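(* Let $C,K,L\in\mathbb{R}_+$ and assume that for some $q\in[1,2)$ $$\text{(W1)}\qquad \lim_{N\to\infty}\max_{i,k}\frac{\|\Delta W^{N,k}_{t^N_i}\|_\infty}{(\Delta\langle W^N\rangle_{t^N_i})^{q/4}}=0 .$$ Then there exists $N_0\in\mathbb{N}$ such that for every $N\ge N_0$, all drivers $f^N_1\ge f^N_2$ and all terminal conditions $\xi^N_1\ge\xi^N_2$ satisfying, for $m=1,2$, (i) $\|\xi^N_m\|_\infty\le C$, (ii) $|f^N_m(t,y,z)|\le K(1+|y|+|z|^q)$ for all $(t,y,z)\in[0,T]\times\mathbb{R}^{d+1}$, (iii) $|f^N_m(t,y_1,z)-f^N_m(t,y_2,z)|\le L(1+|z|^q)|y_1-y_2|$ for all $(t,y_1,y_2,z)\in[0,T]\times\mathbb{R}^{d+2}$ such that $|y_1|,|y_2|\le (C+1)\exp(KT)$, (iv) $|f^N_m(t,y,z_1)-f^N_m(t,y,z_2)|\le L\big(1+(|z_1|\vee|z_2|)^{q/2}\big)|z_1-z_2|$ for all $(t,y,z_1,z_2)\in[0,T]\times\mathbb{R}^{2d+1}$ such that $|y|\le (C+1)\exp(KT)$, the BS$\Delta$Es with parameters $(f^N_m,\xi^N_m)$ have unique solutions $(Y^N_m,Z^N_m,M^N_m)$, $m=1,2$, and $$(C+1)\exp(K(T-t))\ \ge\ Y^N_{1,t}\ \ge\ Y^N_{2,t}\ \ge\ -(C+1)\exp(K(T-t))\qquad\text{for all }t\in[0,T].$$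
   Context: Fix $T>0$, $d\ge 1$ and a probability space $(\Omega,\mathcal{F},\mathbb{P})$ carrying a $d$-dimensional Brownian motion $W=(W_t)_{t\in[0,T]}$. Equalities and inequalities between random variables are understood $\mathbb{P}$-almost surely; $|\cdot|$ is the Euclidean norm, products of vectors are inner products, $\|\cdot\|_\infty$ is the $L^\infty(\mathbb{P})$-norm. Approximating processes: for each $N\in\mathbb{N}$, $W^N=(W^N_t)_{t\in[0,T]}$ is a $d$-dimensional square-integrable martingale on $(\Omega,\mathcal{F},\mathbb{P})$ starting at $0$ with independent increments, and $(\mathcal{F}^N_t)$ is the filtration generated by $W^N$. It is assumed that: (C1) for every $N$ there are $0=t^N_0<t^N_1<\dots<t^N_{i_N}=T$ with $\lim_{N\to\infty}\sup_i|t^N_{i+1}-t^N_i|=0$ and $W^N$ is constant on each $[t^N_i,t^N_{i+1})$; (C2) $\Delta\langle W^{N,k}\rangle_{t^N_i}=\Delta\langle W^{N,l}\rangle_{t^N_i}>0$ for all $i\ge1$ and $1\le k,l\le d$; (C3) $\lim_{N\to\infty}\mathbb{E}[\sup_{0\le t\le T}|W^N_t-W_t|^2]=0$. Here $\Delta X_{t^N_i}=X_{t^N_i}-X_{t^N_{i-1}}$, and $\langle W^N\rangle_t:=\langle W^{N,k}\rangle_t=\mathbb{E}[(W^{N,k}_t)^2]$ (deterministic, independent of $k$). A driver (for index $N$) is a function $f^N:[0,T]\times\Omega\times\mathbb{R}\times\mathbb{R}^d\to\mathbb{R}$ (dependence on $\omega$ suppressed) that is continuous in $(y,z)$, constant in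 $t$ on the intervals $(t^N_i,t^N_{i+1}]$, and such that $\omega\mapsto f^N(t^N_{i+1},\omega,y,z)$ is $\mathcal{F}^N_{t^N_i}$-measurable. A terminal condition $\xi^N$ is an $\mathcal{F}^N_T$-measurable random variable. $f^N_1\ge f^N_2$ means $f^N_1(t,y,z)\ge f^N_2(t,y,z)$ for all $t,y,z$. A solution of the $N$th BS$\Delta$E with parameters $(f^N,\xi^N)$ is a triple of $(\mathcal{F}^N_t)$-adapted processes $(Y^N,Z^N,M^N)$ with values in $\mathbb{R}\times\mathbb{R}^d\times\mathbb{R}$ such that $Y^N$ is constant on the intervals $[t^N_i,t^N_{i+1})$, $Z^N$ is constant on the intervals $(t^N_i,t^N_{i+1}]$, $M^N$ is a square-integrable martingale starting at $0$, orthogonal to $W^N$ and constant on the intervals $[t^N_i,t^N_{i+1})$, $Y^N_T=\xi^N$ and $$Y^N_{t^N_i}=Y^N_{t^N_{i+1}}+f^N(t^N_{i+1},Y^N_{t^N_i},Z^N_{t^N_{i+1}})\Delta\langle W^N\rangle_{t^N_{i+1}}-Z^N_{t^N_{i+1}}\Delta W^N_{t^N_{i+1}}-\Delta M^N_{t^N_{i+1}}.$$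
   Formalization: The components of each W^N are additionally assumed uncorrelated, E[W^{N,k}_t W^{N,l}_t] = 0 for k ≠ l; without this, for d ≥ 2, two components may share an increment in a step, and then uniqueness and the bound fail. *)

theory Defs
  imports "HOL-Probability.Probability"
begin

section \<open>Processes on the time interval [0, T]\<close>

text \<open>A process is a function \<open>X :: real \<Rightarrow> 'a \<Rightarrow> _\<close>; only its values at times in \<open>{0..T}\<close> matter.
  Equalities and inequalities between random variables hold almost surely, whereas path
  properties (``constant on an interval'', ``continuous in (y, z)'') and measurability are
  properties of the functions themselves. Filtrations are not completed.\<close>

definition natural_filtration ::
    "'a measure \<Rightarrow> (real \<Rightarrow> 'a \<Rightarrow> 'b::topological_space) \<Rightarrow> real \<Rightarrow> 'a measure" where
  "natural_filtration M X t =
     sigma (space M) (\<Union>s\<in>{0..t}. {X s -` A \<inter> space M | A. A \<in> sets borel})"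

definition adapted ::
    "real \<Rightarrow> (real \<Rightarrow> 'a measure) \<Rightarrow> (real \<Rightarrow> 'a \<Rightarrow> 'b::topological_space) \<Rightarrow> bool" where
  "adapted T F X \<longleftrightarrow> (\<forall>t\<in>{0..T}. X t \<in> borel_measurable (F t))"

definition martingale ::
    "'a measure \<Rightarrow> real \<Rightarrow> (real \<Rightarrow> 'a measure) \<Rightarrow> (real \<Rightarrow> 'a \<Rightarrow> real) \<Rightarrow> bool" where
  "martingale M T F X \<longleftrightarrow>
     adapted T F X \<and>
     (\<forall>t\<in>{0..T}. integrable M (X t)) \<and>
     (\<forall>s\<in>{0..T}. \<forall>t\<in>{s..T}. AE \<omega> in M. real_cond_exp M (F s) (X t) \<omega> = X s \<omega>)"

definition square_integrable_martingale ::
    "'a measure \<Rightarrow> real \<Rightarrow> (real \<Rightarrow> 'a measure) \<Rightarrow> (real \<Rightarrow> 'a \<Rightarrow> real) \<Rightarrow> bool" where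
  "square_integrable_martingale M T F X \<longleftrightarrow>
     martingale M T F X \<and> (\<forall>t\<in>{0..T}. integrable M (\<lambda>\<omega>. (X t \<omega>)\<^sup>2))"

definition independent_increments ::
    "'a measure \<Rightarrow> real \<Rightarrow> (real \<Rightarrow> 'a \<Rightarrow> 'b::{topological_space, minus}) \<Rightarrow> bool" where
  "independent_increments M T X \<longleftrightarrow>
     (\<forall>s\<in>{0..T}. \<forall>t\<in>{s..T}.
        prob_space.indep_set M (sets (natural_filtration M X s))
          {(\<lambda>\<omega>. X t \<omega> - X s \<omega>) -` A \<inter> space M | A. A \<in> sets borel})"

definition brownian_motion ::
    "'a measure \<Rightarrow> real \<Rightarrow> (real \<Rightarrow> 'a \<Rightarrow> real^'d::finite) \<Rightarrow> bool" where
  "brownian_motion M T W \<longleftrightarrow>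
     (\<forall>t\<in>{0..T}. W t \<in> borel_measurable M) \<and>
     (AE \<omega> in M. W 0 \<omega> = 0) \<and>
     (AE \<omega> in M. continuous_on {0..T} (\<lambda>t. W t \<omega>)) \<and>
     independent_increments M T W \<and>
     (\<forall>s\<in>{0..T}. \<forall>t\<in>{s<..T}.
        prob_space.indep_vars M (\<lambda>_. borel) (\<lambda>k \<omega>. (W t \<omega> - W s \<omega>) $ k) UNIV \<and>
        (\<forall>k. distributed M lborel (\<lambda>\<omega>. (W t \<omega> - W s \<omega>) $ k) (normal_density 0 (sqrt (t - s)))))"

definition Linf_norm :: "'a measure \<Rightarrow> ('a \<Rightarrow> real) \<Rightarrow> ereal" where
  "Linf_norm M X = esssup M (\<lambda>\<omega>. ereal \<bar>X \<omega>\<bar>)"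

section \<open>Approximating processes\<close>

text \<open>A grid is given by its last index \<open>n\<close> and the points \<open>\<tau> 0, \<dots>, \<tau> n\<close>.\<close>

definition is_grid :: "real \<Rightarrow> nat \<Rightarrow> (nat \<Rightarrow> real) \<Rightarrow> bool" where
  "is_grid T n \<tau> \<longleftrightarrow> \<tau> 0 = 0 \<and> \<tau> n = T \<and> (\<forall>i<n. \<tau> i < \<tau> (Suc i))"

definition mesh :: "nat \<Rightarrow> (nat \<Rightarrow> real) \<Rightarrow> real" where
  "mesh n \<tau> = Max ((\<lambda>i. \<bar>\<tau> (Suc i) - \<tau> i\<bar>) ` {..<n})"

definition increment :: "(nat \<Rightarrow> real) \<Rightarrow> (real \<Rightarrow> 'b::minus) \<Rightarrow> nat \<Rightarrow> 'b" where
  "increment \<tau> X i = X (\<tau> i) - X (\<tau> (i - 1))"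

definition constant_right_open :: "'a measure \<Rightarrow> nat \<Rightarrow> (nat \<Rightarrow> real) \<Rightarrow> (real \<Rightarrow> 'a \<Rightarrow> 'b) \<Rightarrow> bool" where
  "constant_right_open M n \<tau> X \<longleftrightarrow>
     (\<forall>i<n. \<forall>t\<in>{\<tau> i..<\<tau> (Suc i)}. \<forall>\<omega>\<in>space M. X t \<omega> = X (\<tau> i) \<omega>)"

definition constant_left_open :: "'a measure \<Rightarrow> nat \<Rightarrow> (nat \<Rightarrow> real) \<Rightarrow> (real \<Rightarrow> 'a \<Rightarrow> 'b) \<Rightarrow> bool" where
  "constant_left_open M n \<tau> X \<longleftrightarrow>
     (\<forall>i<n. \<forall>t\<in>{\<tau> i<..\<tau> (Suc i)}. \<forall>\<omega>\<in>space M. X t \<omega> = X (\<tau> (Suc i)) \<omega>)"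

text \<open>For a square-integrable martingale with independent increments starting at 0, the
  predictable quadratic variation of the \<open>k\<close>-th component is deterministic and equal to its
  second moment.\<close>

definition component_bracket ::
    "'a measure \<Rightarrow> (real \<Rightarrow> 'a \<Rightarrow> real^'d::finite) \<Rightarrow> 'd \<Rightarrow> real \<Rightarrow> real" where
  "component_bracket M X k t = (\<integral>\<omega>. (X t \<omega> $ k)\<^sup>2 \<partial>M)"

text \<open>The common value of the component brackets; meaningful only if they agree.\<close>

definition bracket :: "'a measure \<Rightarrow> (real \<Rightarrow> 'a \<Rightarrow> real^'d::finite) \<Rightarrow> real \<Rightarrow> real" where
  "bracket M X t = (THE c. \<forall>k. component_bracket M X k t = c)"

definition approximating_process ::
    "'a measure \<Rightarrow> real \<Rightarrow> (real \<Rightarrow> 'a \<Rightarrow> real^'d::finite) \<Rightarrow> bool" where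
  "approximating_process M T X \<longleftrightarrow>
     (\<forall>k. square_integrable_martingale M T (natural_filtration M X) (\<lambda>t \<omega>. X t \<omega> $ k)) \<and>
     (AE \<omega> in M. X 0 \<omega> = 0) \<and>
     independent_increments M T X"

definition equal_positive_brackets ::
    "'a measure \<Rightarrow> nat \<Rightarrow> (nat \<Rightarrow> real) \<Rightarrow> (real \<Rightarrow> 'a \<Rightarrow> real^'d::finite) \<Rightarrow> bool" where
  "equal_positive_brackets M n \<tau> X \<longleftrightarrow>
     (\<forall>i\<in>{1..n}. \<forall>k l.
        increment \<tau> (component_bracket M X k) i = increment \<tau> (component_bracket M X l) i \<and>
        increment \<tau> (component_bracket M X k) i > 0)"

text \<open>The mixed brackets of the components vanish, i.e. the matrix-valued bracket is the scalar
  \<open>bracket M X t\<close> times the identity matrix. This is vacuous in dimension one. In higher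
  dimension it is needed: if two components of the driving martingale had the same increment in
  some step, then \<open>Z\<close> could be changed by any multiple of their difference in that step, so that
  solutions would be neither unique nor bounded.\<close>

definition orthogonal_components ::
    "'a measure \<Rightarrow> real \<Rightarrow> (real \<Rightarrow> 'a \<Rightarrow> real^'d::finite) \<Rightarrow> bool" where
  "orthogonal_components M T X \<longleftrightarrow>
     (\<forall>t\<in>{0..T}. \<forall>k l. k \<noteq> l \<longrightarrow> (\<integral>\<omega>. X t \<omega> $ k * X t \<omega> $ l \<partial>M) = 0)"

section \<open>Backward stochastic difference equations\<close>

definition is_driver ::
    "'a measure \<Rightarrow> real \<Rightarrow> nat \<Rightarrow> (nat \<Rightarrow> real) \<Rightarrow> (real \<Rightarrow> 'a measure)
      \<Rightarrow> (real \<Rightarrow> 'a \<Rightarrow> real \<Rightarrow> real^'d::finite \<Rightarrow> real) \<Rightarrow> bool" where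
  "is_driver M T n \<tau> F f \<longleftrightarrow>
     (\<forall>t\<in>{0..T}. \<forall>\<omega>\<in>space M. continuous_on UNIV (\<lambda>(y, z). f t \<omega> y z)) \<and>
     constant_left_open M n \<tau> f \<and>
     (\<forall>i<n. \<forall>y z. (\<lambda>\<omega>. f (\<tau> (Suc i)) \<omega> y z) \<in> borel_measurable (F (\<tau> i)))"

text \<open>Orthogonality of martingales means that their product is a martingale.\<close>

definition is_solution ::
    "'a measure \<Rightarrow> real \<Rightarrow> nat \<Rightarrow> (nat \<Rightarrow> real) \<Rightarrow> (real \<Rightarrow> 'a \<Rightarrow> real^'d::finite)
      \<Rightarrow> (real \<Rightarrow> 'a \<Rightarrow> real \<Rightarrow> real^'d \<Rightarrow> real) \<Rightarrow> ('a \<Rightarrow> real)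
      \<Rightarrow> (real \<Rightarrow> 'a \<Rightarrow> real) \<Rightarrow> (real \<Rightarrow> 'a \<Rightarrow> real^'d) \<Rightarrow> (real \<Rightarrow> 'a \<Rightarrow> real) \<Rightarrow> bool" where
  "is_solution M T n \<tau> X f \<xi> Y Z U \<longleftrightarrow>
     (let F = natural_filtration M X in
       adapted T F Y \<and> constant_right_open M n \<tau> Y \<and>
       adapted T F Z \<and> constant_left_open M n \<tau> Z \<and>
       square_integrable_martingale M T F U \<and>
       (AE \<omega> in M. U 0 \<omega> = 0) \<and>
       (\<forall>k. martingale M T F (\<lambda>t \<omega>. U t \<omega> * X t \<omega> $ k)) \<and>
       constant_right_open M n \<tau> U \<and>
       (AE \<omega> in M. Y T \<omega> = \<xi> \<omega>) \<and>
       (\<forall>i<n. AE \<omega> in M.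
          Y (\<tau> i) \<omega> = Y (\<tau> (Suc i)) \<omega>
            + f (\<tau> (Suc i)) \<omega> (Y (\<tau> i) \<omega>) (Z (\<tau> (Suc i)) \<omega>) * increment \<tau> (bracket M X) (Suc i)
            - Z (\<tau> (Suc i)) \<omega> \<bullet> increment \<tau> (\<lambda>t. X t \<omega>) (Suc i)
            - increment \<tau> (\<lambda>t. U t \<omega>) (Suc i)))"

text \<open>The value of \<open>Z\<close> at time 0 does not enter the equation and is not tied to its values at
  positive times, so uniqueness of \<open>Z\<close> can only refer to the time interval (0, T].\<close>

definition has_unique_solution ::
    "'a measure \<Rightarrow> real \<Rightarrow> nat \<Rightarrow> (nat \<Rightarrow> real) \<Rightarrow> (real \<Rightarrow> 'a \<Rightarrow> real^'d::finite)
      \<Rightarrow> (real \<Rightarrow> 'a \<Rightarrow> real \<Rightarrow> real^'d \<Rightarrow> real) \<Rightarrow> ('a \<Rightarrow> real) \<Rightarrow> bool" where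
  "has_unique_solution M T n \<tau> X f \<xi> \<longleftrightarrow>
     (\<exists>Y Z U. is_solution M T n \<tau> X f \<xi> Y Z U) \<and>
     (\<forall>Y Z U Y' Z' U'.
        is_solution M T n \<tau> X f \<xi> Y Z U \<longrightarrow> is_solution M T n \<tau> X f \<xi> Y' Z' U' \<longrightarrow>
        (AE \<omega> in M. (\<forall>t\<in>{0..T}. Y t \<omega> = Y' t \<omega>) \<and> (\<forall>t\<in>{0<..T}. Z t \<omega> = Z' t \<omega>) \<and>
                    (\<forall>t\<in>{0..T}. U t \<omega> = U' t \<omega>)))"

end

theory Submission
  imports Defs
begin

text \<open>In the step from \<open>t\<^sub>i\<^sub>+\<^sub>1\<close> to \<open>t\<^sub>i\<close>, with \<open>h = \<Delta>\<langle>W\<rangle>\<close>, the equation amounts to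
  \<open>Z = E(Y' \<Delta>W | F) / h\<close>, \<open>Y = E(Y' | F) + f(Y, Z) h\<close>, and \<open>\<Delta>M\<close> is the remainder.
  Two estimates of \<open>Z\<close> are combined: the crude bound \<open>|Z| = O(1 / sqrt h)\<close> for bounded \<open>Y'\<close>, and
  \<open>h |Z| \<le> d \<beta> E(V | F)\<close> when \<open>Y'\<close> is replaced by some \<open>V \<ge> 0\<close>, where \<open>\<beta>\<close> bounds the components
  of \<open>\<Delta>W\<close>. Since \<open>\<beta> = o(h powr (q/4))\<close>, the second estimate, applied to one factor \<open>|Z|\<close> with the
  crude one for the others, lets \<open>E(V | F)\<close> absorb the \<open>z\<close>-dependent part of the driver: with
  \<open>V = a \<mp> Y'\<close> this gives the a priori bound, with \<open>V = Y'\<^sub>1 - Y'\<^sub>2\<close> the comparison, hence uniqueness.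
  The same smallness makes \<open>y \<mapsto> y - f(y, Z) h\<close> strictly increasing, which gives existence.
  The bound propagates through any \<open>a\<close> with \<open>a\<^sub>i\<^sub>+\<^sub>1 + K h \<le> a\<^sub>i (1 - K h)\<close>; it can be kept below \<open>(C + 1) exp(K (T - t)) \<close> because
  \<open>\<langle>W\<rangle>\<close> converges to \<open>t\<close> uniformly and the summand 1 leaves room for the error.\<close>

section \<open>Measurability and conditional expectation\<close>

text \<open>The obstacle is that Z is only known to be of order h^(-1/2), while the driver grows
  like |z|^q and its Lipschitz factors grow like |z|^q and |z|^(q/2). The exponent q/4 in (W1) is
  critical for the comparison: the factor (h^(-1/2))^(q/2) = h^(-q/4) meets \<beta> = \<epsilon>
  h^(q/4), no power of h is left, and the smallness comes from \<epsilon> alone. The sequence a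
  comes from b = a + 1, for which its recursion reads b_(i+1) <= b_i (1 - K h). This is a discrete
  Gronwall inequality, solved by an exponential of the bracket that remains until T. Two gaps in the
  hypotheses shape the statements. Solutions carry no integrability of Y and Z, so boundedness has
  to be gained backwards in time, each step making the next conditional expectation meaningful. The
  conditions on the driver hold almost surely for each fixed argument only, so the null sets must
  first be made independent of the argument before the random values of Y and Z are
  inserted.\<close>

lemma borel_measurable_vec_iff:
  fixes f :: "'a \<Rightarrow> real^'d::finite"
  shows "f \<in> borel_measurable N \<longleftrightarrow> (\<forall>k. (\<lambda>x. f x $ k) \<in> borel_measurable N)"
proof
  assume f: "f \<in> borel_measurable N"
  show "\<forall>k. (\<lambda>x. f x $ k) \<in> borel_measurable N"
    by (intro allI borel_measurable_continuous_on[OF _ f, of "\<lambda>v. v $ _"] continuous_intros)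
next
  assume "\<forall>k. (\<lambda>x. f x $ k) \<in> borel_measurable N"
  then have [measurable]: "(\<lambda>x. f x $ k) \<in> borel_measurable N" for k by blast
  have "f = (\<lambda>x. \<Sum>k\<in>UNIV. (f x $ k) *\<^sub>R axis k 1)"
    by (auto simp: scalar_mult_eq_scaleR[symmetric] basis_expansion)
  moreover have "\<dots> \<in> borel_measurable N" by measurable
  ultimately show "f \<in> borel_measurable N" by simp
qed

text \<open>A countable dense set of arguments yields one null set, and continuity extends the
  inequality to all other arguments. The dense set is taken inside S because the Lipschitz bounds of
  the driver are available for bounded y only.\<close>

lemma AE_forall_le_continuous:
  fixes \<phi> \<psi> :: "'a \<Rightarrow> 'b::{metric_space, second_countable_topology} \<Rightarrow> real"
  assumes \<phi>: "\<And>\<omega>. \<omega> \<in> space M \<Longrightarrow> continuous_on S (\<phi> \<omega>)"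
    and \<psi>: "\<And>\<omega>. \<omega> \<in> space M \<Longrightarrow> continuous_on S (\<psi> \<omega>)"
    and le: "\<And>x. x \<in> S \<Longrightarrow> AE \<omega> in M. \<phi> \<omega> x \<le> \<psi> \<omega> x"
  shows "AE \<omega> in M. \<forall>x\<in>S. \<phi> \<omega> x \<le> \<psi> \<omega> x"
proof -
  obtain D where D: "countable D" "D \<subseteq> S" "S \<subseteq> closure D"
    using separable[of S] by blast
  have "AE \<omega> in M. \<forall>x\<in>D. \<phi> \<omega> x \<le> \<psi> \<omega> x"
    using D le by (subst AE_ball_countable) auto
  then show ?thesis
    using AE_space
  proof eventually_elim
    case (elim \<omega>)
    show ?case
    proof
      fix x assume x: "x \<in> S"
      then obtain d where d: "\<And>j. d j \<in> D" "d \<longlonglongrightarrow> x"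
        using D(3) by (meson closure_sequential subsetD)
      have "(\<lambda>j. \<phi> \<omega> (d j)) \<longlonglongrightarrow> \<phi> \<omega> x" "(\<lambda>j. \<psi> \<omega> (d j)) \<longlonglongrightarrow> \<psi> \<omega> x"
        using \<phi>[of \<omega>] \<psi>[of \<omega>] elim d D(2) x
        by (auto intro!: continuous_on_tendsto_compose[of S] simp: subset_iff)
      then show "\<phi> \<omega> x \<le> \<psi> \<omega> x"
        by (rule LIMSEQ_le) (use elim d in auto)
    qed
  qed
qed

text \<open>Inserting a simple function only patches countably many sections of g together, and
  continuity carries measurability to the limit. It makes the driver evaluated at Y and Z measurable
  with respect to the uncompleted past.\<close>

lemma borel_measurable_Caratheodory:
  fixes g :: "'a \<Rightarrow> 'b::{metric_space, second_countable_topology} \<Rightarrow> real"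
  assumes cont: "\<And>\<omega>. \<omega> \<in> space N \<Longrightarrow> continuous_on UNIV (g \<omega>)"
    and meas: "\<And>x. (\<lambda>\<omega>. g \<omega> x) \<in> borel_measurable N"
    and u: "u \<in> borel_measurable N"
  shows "(\<lambda>\<omega>. g \<omega> (u \<omega>)) \<in> borel_measurable N"
proof -
  obtain s where s: "\<And>j. simple_function N (s j)" "\<And>\<omega>. \<omega> \<in> space N \<Longrightarrow> (\<lambda>j. s j \<omega>) \<longlonglongrightarrow> u \<omega>"
    using borel_measurable_implies_sequence_metric[OF u, of undefined] by metis
  show ?thesis
  proof (rule borel_measurable_LIMSEQ_metric)
    show "(\<lambda>\<omega>. g \<omega> (s j \<omega>)) \<in> borel_measurable N" for j
    proof (rule measurable_compose_countable'[where I = "s j ` space N"])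
      show "s j \<in> measurable N (count_space (s j ` space N))"
        by (rule measurableI) (auto intro: measurable_sets[OF measurable_simple_function[OF s(1)]])
      show "countable (s j ` space N)"
        using s(1)[of j] by (auto simp: simple_function_def countable_finite)
    qed (rule meas)
    show "(\<lambda>j. g \<omega> (s j \<omega>)) \<longlonglongrightarrow> g \<omega> (u \<omega>)" if "\<omega> \<in> space N" for \<omega>
      by (rule continuous_on_tendsto_compose[OF cont[OF that] s(2)[OF that]]) auto
  qed
qed

text \<open>Over an event of G the integral factorises into the probability of the event and the
  mean, which is what characterises a constant as conditional expectation.\<close>

lemma (in prob_space) real_cond_exp_indep:
  fixes g :: "'a \<Rightarrow> 'b::topological_space" and \<phi> :: "'b \<Rightarrow> real"
  assumes G: "subalgebra M G"
    and g: "g \<in> borel_measurable M" and \<phi>: "\<phi> \<in> borel_measurable borel"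
    and ind: "indep_set (sets G) {g -` A \<inter> space M | A. A \<in> sets borel}"
    and int: "integrable M (\<lambda>\<omega>. \<phi> (g \<omega>))"
  shows "AE \<omega> in M. real_cond_exp M G (\<lambda>\<omega>. \<phi> (g \<omega>)) \<omega> = expectation (\<lambda>\<omega>. \<phi> (g \<omega>))"
proof -
  interpret finite_measure_subalgebra M G using G by unfold_locales
  have [measurable]: "(\<lambda>\<omega>. \<phi> (g \<omega>)) \<in> borel_measurable M" using int by simp
  have spG: "space G = space M" and sub: "sets G \<subseteq> sets M" using G by (auto simp: subalgebra_def)
  show ?thesis
  proof (rule real_cond_exp_charact)
    fix A assume A: "A \<in> sets G"
    then have AM [measurable]: "A \<in> sets M" using sub by auto
    have [measurable]: "(indicator A :: 'a \<Rightarrow> real) \<in> borel_measurable G" using A by simp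
    have iv: "indep_var borel (indicator A :: 'a \<Rightarrow> real) borel (\<lambda>\<omega>. \<phi> (g \<omega>))"
      unfolding indep_var_eq
    proof (intro conjI indep_setI)
      show "random_variable borel (indicator A :: 'a \<Rightarrow> real)" by measurable
      have 1: "sigma_sets (space M) {(indicator A :: 'a \<Rightarrow> real) -` B \<inter> space M |B. B \<in> sets borel} \<subseteq> sets G"
      proof (rule subsetI)
        fix X assume "X \<in> sigma_sets (space M) {(indicator A :: 'a \<Rightarrow> real) -` B \<inter> space M |B. B \<in> sets borel}"
        then show "X \<in> sets G"
          unfolding spG[symmetric]
        proof (induction rule: sigma_sets.induct)
          case (Basic a)
          then show ?case using measurable_sets[of "indicator A :: 'a \<Rightarrow> real" G borel] by auto
        qed auto
      qed
      \<comment> \<open>The preimages under g already form a sigma-algebra, so independence passes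
        to the composition with \<phi> without an argument on generators.\<close>
      have 2: "sigma_sets (space M) {(\<lambda>\<omega>. \<phi> (g \<omega>)) -` B \<inter> space M |B. B \<in> sets borel}
          \<subseteq> {g -` A \<inter> space M | A. A \<in> sets borel}"
      proof -
        have "{g -` A \<inter> space M | A. A \<in> sets borel} = sigma_sets (space M) {g -` A \<inter> space M | A. A \<in> sets borel}"
          using sigma_sets_vimage_commute[of g "space M" UNIV "sets borel",
              unfolded sets.sigma_sets_eq[of borel, unfolded space_borel]]
          by simp
        moreover have "{(\<lambda>\<omega>. \<phi> (g \<omega>)) -` B \<inter> space M |B. B \<in> sets borel} \<subseteq> {g -` A \<inter> space M | A. A \<in> sets borel}"
        proof safe
          fix B :: "real set" assume "B \<in> sets borel"
          then have "\<phi> -` B \<in> sets borel" using measurable_sets[OF \<phi>, of B] by simp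
          then show "\<exists>Aa. (\<lambda>\<omega>. \<phi> (g \<omega>)) -` B \<inter> space M = g -` Aa \<inter> space M \<and> Aa \<in> sets borel"
            by (intro exI[of _ "\<phi> -` B"]) auto
        qed
        ultimately show ?thesis
          using sigma_sets_mono'[of "{(\<lambda>\<omega>. \<phi> (g \<omega>)) -` B \<inter> space M |B. B \<in> sets borel}"
              "{g -` A \<inter> space M | A. A \<in> sets borel}" "space M"] by simp
      qed
      show "sigma_sets (space M) {(indicator A :: 'a \<Rightarrow> real) -` B \<inter> space M |B. B \<in> sets borel} \<subseteq> events"
        using 1 sub by auto
      show "sigma_sets (space M) {(\<lambda>\<omega>. \<phi> (g \<omega>)) -` B \<inter> space M |B. B \<in> sets borel} \<subseteq> events"
        using 2 indep_setD_ev2[OF ind] by auto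
      show "prob (a \<inter> b) = prob a * prob b"
        if "a \<in> sigma_sets (space M) {(indicator A :: 'a \<Rightarrow> real) -` B \<inter> space M |B. B \<in> sets borel}"
          "b \<in> sigma_sets (space M) {(\<lambda>\<omega>. \<phi> (g \<omega>)) -` B \<inter> space M |B. B \<in> sets borel}" for a b
        by (rule indep_setD[OF ind subsetD[OF 1 that(1)] subsetD[OF 2 that(2)]])
    qed measurable
    have "(\<integral>\<omega>\<in>A. \<phi> (g \<omega>) \<partial>M) = (\<integral>\<omega>. indicator A \<omega> * \<phi> (g \<omega>) \<partial>M)"
      by (simp add: set_lebesgue_integral_def)
    also have "\<dots> = (\<integral>\<omega>. indicator A \<omega> \<partial>M) * (\<integral>\<omega>. \<phi> (g \<omega>) \<partial>M)"
      by (rule indep_var_lebesgue_integral[OF iv _ int])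
        (simp add: integrable_real_indicator emeasure_eq_measure)
    also have "\<dots> = (\<integral>\<omega>\<in>A. expectation (\<lambda>\<omega>. \<phi> (g \<omega>)) \<partial>M)"
      unfolding set_lebesgue_integral_def by simp
    finally show "(\<integral>\<omega>\<in>A. \<phi> (g \<omega>) \<partial>M) = (\<integral>\<omega>\<in>A. expectation (\<lambda>\<omega>. \<phi> (g \<omega>)) \<partial>M)" .
  qed (use int in simp_all)
qed

section \<open>Projection on a single increment\<close>

text \<open>Takes the place of a conditional Cauchy-Schwarz inequality: if the conditional second
  moment of d is h and s = sqrt h, then the right-hand side has conditional mean exactly sqrt
  h.\<close>

lemma abs_le_sum_squares_over:
  fixes d s :: real
  assumes "s > 0"
  shows "\<bar>d\<bar> \<le> (d * d + s * s) / (2 * s)"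
proof -
  have "0 \<le> (\<bar>d\<bar> - s)\<^sup>2" by simp
  then have "\<bar>d\<bar> * (2 * s) \<le> d * d + s * s"
    by (simp add: power2_eq_square algebra_simps)
  then show ?thesis using assms by (simp add: pos_le_divide_eq)
qed

text \<open>The roles are: G is the past of one grid interval, D the increment of the driving
  martingale over it, h the increment of the bracket, and \<beta> the bound supplied by
  (W1).\<close>

locale one_step = prob_space M for M :: "'a measure" +
  fixes G :: "'a measure" and D :: "'a \<Rightarrow> real^'d::finite" and h \<beta> :: real
  assumes subalg_G: "subalgebra M G"
    and D_measurable [measurable]: "D \<in> borel_measurable M"
    and D_bounded: "AE \<omega> in M. \<forall>k. \<bar>D \<omega> $ k\<bar> \<le> \<beta>"
    and D_mean: "AE \<omega> in M. real_cond_exp M G (\<lambda>\<omega>. D \<omega> $ k) \<omega> = 0"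
    and D_cov: "AE \<omega> in M. real_cond_exp M G (\<lambda>\<omega>. D \<omega> $ k * D \<omega> $ l) \<omega> = (if k = l then h else 0)"
    and h_pos: "h > 0"
begin

sublocale finite_measure_subalgebra M G
  using subalg_G by unfold_locales

abbreviation "E \<equiv> real_cond_exp M G"

lemma measurable_from_G: "f \<in> borel_measurable G \<Longrightarrow> f \<in> borel_measurable M"
  using measurable_from_subalg[OF subalg_G] .

lemma D_component_measurable [measurable]: "(\<lambda>\<omega>. D \<omega> $ k) \<in> borel_measurable M"
  using D_measurable borel_measurable_vec_iff by blast

lemma integrable_AE_bounded:
  fixes f :: "'a \<Rightarrow> real"
  assumes "f \<in> borel_measurable M" "AE \<omega> in M. \<bar>f \<omega>\<bar> \<le> c"
  shows "integrable M f"
  using assms by (intro integrable_const_bound[of _ c]) auto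

lemma integrable_times_D:
  fixes f :: "'a \<Rightarrow> real"
  assumes f [measurable]: "integrable M f"
  shows "integrable M (\<lambda>\<omega>. f \<omega> * D \<omega> $ k)"
proof (rule Bochner_Integration.integrable_bound)
  show "integrable M (\<lambda>\<omega>. \<beta> * f \<omega>)" using f by simp
  show "AE \<omega> in M. norm (f \<omega> * D \<omega> $ k) \<le> norm (\<beta> * f \<omega>)"
    using D_bounded
  proof eventually_elim
    case (elim \<omega>)
    then have "\<bar>D \<omega> $ k\<bar> \<le> \<bar>\<beta>\<bar>" by (meson abs_ge_self order_trans)
    then have "\<bar>f \<omega>\<bar> * \<bar>D \<omega> $ k\<bar> \<le> \<bar>f \<omega>\<bar> * \<bar>\<beta>\<bar>" by (intro mult_left_mono) auto
    then show ?case by (simp add: abs_mult mult.commute)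
  qed
qed (use f in measurable)

lemma integrable_D: "integrable M (\<lambda>\<omega>. D \<omega> $ k)"
  using integrable_times_D[of "\<lambda>_. 1"] by simp

lemma integrable_DD: "integrable M (\<lambda>\<omega>. D \<omega> $ k * D \<omega> $ l)"
  using integrable_times_D[OF integrable_D] .

lemma \<beta>_nonneg: "0 \<le> \<beta>"
proof -
  have "AE \<omega> in M. 0 \<le> \<beta>"
    using D_bounded by eventually_elim (meson abs_ge_zero order_trans)
  then show ?thesis by simp
qed

text \<open>A bounded variable has a bounded second moment. With \<beta> = \<epsilon> h^(q/4) this
  is what turns (W1) into smallness of h itself.\<close>

lemma h_le: "h \<le> \<beta>\<^sup>2"
proof -
  fix k :: 'd
  have "AE \<omega> in M. E (\<lambda>\<omega>. D \<omega> $ k * D \<omega> $ k) \<omega> \<le> E (\<lambda>\<omega>. \<beta>\<^sup>2) \<omega>"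
  proof (rule real_cond_exp_mono[OF _ integrable_DD])
    show "AE \<omega> in M. D \<omega> $ k * D \<omega> $ k \<le> \<beta>\<^sup>2"
      using D_bounded
      by eventually_elim (metis abs_mult_self_eq abs_ge_zero mult_mono \<beta>_nonneg power2_eq_square)
  qed simp
  moreover have "AE \<omega> in M. E (\<lambda>\<omega>. \<beta>\<^sup>2) \<omega> = \<beta>\<^sup>2" by simp
  ultimately have "AE \<omega> in M. h \<le> \<beta>\<^sup>2"
    using D_cov[of k k] by eventually_elim simp
  then show ?thesis by simp
qed

text \<open>Since the conditional covariance of D is h times the identity, division by h gives the
  coefficient of the conditional orthogonal projection of f on D. It is the only candidate for
  Z.\<close>

definition proj :: "('a \<Rightarrow> real) \<Rightarrow> 'a \<Rightarrow> real^'d" where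
  "proj f \<omega> = (\<chi> k. E (\<lambda>\<omega>. f \<omega> * D \<omega> $ k) \<omega> / h)"

lemma proj_component: "proj f \<omega> $ k = E (\<lambda>\<omega>. f \<omega> * D \<omega> $ k) \<omega> / h"
  by (simp add: proj_def)

lemma proj_measurable: "proj f \<in> borel_measurable G"
  unfolding borel_measurable_vec_iff proj_component by simp

lemma proj_cong:
  assumes "AE \<omega> in M. f \<omega> = g \<omega>" and [measurable]: "f \<in> borel_measurable M" "g \<in> borel_measurable M"
  shows "AE \<omega> in M. proj f \<omega> = proj g \<omega>"
proof -
  have "AE \<omega> in M. \<forall>k\<in>UNIV. E (\<lambda>\<omega>. f \<omega> * D \<omega> $ k) \<omega> = E (\<lambda>\<omega>. g \<omega> * D \<omega> $ k) \<omega>"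
  proof (subst AE_ball_countable, simp, intro ballI real_cond_exp_cong)
    show "AE \<omega> in M. f \<omega> * D \<omega> $ k = g \<omega> * D \<omega> $ k" for k
      using assms(1) by eventually_elim simp
  qed measurable
  then show ?thesis by eventually_elim (simp add: proj_def)
qed

lemma proj_diff:
  assumes f: "integrable M f" and g: "integrable M g"
  shows "AE \<omega> in M. proj (\<lambda>\<omega>. f \<omega> - g \<omega>) \<omega> = proj f \<omega> - proj g \<omega>"
proof -
  have "AE \<omega> in M. E (\<lambda>\<omega>. f \<omega> * D \<omega> $ k - g \<omega> * D \<omega> $ k) \<omega>
      = E (\<lambda>\<omega>. f \<omega> * D \<omega> $ k) \<omega> - E (\<lambda>\<omega>. g \<omega> * D \<omega> $ k) \<omega>" for k
    by (intro real_cond_exp_diff integrable_times_D f g)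
  then have "AE \<omega> in M. \<forall>k\<in>UNIV. E (\<lambda>\<omega>. (f \<omega> - g \<omega>) * D \<omega> $ k) \<omega>
      = E (\<lambda>\<omega>. f \<omega> * D \<omega> $ k) \<omega> - E (\<lambda>\<omega>. g \<omega> * D \<omega> $ k) \<omega>"
    by (subst AE_ball_countable) (auto simp: left_diff_distrib)
  then show ?thesis
    by eventually_elim (simp add: vec_eq_iff proj_component diff_divide_distrib)
qed

lemma proj_const: "AE \<omega> in M. proj (\<lambda>_. c) \<omega> = 0"
proof -
  have "AE \<omega> in M. E (\<lambda>\<omega>. c * D \<omega> $ k) \<omega> = 0" for k
  proof -
    have "AE \<omega> in M. E (\<lambda>\<omega>. c * D \<omega> $ k) \<omega> = c * E (\<lambda>\<omega>. D \<omega> $ k) \<omega>"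
      by (intro real_cond_exp_cmult integrable_D)
    then show ?thesis using D_mean[of k] by eventually_elim simp
  qed
  then have "AE \<omega> in M. \<forall>k\<in>UNIV. E (\<lambda>\<omega>. c * D \<omega> $ k) \<omega> = 0"
    by (subst AE_ball_countable) auto
  then show ?thesis
    by eventually_elim (simp add: vec_eq_iff proj_component)
qed

text \<open>The G-measurable factors leave the conditional expectation; then the vanishing mean
  removes one term and the covariance keeps only the diagonal of the other. The bounds are pointwise
  because P and Q are going to be truncations.\<close>

lemma cond_exp_bounded_combination:
  assumes P: "P \<in> borel_measurable G" and Q: "Q \<in> borel_measurable G"
    and Pb: "\<And>\<omega>. \<bar>P \<omega>\<bar> \<le> c" and Qb: "\<And>\<omega> l. \<bar>Q \<omega> $ l\<bar> \<le> c"
  shows "AE \<omega> in M. E (\<lambda>\<omega>. P \<omega> + Q \<omega> \<bullet> D \<omega>) \<omega> = P \<omega>"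
    and "AE \<omega> in M. E (\<lambda>\<omega>. (P \<omega> + Q \<omega> \<bullet> D \<omega>) * D \<omega> $ k) \<omega> = h * Q \<omega> $ k"
proof -
  have QG: "(\<lambda>\<omega>. Q \<omega> $ l) \<in> borel_measurable G" for l
    using Q borel_measurable_vec_iff by blast
  note QM = measurable_from_G[OF QG] and PM = measurable_from_G[OF P]
  have Pi: "integrable M P"
    using integrable_AE_bounded[OF PM] Pb by blast
  have Qi: "integrable M (\<lambda>\<omega>. Q \<omega> $ l)" for l
    using integrable_AE_bounded[OF QM] Qb by blast
  note QDi = integrable_times_D[OF Qi]
  have QDDi: "integrable M (\<lambda>\<omega>. Q \<omega> $ l * (D \<omega> $ l * D \<omega> $ k))" for l k
    using integrable_times_D[OF QDi] by (simp add: mult.assoc)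
  have "AE \<omega> in M. E (\<lambda>\<omega>. P \<omega> + (\<Sum>l\<in>UNIV. Q \<omega> $ l * D \<omega> $ l)) \<omega>
      = E P \<omega> + E (\<lambda>\<omega>. \<Sum>l\<in>UNIV. Q \<omega> $ l * D \<omega> $ l) \<omega>"
    by (intro real_cond_exp_add Pi Bochner_Integration.integrable_sum QDi)
  moreover have "AE \<omega> in M. E P \<omega> = P \<omega>"
    by (intro real_cond_exp_F_meas Pi P)
  moreover have "AE \<omega> in M. E (\<lambda>\<omega>. \<Sum>l\<in>UNIV. Q \<omega> $ l * D \<omega> $ l) \<omega>
      = (\<Sum>l\<in>UNIV. E (\<lambda>\<omega>. Q \<omega> $ l * D \<omega> $ l) \<omega>)"
    by (intro real_cond_exp_sum QDi)
  moreover have "AE \<omega> in M. \<forall>l\<in>UNIV. E (\<lambda>\<omega>. Q \<omega> $ l * D \<omega> $ l) \<omega> = Q \<omega> $ l * E (\<lambda>\<omega>. D \<omega> $ l) \<omega>"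
    by (subst AE_ball_countable) (auto intro!: real_cond_exp_mult QDi QG)
  moreover have "AE \<omega> in M. \<forall>l\<in>UNIV. E (\<lambda>\<omega>. D \<omega> $ l) \<omega> = 0"
    by (subst AE_ball_countable) (auto intro!: D_mean)
  ultimately show "AE \<omega> in M. E (\<lambda>\<omega>. P \<omega> + Q \<omega> \<bullet> D \<omega>) \<omega> = P \<omega>"
    unfolding inner_vec_def inner_real_def by eventually_elim simp
  have eq: "(\<lambda>\<omega>. (P \<omega> + Q \<omega> \<bullet> D \<omega>) * D \<omega> $ k)
      = (\<lambda>\<omega>. P \<omega> * D \<omega> $ k + (\<Sum>l\<in>UNIV. Q \<omega> $ l * (D \<omega> $ l * D \<omega> $ k)))"
    by (auto simp: inner_vec_def distrib_right sum_distrib_right mult.assoc)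
  have "AE \<omega> in M. E (\<lambda>\<omega>. (P \<omega> + Q \<omega> \<bullet> D \<omega>) * D \<omega> $ k) \<omega>
      = E (\<lambda>\<omega>. P \<omega> * D \<omega> $ k) \<omega> + E (\<lambda>\<omega>. \<Sum>l\<in>UNIV. Q \<omega> $ l * (D \<omega> $ l * D \<omega> $ k)) \<omega>"
    unfolding eq
    by (intro real_cond_exp_add integrable_times_D Pi Bochner_Integration.integrable_sum QDDi)
  moreover have "AE \<omega> in M. E (\<lambda>\<omega>. P \<omega> * D \<omega> $ k) \<omega> = P \<omega> * E (\<lambda>\<omega>. D \<omega> $ k) \<omega>"
    by (intro real_cond_exp_mult P integrable_times_D Pi) simp
  moreover have "AE \<omega> in M. E (\<lambda>\<omega>. \<Sum>l\<in>UNIV. Q \<omega> $ l * (D \<omega> $ l * D \<omega> $ k)) \<omega>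
      = (\<Sum>l\<in>UNIV. E (\<lambda>\<omega>. Q \<omega> $ l * (D \<omega> $ l * D \<omega> $ k)) \<omega>)"
    by (intro real_cond_exp_sum QDDi)
  moreover have "AE \<omega> in M. \<forall>l\<in>UNIV. E (\<lambda>\<omega>. Q \<omega> $ l * (D \<omega> $ l * D \<omega> $ k)) \<omega>
      = Q \<omega> $ l * E (\<lambda>\<omega>. D \<omega> $ l * D \<omega> $ k) \<omega>"
    by (subst AE_ball_countable) (auto intro!: real_cond_exp_mult QDDi QG)
  moreover have "AE \<omega> in M. \<forall>l\<in>UNIV. E (\<lambda>\<omega>. D \<omega> $ l * D \<omega> $ k) \<omega> = (if l = k then h else 0)"
    using D_cov by (subst AE_ball_countable) auto
  moreover note D_mean[of k]
  ultimately show "AE \<omega> in M. E (\<lambda>\<omega>. (P \<omega> + Q \<omega> \<bullet> D \<omega>) * D \<omega> $ k) \<omega> = h * Q \<omega> $ k"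
    by eventually_elim (simp add: if_distrib[of "\<lambda>x. _ * x"] cong: if_cong)
qed

text \<open>No integrability of \<open>A\<close> and \<open>Z\<close> is assumed: truncate on the \<open>G\<close>-measurable events
  where both are bounded by \<open>m\<close>.\<close>

lemma decomposition_unique:
  assumes A: "A \<in> borel_measurable G" and Z: "Z \<in> borel_measurable G"
    and R: "integrable M R"
    and eq: "AE \<omega> in M. R \<omega> = A \<omega> + Z \<omega> \<bullet> D \<omega>"
  shows "AE \<omega> in M. A \<omega> = E R \<omega> \<and> Z \<omega> = proj R \<omega>"
proof -
  define I :: "nat \<Rightarrow> 'a \<Rightarrow> real" where
    "I m \<omega> = (if \<bar>A \<omega>\<bar> \<le> real m \<and> norm (Z \<omega>) \<le> real m then 1 else 0)" for m \<omega>
  have IG: "I m \<in> borel_measurable G" for m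
    unfolding I_def using A Z by measurable
  have PG: "(\<lambda>\<omega>. I m \<omega> * A \<omega>) \<in> borel_measurable G" for m
    using IG A by (intro borel_measurable_times)
  have QG: "(\<lambda>\<omega>. I m \<omega> *\<^sub>R Z \<omega>) \<in> borel_measurable G" for m
    using IG Z by (intro borel_measurable_scaleR)
  have Pb: "\<bar>I m \<omega> * A \<omega>\<bar> \<le> real m" for m \<omega> by (auto simp: I_def)
  have Qb: "\<bar>(I m \<omega> *\<^sub>R Z \<omega>) $ l\<bar> \<le> real m" for m \<omega> l
    using component_le_norm_cart[of "Z \<omega>" l] by (auto simp: I_def)
  note comb = cond_exp_bounded_combination[OF PG QG Pb Qb]
  have [measurable]: "R \<in> borel_measurable M" using R by simp
  have mM [measurable]: "I m \<in> borel_measurable M" "A \<in> borel_measurable M" "Z \<in> borel_measurable M" for m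
    using IG A Z measurable_from_subalg[OF subalg_G] by auto
  have ZM [measurable]: "(\<lambda>\<omega>. Z \<omega> \<bullet> D \<omega>) \<in> borel_measurable M" by measurable
  have IR: "integrable M (\<lambda>\<omega>. I m \<omega> * R \<omega>)" for m
    by (rule Bochner_Integration.integrable_bound[OF R]) (auto simp: I_def)
  have IReq: "AE \<omega> in M. I m \<omega> * R \<omega> = I m \<omega> * A \<omega> + (I m \<omega> *\<^sub>R Z \<omega>) \<bullet> D \<omega>" for m
    using eq by eventually_elim (simp add: distrib_left)
  have 1: "AE \<omega> in M. I m \<omega> * E R \<omega> = I m \<omega> * A \<omega>" for m
  proof -
    have "AE \<omega> in M. E (\<lambda>\<omega>. I m \<omega> * R \<omega>) \<omega> = I m \<omega> * E R \<omega>"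
      by (intro real_cond_exp_mult IG IR) simp
    moreover have "AE \<omega> in M. E (\<lambda>\<omega>. I m \<omega> * R \<omega>) \<omega> = E (\<lambda>\<omega>. I m \<omega> * A \<omega> + (I m \<omega> *\<^sub>R Z \<omega>) \<bullet> D \<omega>) \<omega>"
      by (rule real_cond_exp_cong[OF IReq]) measurable
    ultimately show ?thesis using comb(1)[of m] by eventually_elim simp
  qed
  have 2: "AE \<omega> in M. I m \<omega> * E (\<lambda>\<omega>. R \<omega> * D \<omega> $ k) \<omega> = h * (I m \<omega> * Z \<omega> $ k)" for m k
  proof -
    have "AE \<omega> in M. E (\<lambda>\<omega>. I m \<omega> * (R \<omega> * D \<omega> $ k)) \<omega> = I m \<omega> * E (\<lambda>\<omega>. R \<omega> * D \<omega> $ k) \<omega>"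
      by (intro real_cond_exp_mult IG) (use integrable_times_D[OF IR] in \<open>auto simp: mult.assoc\<close>)
    moreover have "AE \<omega> in M. E (\<lambda>\<omega>. I m \<omega> * (R \<omega> * D \<omega> $ k)) \<omega>
        = E (\<lambda>\<omega>. (I m \<omega> * A \<omega> + (I m \<omega> *\<^sub>R Z \<omega>) \<bullet> D \<omega>) * D \<omega> $ k) \<omega>"
    proof (rule real_cond_exp_cong)
      show "AE \<omega> in M. I m \<omega> * (R \<omega> * D \<omega> $ k) = (I m \<omega> * A \<omega> + (I m \<omega> *\<^sub>R Z \<omega>) \<bullet> D \<omega>) * D \<omega> $ k"
        using IReq[of m] by eventually_elim (metis mult.assoc)
    qed measurable
    ultimately show ?thesis using comb(2)[of m k] by eventually_elim simp
  qed
  have "AE \<omega> in M. \<forall>m. I m \<omega> * E R \<omega> = I m \<omega> * A \<omega>"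
    using 1 by (simp only: AE_all_countable) blast
  moreover have "AE \<omega> in M. \<forall>m. \<forall>k\<in>UNIV. I m \<omega> * E (\<lambda>\<omega>. R \<omega> * D \<omega> $ k) \<omega> = h * (I m \<omega> * Z \<omega> $ k)"
    using 2 by (simp only: AE_all_countable, subst AE_ball_countable) auto
  ultimately show ?thesis
  proof eventually_elim
    case (elim \<omega>)
    obtain m :: nat where m: "max \<bar>A \<omega>\<bar> (norm (Z \<omega>)) \<le> real m" using real_arch_simple by blast
    then have I: "I m \<omega> = 1" by (simp add: I_def)
    show ?case
      using elim(1)[THEN spec, of m] elim(2)[THEN spec, of m] h_pos unfolding I
      by (auto simp: vec_eq_iff proj_component)
  qed
qed

text \<open>Nonnegativity of V allows the two-sided bound of D to be multiplied by V before
  conditioning. The result is linear in \<open>E V\<close>, which is what later lets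
  \<open>E V\<close> absorb the term.\<close>

lemma cond_exp_times_D_le:
  assumes V: "integrable M V" and V0: "AE \<omega> in M. 0 \<le> V \<omega>"
  shows "AE \<omega> in M. \<bar>E (\<lambda>\<omega>. V \<omega> * D \<omega> $ k) \<omega>\<bar> \<le> \<beta> * E V \<omega>"
proof -
  have "AE \<omega> in M. V \<omega> * D \<omega> $ k \<le> \<beta> * V \<omega> \<and> (- \<beta>) * V \<omega> \<le> V \<omega> * D \<omega> $ k"
    using D_bounded V0
  proof eventually_elim
    case (elim \<omega>)
    then have "D \<omega> $ k \<le> \<beta>" "- \<beta> \<le> D \<omega> $ k" by (simp_all add: abs_le_iff minus_le_iff)
    then have "V \<omega> * D \<omega> $ k \<le> V \<omega> * \<beta>" "V \<omega> * (- \<beta>) \<le> V \<omega> * D \<omega> $ k"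
      using elim(2) by (blast intro: mult_left_mono)+
    then show ?case by (simp add: mult.commute)
  qed
  then have le1: "AE \<omega> in M. V \<omega> * D \<omega> $ k \<le> \<beta> * V \<omega>" and le2: "AE \<omega> in M. (- \<beta>) * V \<omega> \<le> V \<omega> * D \<omega> $ k"
    by (eventually_elim, blast)+
  have "AE \<omega> in M. E (\<lambda>\<omega>. V \<omega> * D \<omega> $ k) \<omega> \<le> E (\<lambda>\<omega>. \<beta> * V \<omega>) \<omega>"
    by (rule real_cond_exp_mono[OF le1 integrable_times_D[OF V]]) (intro integrable_mult_right V)
  moreover have "AE \<omega> in M. E (\<lambda>\<omega>. (- \<beta>) * V \<omega>) \<omega> \<le> E (\<lambda>\<omega>. V \<omega> * D \<omega> $ k) \<omega>"
    by (rule real_cond_exp_mono[OF le2 _ integrable_times_D[OF V]]) (intro integrable_mult_right V)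
  moreover have "AE \<omega> in M. E (\<lambda>\<omega>. \<beta> * V \<omega>) \<omega> = \<beta> * E V \<omega>"
    "AE \<omega> in M. E (\<lambda>\<omega>. (- \<beta>) * V \<omega>) \<omega> = (- \<beta>) * E V \<omega>"
    using V by (intro real_cond_exp_cmult; simp)+
  ultimately show ?thesis by eventually_elim auto
qed

lemma h_norm_proj_le:
  assumes V: "integrable M V" and V0: "AE \<omega> in M. 0 \<le> V \<omega>"
  shows "AE \<omega> in M. h * norm (proj V \<omega>) \<le> CARD('d) * \<beta> * E V \<omega>"
proof -
  have "AE \<omega> in M. \<forall>k\<in>UNIV. \<bar>E (\<lambda>\<omega>. V \<omega> * D \<omega> $ k) \<omega>\<bar> \<le> \<beta> * E V \<omega>"
    by (subst AE_ball_countable) (auto intro!: cond_exp_times_D_le assms)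
  then show ?thesis
  proof eventually_elim
    case (elim \<omega>)
    have "h * norm (proj V \<omega>) \<le> h * (\<Sum>k\<in>UNIV. \<bar>proj V \<omega> $ k\<bar>)"
      using h_pos norm_le_l1_cart by (intro mult_left_mono) auto
    also have "\<dots> = (\<Sum>k\<in>UNIV. \<bar>E (\<lambda>\<omega>. V \<omega> * D \<omega> $ k) \<omega>\<bar>)"
      using h_pos by (simp add: sum_distrib_left proj_component)
    also have "\<dots> \<le> of_nat (card (UNIV :: 'd set)) * (\<beta> * E V \<omega>)"
      using elim by (intro sum_bounded_above) auto
    finally show ?case by (simp add: mult.assoc)
  qed
qed

text \<open>A component of D has conditional absolute moment at most sqrt h, so each conditional
  expectation is at most c * sqrt h, and the division by h in \<open>proj\<close> leaves c / sqrt h.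
  The cardinality counts the components.\<close>

lemma norm_proj_le:
  fixes c :: real
  assumes Y [measurable]: "Y \<in> borel_measurable M" and Yb: "AE \<omega> in M. \<bar>Y \<omega>\<bar> \<le> c"
  shows "AE \<omega> in M. norm (proj Y \<omega>) \<le> CARD('d) * c / sqrt h"
proof -
  note Yi = integrable_AE_bounded[OF Y Yb]
  \<comment> \<open>A majorant of c times the absolute component, from
    \<open>abs_le_sum_squares_over\<close> with s = sqrt h; its conditional expectation is computed
    from the covariance.\<close>
  let ?U = "\<lambda>k \<omega>. (c / (2 * sqrt h)) * (D \<omega> $ k * D \<omega> $ k) + c * sqrt h / 2"
  have Ui: "integrable M (?U k)" for k
    using integrable_DD by simp
  have EU: "AE \<omega> in M. E (?U k) \<omega> = c * sqrt h" for k
  proof -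
    have "AE \<omega> in M. E (?U k) \<omega> = E (\<lambda>\<omega>. (c / (2 * sqrt h)) * (D \<omega> $ k * D \<omega> $ k)) \<omega> + E (\<lambda>\<omega>. c * sqrt h / 2) \<omega>"
      using integrable_DD by (intro real_cond_exp_add) auto
    moreover have "AE \<omega> in M. E (\<lambda>\<omega>. (c / (2 * sqrt h)) * (D \<omega> $ k * D \<omega> $ k)) \<omega>
        = (c / (2 * sqrt h)) * E (\<lambda>\<omega>. D \<omega> $ k * D \<omega> $ k) \<omega>"
      using integrable_DD by (intro real_cond_exp_cmult)
    moreover have "AE \<omega> in M. E (\<lambda>\<omega>. c * sqrt h / 2) \<omega> = c * sqrt h / 2"
      by (intro real_cond_exp_F_meas) auto
    moreover note D_cov[of k k]
    ultimately show ?thesis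
    proof eventually_elim
      case (elim \<omega>)
      have "c * h / (2 * sqrt h) = c * (h / sqrt h) / 2" by simp
      also have "h / sqrt h = sqrt h" using h_pos by (intro real_div_sqrt) simp
      finally show ?case using elim by simp
    qed
  qed
  have "AE \<omega> in M. \<bar>E (\<lambda>\<omega>. Y \<omega> * D \<omega> $ k) \<omega>\<bar> \<le> c * sqrt h" for k
  proof -
    have "AE \<omega> in M. Y \<omega> * D \<omega> $ k \<le> ?U k \<omega> \<and> (-1) * ?U k \<omega> \<le> Y \<omega> * D \<omega> $ k"
      using Yb
    proof eventually_elim
      case (elim \<omega>)
      have "\<bar>D \<omega> $ k\<bar> \<le> (D \<omega> $ k * D \<omega> $ k + sqrt h * sqrt h) / (2 * sqrt h)"
        using h_pos by (intro abs_le_sum_squares_over) simp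
      moreover have "\<bar>Y \<omega> * D \<omega> $ k\<bar> \<le> c * \<bar>D \<omega> $ k\<bar>"
        using elim by (auto simp: abs_mult intro: mult_right_mono)
      moreover have "0 \<le> c" using elim by (meson abs_ge_zero order_trans)
      ultimately have "\<bar>Y \<omega> * D \<omega> $ k\<bar> \<le> c * ((D \<omega> $ k * D \<omega> $ k + sqrt h * sqrt h) / (2 * sqrt h))"
        by (meson mult_left_mono order_trans)
      also have "\<dots> = ?U k \<omega>" using h_pos by (simp add: field_simps del: real_sqrt_mult_self)
      finally show ?case by (simp only: abs_le_iff) auto
    qed
    then have le1: "AE \<omega> in M. Y \<omega> * D \<omega> $ k \<le> ?U k \<omega>" and le2: "AE \<omega> in M. (-1) * ?U k \<omega> \<le> Y \<omega> * D \<omega> $ k"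
      by (eventually_elim, blast)+
    have "AE \<omega> in M. E (\<lambda>\<omega>. Y \<omega> * D \<omega> $ k) \<omega> \<le> E (?U k) \<omega>"
      by (rule real_cond_exp_mono[OF le1 integrable_times_D[OF Yi] Ui])
    moreover have "AE \<omega> in M. E (\<lambda>\<omega>. (-1) * ?U k \<omega>) \<omega> \<le> E (\<lambda>\<omega>. Y \<omega> * D \<omega> $ k) \<omega>"
      by (rule real_cond_exp_mono[OF le2 _ integrable_times_D[OF Yi]]) (intro integrable_mult_right Ui)
    moreover have "AE \<omega> in M. E (\<lambda>\<omega>. (-1) * ?U k \<omega>) \<omega> = (-1) * E (?U k) \<omega>"
      by (intro real_cond_exp_cmult Ui)
    ultimately show ?thesis using EU[of k] by eventually_elim auto
  qed
  then have "AE \<omega> in M. \<forall>k\<in>UNIV. \<bar>E (\<lambda>\<omega>. Y \<omega> * D \<omega> $ k) \<omega>\<bar> \<le> c * sqrt h"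
    by (subst AE_ball_countable) auto
  then show ?thesis
  proof eventually_elim
    case (elim \<omega>)
    have "norm (proj Y \<omega>) \<le> (\<Sum>k\<in>UNIV. \<bar>proj Y \<omega> $ k\<bar>)" by (rule norm_le_l1_cart)
    also have "\<dots> \<le> of_nat (card (UNIV :: 'd set)) * (c * sqrt h / h)"
      using elim h_pos by (intro sum_bounded_above) (auto simp: proj_component divide_right_mono)
    also have "c * sqrt h / h = c / sqrt h" using h_pos by (simp add: field_simps)
    finally show ?case by simp
  qed
qed

end

section \<open>A single step with small increments\<close>

text \<open>Each condition has one purpose: \<open>small_K\<close> keeps 1 - K h positive,
  \<open>small_Kz\<close> absorbs the growth in z in the a priori bound, \<open>small_Ly\<close>
  makes the dependence on y a contraction with factor 1/2, and \<open>small_Lz\<close> absorbs the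
  change of z in the comparison. In all of them \<rho> stands for the crude bound of |Z| belonging
  to values bounded by c.\<close>

locale small_step = one_step M G D h \<beta>
  for M :: "'a measure" and G and D :: "'a \<Rightarrow> real^'d::finite" and h \<beta> :: real +
  fixes K L q c \<rho> :: real
  assumes K: "0 \<le> K" and L: "0 \<le> L" and q: "1 \<le> q" and c: "0 < c"
    and \<rho>: "CARD('d) * c / sqrt h \<le> \<rho>"
    and small_K: "K * h \<le> 1 / 2"
    and small_Kz: "K * \<rho> powr (q - 1) * (CARD('d) * \<beta>) \<le> 1"
    and small_Ly: "L * (1 + \<rho> powr q) * h \<le> 1 / 2"
    and small_Lz: "L * (1 + \<rho> powr (q / 2)) * (CARD('d) * \<beta>) \<le> 1"
begin

lemma norm_proj_le_\<rho>:
  assumes Y: "Y \<in> borel_measurable M" and Yb: "AE \<omega> in M. \<bar>Y \<omega>\<bar> \<le> c"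
  shows "AE \<omega> in M. norm (proj Y \<omega>) \<le> \<rho>"
  using norm_proj_le[OF assms] by eventually_elim (use \<rho> in simp)

text \<open>One factor of \<open>norm z powr q\<close> is estimated through the distance of \<open>Y\<close> to the constant \<open>a\<close>,
  the remaining \<open>q - 1\<close> through the crude bound \<open>\<rho>\<close>.\<close>

lemma cond_exp_plus_power_le:
  assumes Y [measurable]: "Y \<in> borel_measurable M" and Yb: "AE \<omega> in M. \<bar>Y \<omega>\<bar> \<le> a" and a: "a \<le> c"
  shows "AE \<omega> in M. \<bar>E Y \<omega>\<bar> + K * norm (proj Y \<omega>) powr q * h \<le> a"
proof -
  note Yi = integrable_AE_bounded[OF Y Yb]
  have Yc: "AE \<omega> in M. \<bar>Y \<omega>\<bar> \<le> c"
    using Yb by eventually_elim (use a in simp)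
  have *: "K * norm z powr q * h \<le> v"
    if z: "norm z \<le> \<rho>" and v: "h * norm z \<le> CARD('d) * \<beta> * v" and v0: "0 \<le> v" for z :: "real^'d" and v
  proof (cases "z = 0")
    case True
    then show ?thesis using v0 by simp
  next
    case False
    then have "norm z powr q = norm z powr (q - 1) * norm z"
      using powr_mult_base[of "norm z" "q - 1"] by (simp add: mult.commute)
    then have "K * norm z powr q * h = K * norm z powr (q - 1) * (h * norm z)" by simp
    also have "\<dots> \<le> K * \<rho> powr (q - 1) * (CARD('d) * \<beta> * v)"
    proof (rule mult_mono[OF _ v])
      show "K * norm z powr (q - 1) \<le> K * \<rho> powr (q - 1)"
        using K q z by (intro mult_left_mono powr_mono2) auto
    qed (use K h_pos in auto)
    also have "\<dots> = (K * \<rho> powr (q - 1) * (CARD('d) * \<beta>)) * v" by simp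
    also have "\<dots> \<le> 1 * v"
      using small_Kz v0 by (rule mult_right_mono)
    finally show ?thesis by simp
  qed
  have int: "integrable M (\<lambda>\<omega>. a - Y \<omega>)" "integrable M (\<lambda>\<omega>. Y \<omega> - (- a))"
    using Yi by auto
  have pos: "AE \<omega> in M. 0 \<le> a - Y \<omega>" "AE \<omega> in M. 0 \<le> Y \<omega> - (- a)"
    using Yb by (eventually_elim, simp add: abs_le_iff)+
  have const: "AE \<omega> in M. E (\<lambda>\<omega>. s) \<omega> = s" for s
    by (intro real_cond_exp_F_meas) auto
  have "AE \<omega> in M. E (\<lambda>\<omega>. a - Y \<omega>) \<omega> = E (\<lambda>\<omega>. a) \<omega> - E Y \<omega>"
    "AE \<omega> in M. E (\<lambda>\<omega>. Y \<omega> - (- a)) \<omega> = E Y \<omega> - E (\<lambda>\<omega>. - a) \<omega>"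
    by (intro real_cond_exp_diff Yi; simp)+
  moreover note const[of a] const[of "- a"] norm_proj_le_\<rho>[OF Y Yc]
  moreover have "AE \<omega> in M. proj (\<lambda>\<omega>. a - Y \<omega>) \<omega> = proj (\<lambda>\<omega>. a) \<omega> - proj Y \<omega>"
    "AE \<omega> in M. proj (\<lambda>\<omega>. Y \<omega> - (- a)) \<omega> = proj Y \<omega> - proj (\<lambda>\<omega>. - a) \<omega>"
    by (intro proj_diff Yi; simp)+
  moreover note proj_const[of a] proj_const[of "- a"]
  moreover note h_norm_proj_le[OF int(1) pos(1)] h_norm_proj_le[OF int(2) pos(2)]
  moreover have "AE \<omega> in M. 0 \<le> E (\<lambda>\<omega>. a - Y \<omega>) \<omega>" "AE \<omega> in M. 0 \<le> E (\<lambda>\<omega>. Y \<omega> - (- a)) \<omega>"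
    using real_cond_exp_pos[OF pos(1)] real_cond_exp_pos[OF pos(2)] by measurable
  ultimately show ?thesis
  proof eventually_elim
    case (elim \<omega>)
    \<comment> \<open>Constants project to 0, so a - Y and Y + a have the projections -
      \<open>proj Y\<close> and \<open>proj Y\<close>, of equal norm. Hence the distances of
      \<open>E Y\<close> to both ends of [-a, a] dominate the same quantity K |z|^q h.\<close>
    from *[of "proj Y \<omega>" "a - E Y \<omega>"] *[of "proj Y \<omega>" "E Y \<omega> + a"] elim show ?case by auto
  qed
qed

text \<open>The driver on one grid interval. The quantifiers over y and z stand inside
  \<open>AE\<close>, so that a single null set serves all arguments and random ones may be inserted;
  \<open>good_driverI\<close> obtains this form.\<close>

definition slice :: "('a \<Rightarrow> real \<Rightarrow> real^'d \<Rightarrow> real) \<Rightarrow> bool" where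
  "slice g \<longleftrightarrow>
    (\<forall>\<omega>\<in>space M. continuous_on UNIV (\<lambda>(y, z). g \<omega> y z)) \<and>
    (\<forall>y z. (\<lambda>\<omega>. g \<omega> y z) \<in> borel_measurable G) \<and>
    (AE \<omega> in M. \<forall>y z. \<bar>g \<omega> y z\<bar> \<le> K * (1 + \<bar>y\<bar> + norm z powr q)) \<and>
    (AE \<omega> in M. \<forall>y1 y2 z. \<bar>y1\<bar> \<le> c \<longrightarrow> \<bar>y2\<bar> \<le> c \<longrightarrow>
       \<bar>g \<omega> y1 z - g \<omega> y2 z\<bar> \<le> L * (1 + norm z powr q) * \<bar>y1 - y2\<bar>) \<and>
    (AE \<omega> in M. \<forall>y z1 z2. \<bar>y\<bar> \<le> c \<longrightarrow>
       \<bar>g \<omega> y z1 - g \<omega> y z2\<bar> \<le> L * (1 + max (norm z1) (norm z2) powr (q / 2)) * norm (z1 - z2))"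

lemma sliceD:
  assumes "slice g"
  shows slice_continuous: "\<And>\<omega>. \<omega> \<in> space M \<Longrightarrow> continuous_on UNIV (\<lambda>(y, z). g \<omega> y z)"
    and slice_measurable: "\<And>y z. (\<lambda>\<omega>. g \<omega> y z) \<in> borel_measurable G"
    and slice_growth: "AE \<omega> in M. \<forall>y z. \<bar>g \<omega> y z\<bar> \<le> K * (1 + \<bar>y\<bar> + norm z powr q)"
    and slice_Lipschitz_y: "AE \<omega> in M. \<forall>y1 y2 z. \<bar>y1\<bar> \<le> c \<longrightarrow> \<bar>y2\<bar> \<le> c \<longrightarrow>
       \<bar>g \<omega> y1 z - g \<omega> y2 z\<bar> \<le> L * (1 + norm z powr q) * \<bar>y1 - y2\<bar>"
    and slice_Lipschitz_z: "AE \<omega> in M. \<forall>y z1 z2. \<bar>y\<bar> \<le> c \<longrightarrow>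
       \<bar>g \<omega> y z1 - g \<omega> y z2\<bar> \<le> L * (1 + max (norm z1) (norm z2) powr (q / 2)) * norm (z1 - z2)"
  using assms unfolding slice_def by blast+

lemma slice_measurable_compose:
  assumes g: "slice g" and Y: "Y \<in> borel_measurable G" and Z: "Z \<in> borel_measurable G"
  shows "(\<lambda>\<omega>. g \<omega> (Y \<omega>) (Z \<omega>)) \<in> borel_measurable G"
proof -
  have sp: "space G = space M" using subalg_G by (simp add: subalgebra_def)
  have "(\<lambda>\<omega>. (\<lambda>(y, z). g \<omega> y z) (Y \<omega>, Z \<omega>)) \<in> borel_measurable G"
  proof (rule borel_measurable_Caratheodory[where g = "\<lambda>\<omega> (y, z). g \<omega> y z"])
    show "(\<lambda>\<omega>. (Y \<omega>, Z \<omega>)) \<in> borel_measurable G"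
      using Y Z by (rule borel_measurable_Pair)
  qed (use slice_continuous[OF g] slice_measurable[OF g] sp in auto)
  then show ?thesis by simp
qed

text \<open>By \<open>cond_exp_plus_power_le\<close> the part K |z|^q h of the growth bound fits
  into a together with the conditional expectation. What remains is linear in |Y| and can be solved
  for |Y|.\<close>

lemma a_priori_bound:
  assumes g: "slice g"
    and Y' [measurable]: "Y' \<in> borel_measurable M" and bd: "AE \<omega> in M. \<bar>Y' \<omega>\<bar> \<le> a" and a: "a \<le> c"
    and eq: "AE \<omega> in M. Y \<omega> = E Y' \<omega> + g \<omega> (Y \<omega>) (proj Y' \<omega>) * h"
  shows "AE \<omega> in M. \<bar>Y \<omega>\<bar> \<le> (a + K * h) / (1 - K * h)"
  using cond_exp_plus_power_le[OF Y' bd a] slice_growth[OF g] eq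
proof eventually_elim
  case (elim \<omega>)
  let ?y = "Y \<omega>" and ?z = "proj Y' \<omega>"
  have "\<bar>g \<omega> ?y ?z * h\<bar> \<le> K * (1 + \<bar>?y\<bar> + norm ?z powr q) * h"
    using elim(2) h_pos by (simp add: abs_mult)
  then have "\<bar>?y\<bar> \<le> a + K * h * (1 + \<bar>?y\<bar>)"
    using elim(1,3) by (simp add: algebra_simps)
  then have "\<bar>?y\<bar> * (1 - K * h) \<le> a + K * h" by (simp add: algebra_simps)
  then show ?case using small_K by (simp add: pos_le_divide_eq)
qed

lemma Lipschitz_y_small:
  assumes z: "norm z \<le> \<rho>" and d: "\<bar>d\<bar> \<le> L * (1 + norm z powr q) * e" and e: "0 \<le> e"
  shows "\<bar>d * h\<bar> \<le> e / 2"
proof -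
  have "norm z powr q \<le> \<rho> powr q" using z q by (intro powr_mono2) auto
  then have "L * (1 + norm z powr q) * h \<le> L * (1 + \<rho> powr q) * h"
    using L h_pos by (intro mult_right_mono mult_left_mono) auto
  then have "L * (1 + norm z powr q) * h \<le> 1 / 2" using small_Ly by linarith
  then have "L * (1 + norm z powr q) * h * e \<le> 1 / 2 * e" using e by (rule mult_right_mono)
  moreover have "\<bar>d * h\<bar> \<le> L * (1 + norm z powr q) * e * h"
    using d h_pos by (simp add: abs_mult)
  moreover have "L * (1 + norm z powr q) * e * h = L * (1 + norm z powr q) * h * e" by simp
  ultimately show ?thesis by linarith
qed

text \<open>The difference of the driver terms is telescoped within \<open>g1\<close>, from (y1, z1)
  over (y2, z1) to (y2, z2), and only there exchanged for \<open>g2\<close>. The change of z is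
  governed by the projection of the nonnegative variable Y1' - Y2', so it costs at most the gain in
  the conditional expectations.\<close>

lemma comparison:
  assumes g1: "slice g1"
    and g12: "AE \<omega> in M. \<forall>y z. g2 \<omega> y z \<le> g1 \<omega> y z"
    and Y1' [measurable]: "Y1' \<in> borel_measurable M" and Y2' [measurable]: "Y2' \<in> borel_measurable M"
    and bd1': "AE \<omega> in M. \<bar>Y1' \<omega>\<bar> \<le> c" and bd2': "AE \<omega> in M. \<bar>Y2' \<omega>\<bar> \<le> c"
    and le: "AE \<omega> in M. Y2' \<omega> \<le> Y1' \<omega>"
    and eq1: "AE \<omega> in M. Y1 \<omega> = E Y1' \<omega> + g1 \<omega> (Y1 \<omega>) (proj Y1' \<omega>) * h"
    and eq2: "AE \<omega> in M. Y2 \<omega> = E Y2' \<omega> + g2 \<omega> (Y2 \<omega>) (proj Y2' \<omega>) * h"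
    and bd1: "AE \<omega> in M. \<bar>Y1 \<omega>\<bar> \<le> c" and bd2: "AE \<omega> in M. \<bar>Y2 \<omega>\<bar> \<le> c"
  shows "AE \<omega> in M. Y2 \<omega> \<le> Y1 \<omega>"
proof -
  note i1 = integrable_AE_bounded[OF Y1' bd1'] and i2 = integrable_AE_bounded[OF Y2' bd2']
  have int: "integrable M (\<lambda>\<omega>. Y1' \<omega> - Y2' \<omega>)" using i1 i2 by simp
  have pos: "AE \<omega> in M. 0 \<le> Y1' \<omega> - Y2' \<omega>" using le by eventually_elim simp
  note real_cond_exp_diff[OF i1 i2] proj_diff[OF i1 i2] h_norm_proj_le[OF int pos]
  moreover have "AE \<omega> in M. 0 \<le> E (\<lambda>\<omega>. Y1' \<omega> - Y2' \<omega>) \<omega>"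
    using real_cond_exp_pos[OF pos] by measurable
  moreover note norm_proj_le_\<rho>[OF Y1' bd1'] norm_proj_le_\<rho>[OF Y2' bd2'] eq1 eq2 bd1 bd2
    slice_Lipschitz_y[OF g1] slice_Lipschitz_z[OF g1] g12
  ultimately show ?thesis
  proof eventually_elim
    case (elim \<omega>)
    let ?y1 = "Y1 \<omega>" and ?y2 = "Y2 \<omega>" and ?z1 = "proj Y1' \<omega>" and ?z2 = "proj Y2' \<omega>"
    let ?e = "E Y1' \<omega> - E Y2' \<omega>"
    have e: "0 \<le> ?e" "h * norm (?z1 - ?z2) \<le> CARD('d) * \<beta> * ?e" using elim by auto
    have 1: "\<bar>(g1 \<omega> ?y1 ?z1 - g1 \<omega> ?y2 ?z1) * h\<bar> \<le> \<bar>?y1 - ?y2\<bar> / 2"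
      using elim by (intro Lipschitz_y_small[of ?z1]) auto
    let ?m = "max (norm ?z1) (norm ?z2) powr (q / 2)"
    have m: "?m \<le> \<rho> powr (q / 2)"
      using elim q by (intro powr_mono2) (auto simp: le_max_iff_disj)
    have "\<bar>(g1 \<omega> ?y2 ?z1 - g1 \<omega> ?y2 ?z2) * h\<bar> \<le> L * (1 + ?m) * norm (?z1 - ?z2) * h"
      using elim(12)[rule_format, OF elim(10), of ?z1 ?z2] h_pos by (simp add: abs_mult)
    also have "\<dots> = L * (1 + ?m) * (h * norm (?z1 - ?z2))" by simp
    also have "\<dots> \<le> L * (1 + \<rho> powr (q / 2)) * (CARD('d) * \<beta> * ?e)"
      using m L h_pos by (intro mult_mono[OF _ e(2)] mult_left_mono) auto
    also have "\<dots> = L * (1 + \<rho> powr (q / 2)) * (CARD('d) * \<beta>) * ?e" by simp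
    also have "\<dots> \<le> 1 * ?e" using small_Lz e(1) by (rule mult_right_mono)
    finally have 2: "\<bar>(g1 \<omega> ?y2 ?z1 - g1 \<omega> ?y2 ?z2) * h\<bar> \<le> ?e" by simp
    have 3: "0 \<le> (g1 \<omega> ?y2 ?z2 - g2 \<omega> ?y2 ?z2) * h" using elim h_pos by simp
    have "?y1 - ?y2 = ?e + g1 \<omega> ?y1 ?z1 * h - g2 \<omega> ?y2 ?z2 * h"
      using elim by linarith
    also have "\<dots> = ?e + (g1 \<omega> ?y1 ?z1 - g1 \<omega> ?y2 ?z1) * h + (g1 \<omega> ?y2 ?z1 - g1 \<omega> ?y2 ?z2) * h
        + (g1 \<omega> ?y2 ?z2 - g2 \<omega> ?y2 ?z2) * h" by (simp add: algebra_simps)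
    finally have "?y1 - ?y2 = \<dots>" .
    \<comment> \<open>Since e + v and w are nonnegative, d >= u >= - |d| / 2, which excludes a
      negative d.\<close>
    moreover have "0 \<le> d" if "d = e + u + v + w" "\<bar>u\<bar> \<le> \<bar>d\<bar> / 2" "\<bar>v\<bar> \<le> e" "0 \<le> w" for d e u v w :: real
      using that by linarith
    ultimately have "0 \<le> ?y1 - ?y2" using 1 2 3 by blast
    then show ?case by simp
  qed
qed

text \<open>The implicit equation has, on \<open>[-c, c]\<close>, a strictly increasing residual \<open>\<phi> \<omega>\<close>; its zero is
  the infimum of the rational points where the residual is positive, which makes it measurable
  without a completion of \<open>G\<close>.\<close>

lemma implicit_solution_exists:
  assumes g: "slice g"
    and Y' [measurable]: "Y' \<in> borel_measurable M" and bd: "AE \<omega> in M. \<bar>Y' \<omega>\<bar> \<le> a" and a: "a \<le> c"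
    and ac: "a + K * h * (1 + c) \<le> c"
  shows "\<exists>Y\<in>borel_measurable G. AE \<omega> in M. Y \<omega> = E Y' \<omega> + g \<omega> (Y \<omega>) (proj Y' \<omega>) * h"
proof -
  define \<phi> where "\<phi> \<omega> r = r - E Y' \<omega> - g \<omega> r (proj Y' \<omega>) * h" for \<omega> r
  define J where "J = \<rat> \<inter> {- c..c}"
  \<comment> \<open>The default c does not disturb the infimum: the zero is at most c, and if no
    rational of [-c, c] lies beyond it, then it equals c.\<close>
  define \<psi> where "\<psi> r \<omega> = (if \<phi> \<omega> r > 0 then r else c)" for r \<omega>
  define Y where "Y \<omega> = (INF r\<in>J. \<psi> r \<omega>)" for \<omega>
  have J: "countable J" "0 \<in> J" using c by (auto simp: J_def countable_rat)
  then have J0: "J \<noteq> {}" by auto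
  have bb: "bdd_below ((\<lambda>r. \<psi> r \<omega>) ` J)" for \<omega>
    using c by (intro bdd_belowI[of _ "- c"]) (auto simp: \<psi>_def J_def)
  have \<phi>G: "(\<lambda>\<omega>. \<phi> \<omega> r) \<in> borel_measurable G" for r
    unfolding \<phi>_def using slice_measurable_compose[OF g _ proj_measurable, of "\<lambda>_. r" Y']
    by (intro borel_measurable_diff borel_measurable_times) auto
  have \<psi>G: "\<psi> r \<in> borel_measurable G" for r
    unfolding \<psi>_def using \<phi>G[of r] by measurable
  have YG: "Y \<in> borel_measurable G"
    unfolding Y_def by (intro borel_measurable_cINF J(1) \<psi>G bb)
  have Yc: "AE \<omega> in M. \<bar>Y' \<omega>\<bar> \<le> c"
    using bd by eventually_elim (use a in simp)
  have "AE \<omega> in M. Y \<omega> = E Y' \<omega> + g \<omega> (Y \<omega>) (proj Y' \<omega>) * h"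
    using cond_exp_plus_power_le[OF Y' bd a] norm_proj_le_\<rho>[OF Y' Yc]
      slice_growth[OF g] slice_Lipschitz_y[OF g] AE_space
  proof eventually_elim
    case (elim \<omega>)
    let ?z = "proj Y' \<omega>"
    \<comment> \<open>The y-part of the driver contracts by 1/2, so the residual has slope at least
      1/2. This gives the strict sign change at the zero.\<close>
    have inc: "\<phi> \<omega> r - \<phi> \<omega> s \<ge> (r - s) / 2" if "s \<le> r" "\<bar>r\<bar> \<le> c" "\<bar>s\<bar> \<le> c" for r s
    proof -
      have "\<bar>(g \<omega> r ?z - g \<omega> s ?z) * h\<bar> \<le> \<bar>r - s\<bar> / 2"
        using elim(4)[rule_format, of r s ?z] elim(2) that by (intro Lipschitz_y_small[of ?z]) auto
      moreover have "\<phi> \<omega> r - \<phi> \<omega> s = (r - s) - (g \<omega> r ?z - g \<omega> s ?z) * h"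
        by (simp add: \<phi>_def algebra_simps)
      moreover have "p \<ge> e / 2" if "\<bar>u\<bar> \<le> \<bar>e\<bar> / 2" "p = e - u" "0 \<le> e" for p e u :: real
        using that by linarith
      ultimately show ?thesis using that by (metis diff_ge_0_iff_ge)
    qed
    \<comment> \<open>At the ends of [-c, c] the driver term and the conditional expectation
      together stay within c; this is where \<open>ac\<close> enters, and it provides the signs for
      the intermediate value theorem.\<close>
    have small: "\<bar>E Y' \<omega> + g \<omega> r ?z * h\<bar> \<le> c" if "\<bar>r\<bar> = c" for r
    proof -
      have "\<bar>g \<omega> r ?z * h\<bar> \<le> K * (1 + \<bar>r\<bar> + norm ?z powr q) * h"
        using elim(3) h_pos by (simp add: abs_mult)
      then show ?thesis using elim(1) ac that by (simp add: algebra_simps)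
    qed
    have "continuous_on UNIV (\<lambda>r. (\<lambda>(y, z). g \<omega> y z) (r, ?z))"
      using slice_continuous[OF g elim(5)]
      by (rule continuous_on_compose2) (auto intro!: continuous_intros)
    then have "continuous_on {- c..c} (\<phi> \<omega>)"
      unfolding \<phi>_def by (auto intro!: continuous_intros intro: continuous_on_subset)
    moreover have "\<phi> \<omega> (- c) \<le> 0" "0 \<le> \<phi> \<omega> c"
      using small[of c] small[of "- c"] c by (auto simp: \<phi>_def abs_le_iff)
    ultimately obtain y where y: "- c \<le> y" "y \<le> c" "\<phi> \<omega> y = 0"
      using IVT'[of "\<phi> \<omega>" "- c" 0 c] c by auto
    have pos: "\<phi> \<omega> r > 0 \<longleftrightarrow> y < r" if "\<bar>r\<bar> \<le> c" for r
    proof -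
      have "\<bar>y\<bar> \<le> c" using y by simp
      then show ?thesis using inc[of y r] inc[of r y] y(3) that by (cases "y < r") auto
    qed
    have "y \<le> Y \<omega>"
      unfolding Y_def
    proof (rule cINF_greatest[OF J0])
      show "y \<le> \<psi> r \<omega>" if "r \<in> J" for r
        using pos[of r] that y by (auto simp: \<psi>_def J_def abs_le_iff)
    qed
    moreover have "Y \<omega> \<le> y"
    proof (rule ccontr)
      assume "\<not> Y \<omega> \<le> y"
      moreover have Y_le: "Y \<omega> \<le> \<psi> r \<omega>" if "r \<in> J" for r
        unfolding Y_def using that bb by (rule cINF_lower[rotated])
      moreover have "\<psi> 0 \<omega> \<le> c" using c by (simp add: \<psi>_def)
      ultimately have "y < Y \<omega>" "Y \<omega> \<le> c" using Y_le[OF J(2)] by auto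
      then obtain r where r: "r \<in> \<rat>" "y < r" "r < Y \<omega>" using Rats_dense_in_real by blast
      then have "r \<in> J" using y \<open>Y \<omega> \<le> c\<close> by (auto simp: J_def)
      moreover have "\<psi> r \<omega> = r" using pos[of r] r y \<open>Y \<omega> \<le> c\<close> by (auto simp: \<psi>_def)
      ultimately show False using Y_le[of r] r by simp
    qed
    ultimately show ?case using y(3) by (simp add: \<phi>_def)
  qed
  with YG show ?thesis by blast
qed

end

section \<open>Time grids and martingales on them\<close>

locale time_grid =
  fixes T :: real and n :: nat and \<tau> :: "nat \<Rightarrow> real"
  assumes T_pos: "T > 0" and grid: "is_grid T n \<tau>"
begin

lemma \<tau>_0: "\<tau> 0 = 0" and \<tau>_n: "\<tau> n = T" and \<tau>_Suc: "i < n \<Longrightarrow> \<tau> i < \<tau> (Suc i)"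
  using grid by (auto simp: is_grid_def)

lemma \<tau>_less: "i < j \<Longrightarrow> j \<le> n \<Longrightarrow> \<tau> i < \<tau> j"
proof (induction j)
  case (Suc j)
  then show ?case using \<tau>_Suc[of j] by (cases "i = j") auto
qed simp

lemma \<tau>_mono: "i \<le> j \<Longrightarrow> j \<le> n \<Longrightarrow> \<tau> i \<le> \<tau> j"
  using \<tau>_less[of i j] by (cases "i = j") auto

lemma \<tau>_in: "i \<le> n \<Longrightarrow> \<tau> i \<in> {0..T}"
  using \<tau>_mono[of 0 i] \<tau>_mono[of i n] \<tau>_0 \<tau>_n by auto

lemma n_pos: "0 < n"
  using T_pos \<tau>_0 \<tau>_n by (cases n) auto

text \<open>Numbers the right-open cells, with the final time T as a cell of its own of index n. It
  extends Y, M and the filtration from the grid to all times.\<close>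

definition idx :: "real \<Rightarrow> nat" where
  "idx t = Max {i. i \<le> n \<and> \<tau> i \<le> t}"

lemma idx_eq:
  assumes "i \<le> n" "\<tau> i \<le> t" "i < n \<Longrightarrow> t < \<tau> (Suc i)"
  shows "idx t = i"
  unfolding idx_def
proof (rule Max_eqI)
  fix j assume "j \<in> {i. i \<le> n \<and> \<tau> i \<le> t}"
  then have j: "j \<le> n" "\<tau> j \<le> t" by auto
  show "j \<le> i"
  proof (rule ccontr)
    assume "\<not> j \<le> i"
    then show False using assms j \<tau>_mono[of "Suc i" j] by auto
  qed
qed (use assms in auto)

lemma idx_\<tau>: "i \<le> n \<Longrightarrow> idx (\<tau> i) = i"
  using \<tau>_Suc by (intro idx_eq) auto

lemma idx:
  assumes "t \<in> {0..T}"
  shows idx_le: "idx t \<le> n" and \<tau>_idx_le: "\<tau> (idx t) \<le> t"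
    and less_\<tau>_idx: "idx t < n \<Longrightarrow> t < \<tau> (Suc (idx t))"
    and idx_eq_n: "idx t = n \<Longrightarrow> t = T"
proof -
  let ?S = "{i. i \<le> n \<and> \<tau> i \<le> t}"
  have fin: "finite ?S" "?S \<noteq> {}" using assms \<tau>_0 by auto
  have "idx t \<in> ?S" unfolding idx_def using fin by (rule Max_in)
  then show 1: "idx t \<le> n" "\<tau> (idx t) \<le> t" by auto
  show "t < \<tau> (Suc (idx t))" if "idx t < n"
  proof (rule ccontr)
    assume "\<not> ?thesis"
    then have "Suc (idx t) \<in> ?S" using that by auto
    then have "Suc (idx t) \<le> idx t" unfolding idx_def using fin by (intro Max_ge) auto
    then show False by simp
  qed
  show "t = T" if "idx t = n" using 1(2) \<tau>_n assms unfolding that by auto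
qed

lemma idx_mono:
  assumes "s \<le> t" "0 \<le> s" "t \<le> T"
  shows "idx s \<le> idx t"
proof -
  have "idx s \<in> {i. i \<le> n \<and> \<tau> i \<le> t}" using idx_le[of s] \<tau>_idx_le[of s] assms by auto
  then show ?thesis unfolding idx_def[of t] by (intro Max_ge) auto
qed

text \<open>The counterpart of \<open>idx\<close> for the left-open cells, on which Z is constant;
  it is meant for positive times only.\<close>

definition lidx :: "real \<Rightarrow> nat" where
  "lidx t = Max {i. i < n \<and> \<tau> i < t}"

lemma lidx_eq:
  assumes "i < n" "\<tau> i < t" "t \<le> \<tau> (Suc i)"
  shows "lidx t = i"
  unfolding lidx_def
proof (rule Max_eqI)
  fix j assume "j \<in> {i. i < n \<and> \<tau> i < t}"
  then have j: "j < n" "\<tau> j < t" by auto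
  show "j \<le> i"
  proof (rule ccontr)
    assume "\<not> j \<le> i"
    then show False using assms j \<tau>_mono[of "Suc i" j] by auto
  qed
qed (use assms in auto)

lemma lidx:
  assumes "t \<in> {0<..T}"
  shows lidx_less: "lidx t < n" and \<tau>_lidx_less: "\<tau> (lidx t) < t" and le_\<tau>_lidx: "t \<le> \<tau> (Suc (lidx t))"
proof -
  let ?S = "{i. i < n \<and> \<tau> i < t}"
  have fin: "finite ?S" "?S \<noteq> {}" using assms \<tau>_0 n_pos by auto
  have "lidx t \<in> ?S" unfolding lidx_def using fin by (rule Max_in)
  then show 1: "lidx t < n" "\<tau> (lidx t) < t" by auto
  show "t \<le> \<tau> (Suc (lidx t))"
  proof (rule ccontr)
    assume *: "\<not> ?thesis"
    show False
    proof (cases "Suc (lidx t) < n")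
      case True
      then have "Suc (lidx t) \<in> ?S" using * by auto
      then have "Suc (lidx t) \<le> lidx t" unfolding lidx_def using fin by (intro Max_ge) auto
      then show False by simp
    next
      case False
      then have "Suc (lidx t) = n" using 1 by simp
      then show False using * \<tau>_n assms by auto
    qed
  qed
qed

lemma constant_right_openD:
  assumes "constant_right_open M n \<tau> P" "t \<in> {0..T}" "\<omega> \<in> space M"
  shows "P t \<omega> = P (\<tau> (idx t)) \<omega>"
proof (cases "idx t = n")
  case True
  then show ?thesis using idx_eq_n[OF assms(2)] \<tau>_n by simp
next
  case False
  then show ?thesis
    using assms idx_le[OF assms(2)] \<tau>_idx_le[OF assms(2)] less_\<tau>_idx[OF assms(2)] unfolding constant_right_open_def
    by (metis atLeastLessThan_iff le_neq_implies_less)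
qed

lemma constant_left_openD:
  assumes "constant_left_open M n \<tau> P" "t \<in> {0<..T}" "\<omega> \<in> space M"
  shows "P t \<omega> = P (\<tau> (Suc (lidx t))) \<omega>"
proof -
  have "t \<in> {\<tau> (lidx t)<..\<tau> (Suc (lidx t))}" using lidx[OF assms(2)] by simp
  then show ?thesis
    using assms(1,3) lidx_less[OF assms(2)] unfolding constant_left_open_def by blast
qed

end

section \<open>Natural filtrations, and products of square-integrable variables\<close>

lemma space_natural_filtration [simp]: "space (natural_filtration M X t) = space M"
  by (auto simp: natural_filtration_def space_measure_of_conv)

lemma sets_natural_filtration:
  "sets (natural_filtration M X t) =
     sigma_sets (space M) (\<Union>s\<in>{0..t}. {X s -` A \<inter> space M | A. A \<in> sets borel})"
  unfolding natural_filtration_def by (rule sets_measure_of) auto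

lemma measurable_natural_filtration:
  assumes "0 \<le> s" "s \<le> t"
  shows "X s \<in> borel_measurable (natural_filtration M X t)"
proof (rule measurableI)
  fix A :: "'b set" assume "A \<in> sets borel"
  then show "X s -` A \<inter> space (natural_filtration M X t) \<in> sets (natural_filtration M X t)"
    using assms unfolding sets_natural_filtration space_natural_filtration
    by (intro sigma_sets.Basic UN_I[of s]) auto
qed simp

lemma subalgebra_natural_filtration_mono:
  assumes "s \<le> t"
  shows "subalgebra (natural_filtration M X t) (natural_filtration M X s)"
  unfolding subalgebra_def sets_natural_filtration space_natural_filtration
  using assms by (intro conjI refl sigma_sets_mono' UN_mono) simp_all

lemma subalgebra_natural_filtration:
  assumes "\<And>s. 0 \<le> s \<Longrightarrow> s \<le> t \<Longrightarrow> X s \<in> borel_measurable M"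
  shows "subalgebra M (natural_filtration M X t)"
  unfolding subalgebra_def sets_natural_filtration space_natural_filtration
proof (intro conjI refl sets.sigma_sets_subset subsetI)
  fix B assume "B \<in> (\<Union>s\<in>{0..t}. {X s -` A \<inter> space M | A. A \<in> sets borel})"
  then obtain s A where "0 \<le> s" "s \<le> t" "A \<in> sets borel" "B = X s -` A \<inter> space M" by auto
  then show "B \<in> sets M" using measurable_sets[OF assms, of s A] by simp
qed

lemma integrable_mult_square_integrable:
  fixes f g :: "'a \<Rightarrow> real"
  assumes [measurable]: "f \<in> borel_measurable M" "g \<in> borel_measurable M"
    and "integrable M (\<lambda>x. (f x)\<^sup>2)" "integrable M (\<lambda>x. (g x)\<^sup>2)"
  shows "integrable M (\<lambda>x. f x * g x)"
proof (rule Bochner_Integration.integrable_bound)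
  show "integrable M (\<lambda>x. (f x)\<^sup>2 + (g x)\<^sup>2)" using assms by simp
  have "\<bar>a * b\<bar> \<le> a\<^sup>2 + b\<^sup>2" for a b :: real
  proof -
    have "2 * \<bar>a\<bar> * \<bar>b\<bar> \<le> a\<^sup>2 + b\<^sup>2" using sum_squares_bound[of "\<bar>a\<bar>" "\<bar>b\<bar>"] by simp
    moreover have "0 \<le> \<bar>a\<bar> * \<bar>b\<bar>" by simp
    ultimately show ?thesis unfolding abs_mult by linarith
  qed
  then show "AE x in M. norm (f x * g x) \<le> norm ((f x)\<^sup>2 + (g x)\<^sup>2)" by simp
qed measurable

section \<open>Increments, brackets and filtration of the driving martingale on its grid\<close>

locale grid_martingale = prob_space M + time_grid T n \<tau>
  for M :: "'a measure" and T n \<tau> +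
  fixes X :: "real \<Rightarrow> 'a \<Rightarrow> real^'d::finite"
  assumes approx: "approximating_process M T X"
    and orth: "orthogonal_components M T X"
    and X_const: "constant_right_open M n \<tau> X"
    and brackets: "equal_positive_brackets M n \<tau> X"
begin

abbreviation "\<F> \<equiv> natural_filtration M X"
abbreviation "F i \<equiv> \<F> (\<tau> i)"

text \<open>Numbered by the left end of the step, unlike \<open>increment\<close>, so that
  \<open>D i\<close> and \<open>h i\<close> go with the past \<open>F i\<close>.\<close>

definition D :: "nat \<Rightarrow> 'a \<Rightarrow> real^'d" where
  "D i \<omega> = X (\<tau> (Suc i)) \<omega> - X (\<tau> i) \<omega>"

definition h :: "nat \<Rightarrow> real" where
  "h i = increment \<tau> (bracket M X) (Suc i)"

lemma X_martingale: "martingale M T \<F> (\<lambda>t \<omega>. X t \<omega> $ k)"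
  and X_square_integrable: "t \<in> {0..T} \<Longrightarrow> integrable M (\<lambda>\<omega>. (X t \<omega> $ k)\<^sup>2)"
  using approx by (auto simp: approximating_process_def square_integrable_martingale_def)

lemma X_integrable: "t \<in> {0..T} \<Longrightarrow> integrable M (\<lambda>\<omega>. X t \<omega> $ k)"
  using X_martingale by (auto simp: martingale_def)

lemma X_measurable: "t \<in> {0..T} \<Longrightarrow> X t \<in> borel_measurable M"
  using X_integrable unfolding borel_measurable_vec_iff by blast

lemma subalg: "t \<in> {0..T} \<Longrightarrow> subalgebra M (\<F> t)"
  by (intro subalgebra_natural_filtration X_measurable) auto

lemma subalg_F: "i \<le> n \<Longrightarrow> subalgebra M (F i)"
  by (intro subalg \<tau>_in)

lemma subalg_FF: "i \<le> j \<Longrightarrow> j \<le> n \<Longrightarrow> subalgebra (F j) (F i)"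
  by (intro subalgebra_natural_filtration_mono \<tau>_mono)

lemma measurable_F_mono:
  "i \<le> j \<Longrightarrow> j \<le> n \<Longrightarrow> f \<in> borel_measurable (F i) \<Longrightarrow> f \<in> borel_measurable (F j)"
  using measurable_from_subalg[OF subalg_FF] by blast

lemma measurable_F_M: "i \<le> n \<Longrightarrow> f \<in> borel_measurable (F i) \<Longrightarrow> f \<in> borel_measurable M"
  using measurable_from_subalg[OF subalg_F] by blast

lemma sigma_finite_F:
  assumes "i \<le> n"
  shows "sigma_finite_subalgebra M (F i)"
proof -
  interpret finite_measure_subalgebra M "F i" using subalg_F[OF assms] by unfold_locales
  show ?thesis by unfold_locales
qed

lemma X_component_measurable_F: "i \<le> j \<Longrightarrow> j \<le> n \<Longrightarrow> (\<lambda>\<omega>. X (\<tau> i) \<omega> $ k) \<in> borel_measurable (F j)"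
  using measurable_natural_filtration[of "\<tau> i" "\<tau> j" X M] \<tau>_mono[of i j] \<tau>_in[of i]
  unfolding borel_measurable_vec_iff by auto

lemma D_measurable_F: "i < n \<Longrightarrow> D i \<in> borel_measurable (F (Suc i))"
  unfolding D_def borel_measurable_vec_iff
  by (auto intro!: borel_measurable_diff X_component_measurable_F)

lemma D_integrable: "i < n \<Longrightarrow> integrable M (\<lambda>\<omega>. D i \<omega> $ k)"
  by (auto simp: D_def intro!: Bochner_Integration.integrable_diff X_integrable \<tau>_in simp del: atLeastAtMost_iff)

lemma XX_integrable:
  "s \<in> {0..T} \<Longrightarrow> t \<in> {0..T} \<Longrightarrow> integrable M (\<lambda>\<omega>. X s \<omega> $ k * X t \<omega> $ l)"
  using X_measurable unfolding borel_measurable_vec_iff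
  by (intro integrable_mult_square_integrable X_square_integrable) auto

lemma D_mean:
  assumes i: "i < n"
  shows "AE \<omega> in M. real_cond_exp M (F i) (\<lambda>\<omega>. D i \<omega> $ k) \<omega> = 0"
proof -
  interpret sigma_finite_subalgebra M "F i" using i by (intro sigma_finite_F) simp
  have t: "\<tau> i \<in> {0..T}" "\<tau> (Suc i) \<in> {\<tau> i..T}" "\<tau> (Suc i) \<in> {0..T}"
    using \<tau>_in[of i] \<tau>_in[of "Suc i"] \<tau>_Suc[of i] i by auto
  have "AE \<omega> in M. real_cond_exp M (F i) (\<lambda>\<omega>. X (\<tau> (Suc i)) \<omega> $ k) \<omega> = X (\<tau> i) \<omega> $ k"
    using X_martingale t unfolding martingale_def by blast
  moreover have "AE \<omega> in M. real_cond_exp M (F i) (\<lambda>\<omega>. X (\<tau> i) \<omega> $ k) \<omega> = X (\<tau> i) \<omega> $ k"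
    using i by (intro real_cond_exp_F_meas X_integrable t X_component_measurable_F) auto
  moreover have "AE \<omega> in M. real_cond_exp M (F i) (\<lambda>\<omega>. X (\<tau> (Suc i)) \<omega> $ k - X (\<tau> i) \<omega> $ k) \<omega>
      = real_cond_exp M (F i) (\<lambda>\<omega>. X (\<tau> (Suc i)) \<omega> $ k) \<omega> - real_cond_exp M (F i) (\<lambda>\<omega>. X (\<tau> i) \<omega> $ k) \<omega>"
    by (intro real_cond_exp_diff X_integrable t)
  ultimately show ?thesis unfolding D_def vector_minus_component by eventually_elim simp
qed

text \<open>(C2) compares increments only. Together with the common initial value 0 it gives
  equality at the grid points, which makes the definite description in \<open>bracket\<close>
  meaningful there.\<close>

lemma component_bracket_grid: "i \<le> n \<Longrightarrow> component_bracket M X k (\<tau> i) = component_bracket M X l (\<tau> i)"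
proof (induction i)
  case 0
  have "component_bracket M X k (\<tau> 0) = 0" for k
  proof -
    have "AE \<omega> in M. X 0 \<omega> = 0" using approx by (simp add: approximating_process_def)
    then have "AE \<omega> in M. (X 0 \<omega> $ k)\<^sup>2 = 0" by eventually_elim simp
    then show ?thesis unfolding component_bracket_def \<tau>_0 by (rule integral_eq_zero_AE)
  qed
  then show ?case by simp
next
  case (Suc i)
  have "Suc i \<in> {1..n}" using Suc.prems by simp
  then have "increment \<tau> (component_bracket M X k) (Suc i) = increment \<tau> (component_bracket M X l) (Suc i)"
    using brackets unfolding equal_positive_brackets_def by blast
  then show ?case using Suc by (simp add: increment_def)
qed

lemma bracket_grid: "i \<le> n \<Longrightarrow> bracket M X (\<tau> i) = component_bracket M X k (\<tau> i)"
  unfolding bracket_def using component_bracket_grid by (intro the_equality) auto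

lemma h_eq: "i < n \<Longrightarrow> h i = component_bracket M X k (\<tau> (Suc i)) - component_bracket M X k (\<tau> i)"
  unfolding h_def increment_def using bracket_grid[of _ k] by auto

lemma h_pos: "i < n \<Longrightarrow> h i > 0"
  using h_eq[of i undefined] brackets unfolding equal_positive_brackets_def increment_def by force

text \<open>The increment is independent of the past, so it suffices to compute the unconditional
  covariance. There the mixed terms of the past value with the increment vanish by the martingale
  property, leaving the increment of the second moments: h on the diagonal by definition of the
  bracket, 0 off it by orthogonality of the components.\<close>

lemma D_cov:
  assumes i: "i < n"
  shows "AE \<omega> in M. real_cond_exp M (F i) (\<lambda>\<omega>. D i \<omega> $ k * D i \<omega> $ l) \<omega> = (if k = l then h i else 0)"
proof -
  interpret sigma_finite_subalgebra M "F i" using i by (intro sigma_finite_F) simp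
  have t: "\<tau> i \<in> {0..T}" "\<tau> (Suc i) \<in> {\<tau> i..T}" "\<tau> (Suc i) \<in> {0..T}"
    using \<tau>_in[of i] \<tau>_in[of "Suc i"] \<tau>_Suc[of i] i by auto
  have DXi: "integrable M (\<lambda>\<omega>. X (\<tau> i) \<omega> $ k * D i \<omega> $ l)" for k l
    unfolding D_def using XX_integrable[OF t(1) t(1), of k l] XX_integrable[OF t(1) t(3), of k l]
    by (simp add: right_diff_distrib)
  have eq: "D i \<omega> $ k * D i \<omega> $ l = X (\<tau> (Suc i)) \<omega> $ k * X (\<tau> (Suc i)) \<omega> $ l
      - X (\<tau> i) \<omega> $ k * X (\<tau> i) \<omega> $ l - X (\<tau> i) \<omega> $ k * D i \<omega> $ l - X (\<tau> i) \<omega> $ l * D i \<omega> $ k" for k l \<omega>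
    by (simp add: D_def algebra_simps)
  have DDi: "integrable M (\<lambda>\<omega>. D i \<omega> $ k * D i \<omega> $ l)"
    unfolding eq by (intro Bochner_Integration.integrable_diff XX_integrable t DXi)
  have zero: "(\<integral>\<omega>. X (\<tau> i) \<omega> $ k * D i \<omega> $ l \<partial>M) = 0" for k l
  proof -
    have [measurable]: "(\<lambda>\<omega>. X (\<tau> i) \<omega> $ k) \<in> borel_measurable (F i)"
      using i by (intro X_component_measurable_F) auto
    have "(\<integral>\<omega>. X (\<tau> i) \<omega> $ k * D i \<omega> $ l \<partial>M)
        = (\<integral>\<omega>. X (\<tau> i) \<omega> $ k * real_cond_exp M (F i) (\<lambda>\<omega>. D i \<omega> $ l) \<omega> \<partial>M)"
      using D_integrable[OF i, of l] by (intro real_cond_exp_intg(2)[symmetric] DXi) auto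
    also have "\<dots> = 0"
    proof -
      have "AE \<omega> in M. X (\<tau> i) \<omega> $ k * real_cond_exp M (F i) (\<lambda>\<omega>. D i \<omega> $ l) \<omega> = 0"
        using D_mean[OF i, of l] by eventually_elim simp
      then show ?thesis by (rule integral_eq_zero_AE)
    qed
    finally show ?thesis .
  qed
  have "(\<integral>\<omega>. D i \<omega> $ k * D i \<omega> $ l \<partial>M)
      = (\<integral>\<omega>. X (\<tau> (Suc i)) \<omega> $ k * X (\<tau> (Suc i)) \<omega> $ l \<partial>M) - (\<integral>\<omega>. X (\<tau> i) \<omega> $ k * X (\<tau> i) \<omega> $ l \<partial>M)"
    unfolding eq using zero XX_integrable t DXi by simp
  also have "\<dots> = (if k = l then h i else 0)"
  proof (cases "k = l")
    case True
    then show ?thesis using h_eq[OF i, of l] by (simp add: component_bracket_def power2_eq_square)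
  next
    case False
    then show ?thesis using orth t unfolding orthogonal_components_def by auto
  qed
  finally have int: "(\<integral>\<omega>. D i \<omega> $ k * D i \<omega> $ l \<partial>M) = (if k = l then h i else 0)" .
  have D_eq: "D i = (\<lambda>\<omega>. X (\<tau> (Suc i)) \<omega> - X (\<tau> i) \<omega>)" by (auto simp: D_def)
  have "AE \<omega> in M. real_cond_exp M (F i) (\<lambda>\<omega>. (\<lambda>v. v $ k * v $ l) (D i \<omega>)) \<omega>
      = (\<integral>\<omega>. (\<lambda>v. v $ k * v $ l) (D i \<omega>) \<partial>M)"
  proof (rule real_cond_exp_indep[where g = "D i" and \<phi> = "\<lambda>v. v $ k * v $ l"])
    show "subalgebra M (F i)" using i by (intro subalg_F) simp
    show "D i \<in> borel_measurable M" using D_measurable_F[OF i] i by (intro measurable_F_M[of "Suc i"]) auto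
    show "indep_set (sets (F i)) {D i -` A \<inter> space M |A. A \<in> sets borel}"
      using approx t unfolding D_eq approximating_process_def independent_increments_def by blast
    show "(\<lambda>v :: real^'d. v $ k * v $ l) \<in> borel_measurable borel"
      by (intro borel_measurable_continuous_onI continuous_intros)
  qed (use DDi in simp)
  then show ?thesis unfolding int by simp
qed

lemma one_step:
  assumes "i < n" "AE \<omega> in M. \<forall>k. \<bar>D i \<omega> $ k\<bar> \<le> \<beta>"
  shows "one_step M (F i) (D i) (h i) \<beta>"
proof
  show "subalgebra M (F i)" using assms by (intro subalg_F) simp
  show "D i \<in> borel_measurable M" using D_measurable_F assms(1) by (intro measurable_F_M[of "Suc i"]) auto
qed (use assms D_mean D_cov h_pos in auto)

text \<open>The driving process is constant between grid points for every outcome, not just almost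
  surely, so its uncompleted filtration can change only at grid times.\<close>

lemma \<F>_idx:
  assumes t: "t \<in> {0..T}"
  shows "\<F> t = F (idx t)"
proof -
  define S where "S s = {X s -` A \<inter> space M | A. A \<in> sets borel}" for s
  have S: "S s = S (\<tau> (idx s))" if "s \<in> {0..t}" for s
  proof -
    have s: "s \<in> {0..T}" using that t by simp
    have "X s -` A \<inter> space M = X (\<tau> (idx s)) -` A \<inter> space M" for A
      using constant_right_openD[OF X_const s] by auto
    then show ?thesis by (simp add: S_def)
  qed
  have *: "\<tau> (idx s) \<in> {0..\<tau> (idx t)}" if "s \<in> {0..t}" for s
    using that t idx_mono[of s t] idx_le[of s] idx_le[of t] \<tau>_in[of "idx s"] \<tau>_mono[of "idx s" "idx t"] by simp
  have "(\<Union>s\<in>{0..t}. S s) = (\<Union>s\<in>{0..\<tau> (idx t)}. S s)"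
  proof (intro equalityI UN_least)
    show "S s \<subseteq> (\<Union>s\<in>{0..\<tau> (idx t)}. S s)" if "s \<in> {0..t}" for s
      unfolding S[OF that] using *[OF that] by (rule UN_upper)
    show "S s \<subseteq> (\<Union>s\<in>{0..t}. S s)" if "s \<in> {0..\<tau> (idx t)}" for s
      using that \<tau>_idx_le[OF t] by (intro UN_upper) simp
  qed
  then show ?thesis unfolding natural_filtration_def S_def by simp
qed

text \<open>This is the predictability of Z: its value at the right end of a step is already
  attained at an interior time, when the filtration is still that of the left end.\<close>

lemma constant_left_open_measurable:
  fixes Z :: "real \<Rightarrow> 'a \<Rightarrow> 'b::topological_space"
  assumes Z: "adapted T \<F> Z" "constant_left_open M n \<tau> Z" and i: "i < n"
  shows "Z (\<tau> (Suc i)) \<in> borel_measurable (F i)"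
proof -
  obtain t where t: "\<tau> i < t" "t < \<tau> (Suc i)" using dense \<tau>_Suc[OF i] by blast
  have tT: "t \<in> {0..T}" using t \<tau>_in[of i] \<tau>_in[of "Suc i"] i by auto
  have it: "idx t = i" using t i by (intro idx_eq) auto
  have "Z t \<in> borel_measurable (\<F> t)" using Z(1) tT unfolding adapted_def by blast
  then have "Z t \<in> borel_measurable (F i)" unfolding \<F>_idx[OF tT] it .
  moreover have "Z t \<omega> = Z (\<tau> (Suc i)) \<omega>" if "\<omega> \<in> space (F i)" for \<omega>
  proof -
    have "t \<in> {\<tau> i<..\<tau> (Suc i)}" "\<omega> \<in> space M" using t that by simp_all
    then show ?thesis using Z(2) i unfolding constant_left_open_def by blast
  qed
  ultimately show ?thesis by (rule measurable_cong[THEN iffD1, rotated])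
qed

section \<open>From the one-step martingale property on the grid to martingales in continuous
  time\<close>

lemma discrete_martingale:
  assumes int: "\<And>i. i \<le> n \<Longrightarrow> integrable M (u i)"
    and meas: "\<And>i. i \<le> n \<Longrightarrow> u i \<in> borel_measurable (F i)"
    and step: "\<And>i. i < n \<Longrightarrow> AE \<omega> in M. real_cond_exp M (F i) (u (Suc i)) \<omega> = u i \<omega>"
    and ij: "i \<le> j" "j \<le> n"
  shows "AE \<omega> in M. real_cond_exp M (F i) (u j) \<omega> = u i \<omega>"
  using ij
proof (induction j)
  case 0
  interpret sigma_finite_subalgebra M "F 0" by (intro sigma_finite_F) simp
  show ?case using 0 real_cond_exp_F_meas[OF int[of 0] meas[of 0]] by simp
next
  case (Suc j)
  interpret sigma_finite_subalgebra M "F i" using Suc.prems by (intro sigma_finite_F) simp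
  show ?case
  proof (cases "i = Suc j")
    case True
    then show ?thesis using Suc.prems real_cond_exp_F_meas[OF int[of i] meas[of i]] by simp
  next
    case False
    then have ij: "i \<le> j" "j < n" using Suc.prems by auto
    have "AE \<omega> in M. real_cond_exp M (F i) (real_cond_exp M (F j) (u (Suc j))) \<omega> = real_cond_exp M (F i) (u (Suc j)) \<omega>"
      using ij by (intro real_cond_exp_nested_subalg subalg_F subalg_FF int) auto
    moreover have "AE \<omega> in M. real_cond_exp M (F i) (real_cond_exp M (F j) (u (Suc j))) \<omega> = real_cond_exp M (F i) (u j) \<omega>"
      using ij int[of j] by (intro real_cond_exp_cong step) auto
    moreover have "AE \<omega> in M. real_cond_exp M (F i) (u j) \<omega> = u i \<omega>" using Suc.IH ij by simp
    ultimately show ?thesis by eventually_elim simp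
  qed
qed

lemma martingale_from_grid:
  assumes P: "constant_right_open M n \<tau> P"
    and int: "\<And>i. i \<le> n \<Longrightarrow> integrable M (P (\<tau> i))"
    and meas: "\<And>i. i \<le> n \<Longrightarrow> P (\<tau> i) \<in> borel_measurable (F i)"
    and step: "\<And>i. i < n \<Longrightarrow> AE \<omega> in M. real_cond_exp M (F i) (P (\<tau> (Suc i))) \<omega> = P (\<tau> i) \<omega>"
  shows "martingale M T \<F> P"
  unfolding martingale_def adapted_def
proof (intro conjI ballI)
  fix t assume t: "t \<in> {0..T}"
  note eq = constant_right_openD[OF P t] and it = idx_le[OF t]
  show "P t \<in> borel_measurable (\<F> t)"
    using meas[OF it] measurable_cong[of "F (idx t)" "P t" "P (\<tau> (idx t))"] eq
    unfolding \<F>_idx[OF t] by simp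
  show "integrable M (P t)"
    using int[OF it] Bochner_Integration.integrable_cong[of M M "P t" "P (\<tau> (idx t))"] eq by simp
next
  fix s t assume s: "s \<in> {0..T}" and t: "t \<in> {s..T}"
  then have t0: "t \<in> {0..T}" by auto
  note it = idx_le[OF t0] and ix = idx_le[OF s]
  interpret sigma_finite_subalgebra M "F (idx s)" using ix by (rule sigma_finite_F)
  have [measurable]: "P (\<tau> (idx t)) \<in> borel_measurable M" using int[OF it] by simp
  have eqt: "P t \<omega> = P (\<tau> (idx t)) \<omega>" if "\<omega> \<in> space M" for \<omega>
    using constant_right_openD[OF P t0 that] .
  have "P t \<in> borel_measurable M"
    using measurable_cong[of M "P t" "P (\<tau> (idx t))"] eqt by simp
  then have "AE \<omega> in M. real_cond_exp M (F (idx s)) (P t) \<omega> = real_cond_exp M (F (idx s)) (P (\<tau> (idx t))) \<omega>"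
    using eqt by (intro real_cond_exp_cong) auto
  moreover have "AE \<omega> in M. real_cond_exp M (F (idx s)) (P (\<tau> (idx t))) \<omega> = P (\<tau> (idx s)) \<omega>"
    using discrete_martingale[of "\<lambda>i. P (\<tau> i)", OF int meas step, of "idx s" "idx t"]
      idx_mono[of s t] s t it by auto
  moreover note AE_space
  ultimately show "AE \<omega> in M. real_cond_exp M (\<F> s) (P t) \<omega> = P s \<omega>"
    unfolding \<F>_idx[OF s]
    by eventually_elim (simp add: constant_right_openD[OF P s])
qed

end

section \<open>Solutions on a grid\<close>

definition AE_bounded :: "'a measure \<Rightarrow> ('a \<Rightarrow> real) \<Rightarrow> bool" where
  "AE_bounded M f \<longleftrightarrow> (\<exists>b. AE \<omega> in M. \<bar>f \<omega>\<bar> \<le> b)"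

lemma AE_boundedI: "AE \<omega> in M. \<bar>f \<omega>\<bar> \<le> b \<Longrightarrow> AE_bounded M f"
  unfolding AE_bounded_def by blast

lemma AE_bounded_const: "AE_bounded M (\<lambda>_. c)"
  by (rule AE_boundedI[where b = "\<bar>c\<bar>"]) simp

lemma AE_bounded_add:
  assumes "AE_bounded M f" "AE_bounded M g"
  shows "AE_bounded M (\<lambda>\<omega>. f \<omega> + g \<omega>)"
proof -
  obtain b c where "AE \<omega> in M. \<bar>f \<omega>\<bar> \<le> b" "AE \<omega> in M. \<bar>g \<omega>\<bar> \<le> c"
    using assms unfolding AE_bounded_def by blast
  then have "AE \<omega> in M. \<bar>f \<omega> + g \<omega>\<bar> \<le> b + c" by eventually_elim linarith
  then show ?thesis by (rule AE_boundedI)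
qed

lemma AE_bounded_mult:
  assumes "AE_bounded M f" "AE_bounded M g"
  shows "AE_bounded M (\<lambda>\<omega>. f \<omega> * g \<omega>)"
proof -
  obtain b c where "AE \<omega> in M. \<bar>f \<omega>\<bar> \<le> b" "AE \<omega> in M. \<bar>g \<omega>\<bar> \<le> c"
    using assms unfolding AE_bounded_def by blast
  then have "AE \<omega> in M. \<bar>f \<omega> * g \<omega>\<bar> \<le> b * c"
  proof eventually_elim
    case (elim \<omega>)
    then show ?case unfolding abs_mult by (intro mult_mono) auto
  qed
  then show ?thesis by (rule AE_boundedI)
qed

lemma AE_bounded_diff:
  assumes "AE_bounded M f" "AE_bounded M g"
  shows "AE_bounded M (\<lambda>\<omega>. f \<omega> - g \<omega>)"
  using AE_bounded_add[OF assms(1) AE_bounded_mult[OF AE_bounded_const[of M "- 1"] assms(2)]] by simp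

lemma AE_bounded_sum:
  assumes "\<And>i. i \<in> I \<Longrightarrow> AE_bounded M (f i)"
  shows "AE_bounded M (\<lambda>\<omega>. \<Sum>i\<in>I. f i \<omega>)"
  using assms
proof (induction I rule: infinite_finite_induct)
  case (insert i I)
  then show ?case by (simp add: AE_bounded_add)
qed (simp_all add: AE_bounded_const)

lemma (in finite_measure) AE_bounded_integrable:
  fixes f :: "'a \<Rightarrow> real"
  assumes "AE_bounded M f" "f \<in> borel_measurable M"
  shows "integrable M f"
proof -
  obtain b where "AE \<omega> in M. \<bar>f \<omega>\<bar> \<le> b" using assms(1) unfolding AE_bounded_def by blast
  then show ?thesis using assms(2) by (intro integrable_const_bound[of _ b]) simp_all
qed

context one_step
begin

lemma cond_exp_abs_le:
  assumes Y: "Y \<in> borel_measurable M" and bd: "AE \<omega> in M. \<bar>Y \<omega>\<bar> \<le> c"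
  shows "AE \<omega> in M. \<bar>E Y \<omega>\<bar> \<le> c"
proof -
  note Yi = integrable_AE_bounded[OF Y bd]
  have "AE \<omega> in M. Y \<omega> \<le> c" "AE \<omega> in M. - c \<le> Y \<omega>"
    using bd by (eventually_elim, simp add: abs_le_iff)+
  then have "AE \<omega> in M. E Y \<omega> \<le> c" "AE \<omega> in M. - c \<le> E Y \<omega>"
    using real_cond_exp_le_c[OF Yi] real_cond_exp_ge_c[OF Yi] by blast+
  then show ?thesis by eventually_elim (simp add: abs_le_iff)
qed

text \<open>One step of the orthogonal (Kunita-Watanabe) decomposition: V is to become the increment
  of the martingale M, whose martingale property and orthogonality to the driving process are the
  last two claims.\<close>

lemma residual:
  assumes Y [measurable]: "Y \<in> borel_measurable M" and bd: "AE_bounded M Y"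
  defines "V \<equiv> \<lambda>\<omega>. Y \<omega> - E Y \<omega> - proj Y \<omega> \<bullet> D \<omega>"
  shows residual_measurable: "V \<in> borel_measurable M"
    and residual_bounded: "AE_bounded M V"
    and cond_exp_residual: "AE \<omega> in M. E V \<omega> = 0"
    and cond_exp_residual_D: "AE \<omega> in M. E (\<lambda>\<omega>. V \<omega> * D \<omega> $ k) \<omega> = 0"
proof -
  obtain c where c: "AE \<omega> in M. \<bar>Y \<omega>\<bar> \<le> c" using bd unfolding AE_bounded_def by blast
  have [measurable]: "E Y \<in> borel_measurable M" "proj Y \<in> borel_measurable M"
    using measurable_from_subalg[OF subalg_G] proj_measurable by auto
  have [measurable]: "(\<lambda>\<omega>. proj Y \<omega> \<bullet> D \<omega>) \<in> borel_measurable M" by measurable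
  show V [measurable]: "V \<in> borel_measurable M" unfolding V_def by measurable
  have EYb: "AE_bounded M (E Y)"
    using cond_exp_abs_le[OF Y c] by (rule AE_boundedI)
  have "AE_bounded M (\<lambda>\<omega>. proj Y \<omega> $ l * D \<omega> $ l)" for l
  proof (rule AE_bounded_mult)
    show "AE_bounded M (\<lambda>\<omega>. proj Y \<omega> $ l)"
    proof (rule AE_boundedI)
      show "AE \<omega> in M. \<bar>proj Y \<omega> $ l\<bar> \<le> CARD('d) * c / sqrt h"
        using norm_proj_le[OF Y c] by eventually_elim (meson component_le_norm_cart order_trans)
    qed
    show "AE_bounded M (\<lambda>\<omega>. D \<omega> $ l)"
      by (rule AE_boundedI[where b = \<beta>]) (use D_bounded in \<open>eventually_elim, blast\<close>)
  qed
  then have PDb: "AE_bounded M (\<lambda>\<omega>. proj Y \<omega> \<bullet> D \<omega>)"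
    unfolding inner_vec_def inner_real_def by (rule AE_bounded_sum)
  show "AE_bounded M V" unfolding V_def by (intro AE_bounded_diff bd EYb PDb)
  \<comment> \<open>R is the explained part of Y. Being of the form treated by
    \<open>decomposition_unique\<close>, it has the same conditional expectation and projection as
    Y, so both vanish for the difference Y - R.\<close>
  define R where "R \<omega> = E Y \<omega> + proj Y \<omega> \<bullet> D \<omega>" for \<omega>
  have Ri: "integrable M R"
    unfolding R_def by (intro AE_bounded_integrable AE_bounded_add EYb PDb) measurable
  have Yi: "integrable M Y" by (intro AE_bounded_integrable bd Y)
  have R: "AE \<omega> in M. E Y \<omega> = E R \<omega> \<and> proj Y \<omega> = proj R \<omega>"
    by (rule decomposition_unique[OF _ proj_measurable Ri]) (auto simp: R_def)
  have V_eq: "V = (\<lambda>\<omega>. Y \<omega> - R \<omega>)" by (auto simp: V_def R_def)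
  show "AE \<omega> in M. E V \<omega> = 0"
    unfolding V_eq using real_cond_exp_diff[OF Yi Ri] R by eventually_elim simp
  have "AE \<omega> in M. proj V \<omega> = 0"
    unfolding V_eq using proj_diff[OF Yi Ri] R by eventually_elim simp
  then show "AE \<omega> in M. E (\<lambda>\<omega>. V \<omega> * D \<omega> $ k) \<omega> = 0"
  proof eventually_elim
    case (elim \<omega>)
    then have "proj V \<omega> $ k = 0" by simp
    then show ?case using h_pos by (simp add: proj_component)
  qed
qed

end

section \<open>A priori bound, comparison and uniqueness along the grid\<close>

locale small_grid = grid_martingale M T n \<tau> X
  for M :: "'a measure" and T n \<tau> and X :: "real \<Rightarrow> 'a \<Rightarrow> real^'d::finite" +
  fixes K L q c :: real and \<beta> \<rho> a :: "nat \<Rightarrow> real"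
  assumes D_bounded: "i < n \<Longrightarrow> AE \<omega> in M. \<forall>k. \<bar>D i \<omega> $ k\<bar> \<le> \<beta> i"
    and K: "0 \<le> K" and L: "0 \<le> L" and q: "1 \<le> q" and c: "0 < c"
    and \<rho>: "i < n \<Longrightarrow> CARD('d) * c / sqrt (h i) \<le> \<rho> i"
    and small_K: "i < n \<Longrightarrow> K * h i \<le> 1 / 2"
    and small_Kz: "i < n \<Longrightarrow> K * \<rho> i powr (q - 1) * (CARD('d) * \<beta> i) \<le> 1"
    and small_Ly: "i < n \<Longrightarrow> L * (1 + \<rho> i powr q) * h i \<le> 1 / 2"
    and small_Lz: "i < n \<Longrightarrow> L * (1 + \<rho> i powr (q / 2)) * (CARD('d) * \<beta> i) \<le> 1"
    and a_le: "i \<le> n \<Longrightarrow> a i \<le> c"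
    and a_step: "i < n \<Longrightarrow> a (Suc i) + K * h i \<le> a i * (1 - K * h i)"
begin

lemma small_step: "i < n \<Longrightarrow> small_step M (F i) (D i) (h i) (\<beta> i) K L q c (\<rho> i)"
  by (intro small_step.intro one_step small_step_axioms.intro D_bounded K L q c \<rho>
      small_K small_Kz small_Ly small_Lz)

abbreviation "Ec i \<equiv> real_cond_exp M (F i)"
abbreviation "pr i \<equiv> one_step.proj M (F i) (D i) (h i)"

definition good_driver :: "(real \<Rightarrow> 'a \<Rightarrow> real \<Rightarrow> real^'d \<Rightarrow> real) \<Rightarrow> bool" where
  "good_driver f \<longleftrightarrow> (\<forall>i<n. small_step.slice M (F i) K L q c (f (\<tau> (Suc i))))"

lemma is_solutionD:
  assumes "is_solution M T n \<tau> X f \<xi> Y Z U"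
  shows sol_Y_adapted: "adapted T \<F> Y" and sol_Y_const: "constant_right_open M n \<tau> Y"
    and sol_Z_adapted: "adapted T \<F> Z" and sol_Z_const: "constant_left_open M n \<tau> Z"
    and sol_U_martingale: "martingale M T \<F> U"
    and sol_U_square: "\<forall>t\<in>{0..T}. integrable M (\<lambda>\<omega>. (U t \<omega>)\<^sup>2)"
    and sol_U_0: "AE \<omega> in M. U 0 \<omega> = 0"
    and sol_U_orth: "\<And>k. martingale M T \<F> (\<lambda>t \<omega>. U t \<omega> * X t \<omega> $ k)"
    and sol_U_const: "constant_right_open M n \<tau> U"
    and sol_terminal: "AE \<omega> in M. Y T \<omega> = \<xi> \<omega>"
    and sol_eq: "\<And>i. i < n \<Longrightarrow> AE \<omega> in M. Y (\<tau> i) \<omega> = Y (\<tau> (Suc i)) \<omega>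
            + f (\<tau> (Suc i)) \<omega> (Y (\<tau> i) \<omega>) (Z (\<tau> (Suc i)) \<omega>) * h i
            - Z (\<tau> (Suc i)) \<omega> \<bullet> D i \<omega> - (U (\<tau> (Suc i)) \<omega> - U (\<tau> i) \<omega>)"
  using assms
  unfolding is_solution_def Let_def square_integrable_martingale_def h_def D_def increment_def
  by simp_all

text \<open>Discrete product rule: with s and t the ends of the step, V times D is the increment of
  U X minus U_s D minus X_s V, and each of these three terms has conditional mean 0. Square
  integrability makes all the products integrable.\<close>

lemma martingale_orthogonal_increment:
  assumes U: "martingale M T \<F> U" and sq: "\<forall>t\<in>{0..T}. integrable M (\<lambda>\<omega>. (U t \<omega>)\<^sup>2)"
    and UX: "\<And>k. martingale M T \<F> (\<lambda>t \<omega>. U t \<omega> * X t \<omega> $ k)" and i: "i < n"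
  defines "V \<equiv> \<lambda>\<omega>. U (\<tau> (Suc i)) \<omega> - U (\<tau> i) \<omega>"
  shows "integrable M V" "AE \<omega> in M. Ec i V \<omega> = 0"
    "AE \<omega> in M. Ec i (\<lambda>\<omega>. V \<omega> * D i \<omega> $ k) \<omega> = 0"
proof -
  interpret sigma_finite_subalgebra M "F i" using i by (intro sigma_finite_F) simp
  let ?s = "\<tau> i" and ?t = "\<tau> (Suc i)"
  have st: "?s \<in> {0..T}" "?t \<in> {?s..T}" "?t \<in> {0..T}"
    using \<tau>_in[of i] \<tau>_in[of "Suc i"] \<tau>_Suc[of i] i by auto
  have Ui: "integrable M (U t)" if "t \<in> {0..T}" for t using U that by (auto simp: martingale_def)
  then have UM: "U t \<in> borel_measurable M" if "t \<in> {0..T}" for t using that by auto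
  have UF: "U ?s \<in> borel_measurable (F i)" and XF: "(\<lambda>\<omega>. X ?s \<omega> $ k) \<in> borel_measurable (F i)" for k
    using U st X_component_measurable_F[of i i] i by (auto simp: martingale_def adapted_def)
  have XM: "(\<lambda>\<omega>. X t \<omega> $ k) \<in> borel_measurable M" if "t \<in> {0..T}" for t k
    using X_measurable[OF that] unfolding borel_measurable_vec_iff by blast
  have UXi: "integrable M (\<lambda>\<omega>. U s \<omega> * X t \<omega> $ k)" if "s \<in> {0..T}" "t \<in> {0..T}" for s t k
    using that by (intro integrable_mult_square_integrable UM XM sq[rule_format] X_square_integrable)
  have XUi: "integrable M (\<lambda>\<omega>. X s \<omega> $ k * U t \<omega>)" if "s \<in> {0..T}" "t \<in> {0..T}" for s t k
    using UXi[of t s k] that by (simp add: mult.commute)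
  show Vi: "integrable M V" unfolding V_def using Ui st by simp
  have EU: "AE \<omega> in M. Ec i (U ?t) \<omega> = U ?s \<omega>" using U st unfolding martingale_def by blast
  have EUs: "AE \<omega> in M. Ec i (U ?s) \<omega> = U ?s \<omega>" by (intro real_cond_exp_F_meas Ui st UF)
  have "AE \<omega> in M. Ec i V \<omega> = Ec i (U ?t) \<omega> - Ec i (U ?s) \<omega>"
    unfolding V_def by (intro real_cond_exp_diff Ui st)
  then show EV: "AE \<omega> in M. Ec i V \<omega> = 0" using EU EUs by eventually_elim simp
  have XVi: "integrable M (\<lambda>\<omega>. X ?s \<omega> $ k * V \<omega>)" and UDi: "integrable M (\<lambda>\<omega>. U ?s \<omega> * D i \<omega> $ k)" for k
    unfolding V_def D_def using UXi[OF st(1) st(1), of k] UXi[OF st(1) st(3), of k] XUi[OF st(1) st(1), of k] XUi[OF st(1) st(3), of k]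
    by (simp_all add: right_diff_distrib)
  have eq: "V \<omega> * D i \<omega> $ k = U ?t \<omega> * X ?t \<omega> $ k - U ?s \<omega> * X ?s \<omega> $ k - U ?s \<omega> * D i \<omega> $ k - X ?s \<omega> $ k * V \<omega>" for \<omega>
    by (simp add: V_def D_def algebra_simps)
  let ?A = "\<lambda>\<omega>. U ?t \<omega> * X ?t \<omega> $ k" and ?B = "\<lambda>\<omega>. U ?s \<omega> * X ?s \<omega> $ k"
    and ?C = "\<lambda>\<omega>. U ?s \<omega> * D i \<omega> $ k" and ?D = "\<lambda>\<omega>. X ?s \<omega> $ k * V \<omega>"
  have int: "integrable M ?A" "integrable M ?B" "integrable M ?C" "integrable M ?D"
    using UXi st XVi UDi by auto
  have "AE \<omega> in M. Ec i (\<lambda>\<omega>. ?A \<omega> - ?B \<omega> - ?C \<omega> - ?D \<omega>) \<omega> = Ec i (\<lambda>\<omega>. ?A \<omega> - ?B \<omega> - ?C \<omega>) \<omega> - Ec i ?D \<omega>"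
    by (intro real_cond_exp_diff Bochner_Integration.integrable_diff int)
  moreover have "AE \<omega> in M. Ec i (\<lambda>\<omega>. ?A \<omega> - ?B \<omega> - ?C \<omega>) \<omega> = Ec i (\<lambda>\<omega>. ?A \<omega> - ?B \<omega>) \<omega> - Ec i ?C \<omega>"
    by (intro real_cond_exp_diff Bochner_Integration.integrable_diff int)
  moreover have "AE \<omega> in M. Ec i (\<lambda>\<omega>. ?A \<omega> - ?B \<omega>) \<omega> = Ec i ?A \<omega> - Ec i ?B \<omega>"
    by (intro real_cond_exp_diff int)
  moreover have "AE \<omega> in M. Ec i ?A \<omega> = ?B \<omega>" using UX[of k] st unfolding martingale_def by blast
  moreover have "AE \<omega> in M. Ec i ?B \<omega> = ?B \<omega>"
    by (intro real_cond_exp_F_meas int borel_measurable_times UF XF)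
  moreover have "AE \<omega> in M. Ec i ?C \<omega> = U ?s \<omega> * Ec i (\<lambda>\<omega>. D i \<omega> $ k) \<omega>"
    using D_integrable[OF i, of k] by (intro real_cond_exp_mult UF int) auto
  moreover have "AE \<omega> in M. Ec i ?D \<omega> = X ?s \<omega> $ k * Ec i V \<omega>"
    using Vi by (intro real_cond_exp_mult XF int) auto
  moreover note EV D_mean[OF i, of k]
  ultimately show "AE \<omega> in M. Ec i (\<lambda>\<omega>. V \<omega> * D i \<omega> $ k) \<omega> = 0"
    unfolding eq by eventually_elim simp
qed

lemma solution_step:
  assumes sol: "is_solution M T n \<tau> X f \<xi> Y Z U" and f: "good_driver f" and i: "i < n"
    and bd: "AE_bounded M (Y (\<tau> (Suc i)))"
  shows "AE \<omega> in M. Y (\<tau> i) \<omega> = Ec i (Y (\<tau> (Suc i))) \<omega>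
           + f (\<tau> (Suc i)) \<omega> (Y (\<tau> i) \<omega>) (pr i (Y (\<tau> (Suc i))) \<omega>) * h i"
    and "AE \<omega> in M. Z (\<tau> (Suc i)) \<omega> = pr i (Y (\<tau> (Suc i))) \<omega>"
proof -
  interpret S: small_step M "F i" "D i" "h i" "\<beta> i" K L q c "\<rho> i" using i by (rule small_step)
  let ?Y = "Y (\<tau> i)" and ?Y' = "Y (\<tau> (Suc i))" and ?Z = "Z (\<tau> (Suc i))" and ?g = "f (\<tau> (Suc i))"
  let ?V = "\<lambda>\<omega>. U (\<tau> (Suc i)) \<omega> - U (\<tau> i) \<omega>"
  note V = martingale_orthogonal_increment[OF sol_U_martingale[OF sol] sol_U_square[OF sol] sol_U_orth[OF sol] i]
  have g: "S.slice ?g" using f i unfolding good_driver_def by blast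
  have YF: "?Y \<in> borel_measurable (F i)" and Y'F: "?Y' \<in> borel_measurable (F (Suc i))"
    using sol_Y_adapted[OF sol] \<tau>_in[of i] \<tau>_in[of "Suc i"] i unfolding adapted_def by auto
  have Y'M: "?Y' \<in> borel_measurable M" using i by (intro measurable_F_M[OF _ Y'F]) simp
  have ZF: "?Z \<in> borel_measurable (F i)"
    by (rule constant_left_open_measurable[OF sol_Z_adapted[OF sol] sol_Z_const[OF sol] i])
  have Y'i: "integrable M ?Y'" by (intro AE_bounded_integrable bd Y'M)
  have AF: "(\<lambda>\<omega>. ?Y \<omega> - ?g \<omega> (?Y \<omega>) (?Z \<omega>) * h i) \<in> borel_measurable (F i)"
    by (intro borel_measurable_diff borel_measurable_times YF S.slice_measurable_compose[OF g YF ZF]) simp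
  have R: "integrable M (\<lambda>\<omega>. ?Y' \<omega> - ?V \<omega>)" using Y'i V(1) by (rule Bochner_Integration.integrable_diff)
  have eq: "AE \<omega> in M. ?Y' \<omega> - ?V \<omega> = (?Y \<omega> - ?g \<omega> (?Y \<omega>) (?Z \<omega>) * h i) + ?Z \<omega> \<bullet> D i \<omega>"
    using sol_eq[OF sol i] by eventually_elim simp
  note dec = S.decomposition_unique[OF AF ZF R eq]
  have "AE \<omega> in M. \<forall>k\<in>UNIV. Ec i (\<lambda>\<omega>. ?V \<omega> * D i \<omega> $ k) \<omega> = 0"
    by (subst AE_ball_countable) (auto intro: V(3))
  then have projV: "AE \<omega> in M. pr i ?V \<omega> = 0"
    by eventually_elim (simp add: vec_eq_iff S.proj_component)
  note diff = S.real_cond_exp_diff[OF Y'i V(1)] S.proj_diff[OF Y'i V(1)]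
  show Z: "AE \<omega> in M. ?Z \<omega> = pr i ?Y' \<omega>"
    using dec diff(2) projV by eventually_elim simp
  show "AE \<omega> in M. ?Y \<omega> = Ec i ?Y' \<omega> + ?g \<omega> (?Y \<omega>) (pr i ?Y' \<omega>) * h i"
    using dec diff(1) V(2) Z
  proof eventually_elim
    case (elim \<omega>)
    then have "?Y \<omega> = Ec i ?Y' \<omega> + ?g \<omega> (?Y \<omega>) (?Z \<omega>) * h i" by linarith
    then show ?case by (simp only: elim(4))
  qed
qed

lemma a_bound:
  assumes i: "i < n" and y: "y \<le> (a (Suc i) + K * h i) / (1 - K * h i)"
  shows "y \<le> a i"
proof -
  have "0 < 1 - K * h i" using small_K[OF i] by simp
  then have "(a (Suc i) + K * h i) / (1 - K * h i) \<le> a i"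
    using a_step[OF i] by (simp add: pos_divide_le_eq)
  then show ?thesis using y by simp
qed

lemma solution_measurable:
  assumes sol: "is_solution M T n \<tau> X f \<xi> Y Z U" and i: "i \<le> n"
  shows "Y (\<tau> i) \<in> borel_measurable M"
  using sol_Y_adapted[OF sol] \<tau>_in[OF i] measurable_F_M[OF i] unfolding adapted_def by blast

text \<open>Boundedness is not part of the notion of solution. It is known at T, and going backwards
  the bound at the later grid point is what entitles \<open>solution_step\<close> to be used at the
  earlier one.\<close>

lemma solution_bound:
  assumes sol: "is_solution M T n \<tau> X f \<xi> Y Z U" and f: "good_driver f"
    and \<xi>: "AE \<omega> in M. \<bar>\<xi> \<omega>\<bar> \<le> a n" and i: "i \<le> n"
  shows "AE \<omega> in M. \<bar>Y (\<tau> i) \<omega>\<bar> \<le> a i"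
  using i
proof (induction rule: inc_induct)
  case base
  show ?case using sol_terminal[OF sol] \<xi> unfolding \<tau>_n by eventually_elim simp
next
  case (step i)
  interpret S: small_step M "F i" "D i" "h i" "\<beta> i" K L q c "\<rho> i" using step by (intro small_step)
  have "AE \<omega> in M. \<bar>Y (\<tau> i) \<omega>\<bar> \<le> (a (Suc i) + K * h i) / (1 - K * h i)"
  proof (rule S.a_priori_bound)
    show "S.slice (f (\<tau> (Suc i)))" using f step unfolding good_driver_def by blast
    show "Y (\<tau> (Suc i)) \<in> borel_measurable M" using step by (intro solution_measurable[OF sol]) simp
    show "AE \<omega> in M. Y (\<tau> i) \<omega> = Ec i (Y (\<tau> (Suc i))) \<omega>
           + f (\<tau> (Suc i)) \<omega> (Y (\<tau> i) \<omega>) (pr i (Y (\<tau> (Suc i))) \<omega>) * h i"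
      using step by (intro solution_step[OF sol f] AE_boundedI) auto
  qed (use step a_le in auto)
  then show ?case by eventually_elim (use a_bound step in blast)
qed

lemma solution_comparison:
  assumes sol1: "is_solution M T n \<tau> X f1 \<xi>1 Y1 Z1 U1" and sol2: "is_solution M T n \<tau> X f2 \<xi>2 Y2 Z2 U2"
    and f1: "good_driver f1" and f2: "good_driver f2"
    and \<xi>1: "AE \<omega> in M. \<bar>\<xi>1 \<omega>\<bar> \<le> a n" and \<xi>2: "AE \<omega> in M. \<bar>\<xi>2 \<omega>\<bar> \<le> a n"
    and f12: "\<And>i. i < n \<Longrightarrow> AE \<omega> in M. \<forall>y z. f2 (\<tau> (Suc i)) \<omega> y z \<le> f1 (\<tau> (Suc i)) \<omega> y z"
    and \<xi>12: "AE \<omega> in M. \<xi>2 \<omega> \<le> \<xi>1 \<omega>"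
    and i: "i \<le> n"
  shows "AE \<omega> in M. Y2 (\<tau> i) \<omega> \<le> Y1 (\<tau> i) \<omega>"
  using i
proof (induction rule: inc_induct)
  case base
  show ?case using sol_terminal[OF sol1] sol_terminal[OF sol2] \<xi>12 unfolding \<tau>_n by eventually_elim simp
next
  case (step i)
  interpret S: small_step M "F i" "D i" "h i" "\<beta> i" K L q c "\<rho> i" using step by (intro small_step)
  have bd: "AE \<omega> in M. \<bar>Y1 (\<tau> j) \<omega>\<bar> \<le> c" "AE \<omega> in M. \<bar>Y2 (\<tau> j) \<omega>\<bar> \<le> c" if "j \<le> n" for j
    using solution_bound[OF sol1 f1 \<xi>1 that] solution_bound[OF sol2 f2 \<xi>2 that]
    by (eventually_elim, use a_le[OF that] in simp)+
  show ?case
  proof (rule S.comparison)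
    show "S.slice (f1 (\<tau> (Suc i)))" using f1 step unfolding good_driver_def by blast
    show "AE \<omega> in M. \<forall>y z. f2 (\<tau> (Suc i)) \<omega> y z \<le> f1 (\<tau> (Suc i)) \<omega> y z" using step by (intro f12)
    show "Y1 (\<tau> (Suc i)) \<in> borel_measurable M" "Y2 (\<tau> (Suc i)) \<in> borel_measurable M"
      using step by (auto intro: solution_measurable[OF sol1] solution_measurable[OF sol2])
    show "AE \<omega> in M. Y1 (\<tau> i) \<omega> = Ec i (Y1 (\<tau> (Suc i))) \<omega>
           + f1 (\<tau> (Suc i)) \<omega> (Y1 (\<tau> i) \<omega>) (pr i (Y1 (\<tau> (Suc i))) \<omega>) * h i"
      using step by (intro solution_step[OF sol1 f1] AE_boundedI[OF bd(1)]) auto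
    show "AE \<omega> in M. Y2 (\<tau> i) \<omega> = Ec i (Y2 (\<tau> (Suc i))) \<omega>
           + f2 (\<tau> (Suc i)) \<omega> (Y2 (\<tau> i) \<omega>) (pr i (Y2 (\<tau> (Suc i))) \<omega>) * h i"
      using step by (intro solution_step[OF sol2 f2] AE_boundedI[OF bd(2)]) auto
  qed (use step bd in auto)
qed

text \<open>Comparison in both directions fixes Y on the grid, Z is the projection of the next value
  of Y, and the equation then yields the increments of U, summed forwards from U = 0 at time 0.
  Finitely many null sets suffice, since all processes are constant between grid points.\<close>

lemma solution_unique:
  assumes sol: "is_solution M T n \<tau> X f \<xi> Y Z U" and sol': "is_solution M T n \<tau> X f \<xi> Y' Z' U'"
    and f: "good_driver f" and \<xi>: "AE \<omega> in M. \<bar>\<xi> \<omega>\<bar> \<le> a n"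
  shows "AE \<omega> in M. (\<forall>t\<in>{0..T}. Y t \<omega> = Y' t \<omega>) \<and> (\<forall>t\<in>{0<..T}. Z t \<omega> = Z' t \<omega>) \<and>
    (\<forall>t\<in>{0..T}. U t \<omega> = U' t \<omega>)"
proof -
  have Yeq: "AE \<omega> in M. Y (\<tau> i) \<omega> = Y' (\<tau> i) \<omega>" if "i \<le> n" for i
  proof -
    have "AE \<omega> in M. Y (\<tau> i) \<omega> \<le> Y' (\<tau> i) \<omega>" "AE \<omega> in M. Y' (\<tau> i) \<omega> \<le> Y (\<tau> i) \<omega>"
      using that by (intro solution_comparison[OF sol' sol f f \<xi> \<xi>] solution_comparison[OF sol sol' f f \<xi> \<xi>]; simp)+
    then show ?thesis by eventually_elim simp
  qed
  have bd: "AE_bounded M (Y (\<tau> i))" "AE_bounded M (Y' (\<tau> i))" if "i \<le> n" for i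
    using solution_bound[OF sol f \<xi> that] solution_bound[OF sol' f \<xi> that] by (blast intro: AE_boundedI)+
  have Zeq: "AE \<omega> in M. Z (\<tau> (Suc i)) \<omega> = Z' (\<tau> (Suc i)) \<omega>" if i: "i < n" for i
  proof -
    interpret S: small_step M "F i" "D i" "h i" "\<beta> i" K L q c "\<rho> i" using i by (rule small_step)
    have "AE \<omega> in M. pr i (Y (\<tau> (Suc i))) \<omega> = pr i (Y' (\<tau> (Suc i))) \<omega>"
      using i by (intro S.proj_cong Yeq solution_measurable[OF sol] solution_measurable[OF sol']) auto
    moreover have "AE \<omega> in M. Z (\<tau> (Suc i)) \<omega> = pr i (Y (\<tau> (Suc i))) \<omega>"
      "AE \<omega> in M. Z' (\<tau> (Suc i)) \<omega> = pr i (Y' (\<tau> (Suc i))) \<omega>"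
      using i by (intro solution_step(2)[OF sol f i] solution_step(2)[OF sol' f i] bd; simp)+
    ultimately show ?thesis by eventually_elim simp
  qed
  have Ueq: "AE \<omega> in M. U (\<tau> i) \<omega> = U' (\<tau> i) \<omega>" if "i \<le> n" for i
    using that
  proof (induction i)
    case 0
    show ?case using sol_U_0[OF sol] sol_U_0[OF sol'] unfolding \<tau>_0 by eventually_elim simp
  next
    case (Suc i)
    then have i: "i < n" by simp
    then have "AE \<omega> in M. U (\<tau> i) \<omega> = U' (\<tau> i) \<omega>" using Suc by simp
    moreover have "AE \<omega> in M. Y (\<tau> i) \<omega> = Y' (\<tau> i) \<omega>" "AE \<omega> in M. Y (\<tau> (Suc i)) \<omega> = Y' (\<tau> (Suc i)) \<omega>"
      using i by (auto intro: Yeq)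
    moreover note Zeq[OF i] sol_eq[OF sol i] sol_eq[OF sol' i]
    ultimately show ?case by eventually_elim simp
  qed
  have "AE \<omega> in M. \<forall>i\<in>{..n}. Y (\<tau> i) \<omega> = Y' (\<tau> i) \<omega>" "AE \<omega> in M. \<forall>i\<in>{..<n}. Z (\<tau> (Suc i)) \<omega> = Z' (\<tau> (Suc i)) \<omega>"
    "AE \<omega> in M. \<forall>i\<in>{..n}. U (\<tau> i) \<omega> = U' (\<tau> i) \<omega>"
    using Yeq Zeq Ueq by (simp_all add: AE_ball_countable)
  then show ?thesis
    using AE_space
  proof eventually_elim
    case (elim \<omega>)
    have "Y t \<omega> = Y' t \<omega>" "U t \<omega> = U' t \<omega>" if t: "t \<in> {0..T}" for t
      using constant_right_openD[OF sol_Y_const[OF sol] t elim(4)] constant_right_openD[OF sol_Y_const[OF sol'] t elim(4)]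
        constant_right_openD[OF sol_U_const[OF sol] t elim(4)] constant_right_openD[OF sol_U_const[OF sol'] t elim(4)]
        elim(1,3) idx_le[OF t] by auto
    moreover have "Z t \<omega> = Z' t \<omega>" if t: "t \<in> {0<..T}" for t
      using constant_left_openD[OF sol_Z_const[OF sol] t elim(4)] constant_left_openD[OF sol_Z_const[OF sol'] t elim(4)]
        elim(2) lidx_less[OF t] by auto
    ultimately show ?case by blast
  qed
qed

end

section \<open>Existence along the grid\<close>

context small_grid
begin

text \<open>The lower index m is a variable so that downward induction can extend the family by one
  value at a time. The measurability and the bound carried along are what the implicit equation at
  the next lower index requires.\<close>

lemma discrete_solution_exists:
  assumes f: "good_driver f" and \<xi>M: "\<xi> \<in> borel_measurable (\<F> T)"
    and \<xi>: "AE \<omega> in M. \<bar>\<xi> \<omega>\<bar> \<le> a n" and m: "m \<le> n"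
  shows "\<exists>y. y n = \<xi> \<and>
    (\<forall>i\<in>{m..n}. y i \<in> borel_measurable (F i) \<and> (AE \<omega> in M. \<bar>y i \<omega>\<bar> \<le> a i)) \<and>
    (\<forall>i\<in>{m..<n}. AE \<omega> in M.
       y i \<omega> = Ec i (y (Suc i)) \<omega> + f (\<tau> (Suc i)) \<omega> (y i \<omega>) (pr i (y (Suc i)) \<omega>) * h i)"
  using m
proof (induction rule: inc_induct)
  case base
  show ?case using \<xi>M \<xi> \<tau>_n by (intro exI[of _ "\<lambda>_. \<xi>"]) simp
next
  case (step m)
  from step.IH obtain y where y: "y n = \<xi>"
    "\<forall>i\<in>{Suc m..n}. y i \<in> borel_measurable (F i) \<and> (AE \<omega> in M. \<bar>y i \<omega>\<bar> \<le> a i)"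
    "\<forall>i\<in>{Suc m..<n}. AE \<omega> in M.
       y i \<omega> = Ec i (y (Suc i)) \<omega> + f (\<tau> (Suc i)) \<omega> (y i \<omega>) (pr i (y (Suc i)) \<omega>) * h i"
    by (elim exE conjE)
  have m: "m < n" using step by simp
  interpret S: small_step M "F m" "D m" "h m" "\<beta> m" K L q c "\<rho> m" using m by (rule small_step)
  have g: "S.slice (f (\<tau> (Suc m)))" using f m unfolding good_driver_def by blast
  have yM: "y (Suc m) \<in> borel_measurable M" using m y(2) by (intro measurable_F_M[of "Suc m"]) auto
  have yb: "AE \<omega> in M. \<bar>y (Suc m) \<omega>\<bar> \<le> a (Suc m)" using m y(2) by auto
  have ac: "a (Suc m) \<le> c" using m by (intro a_le) simp
  have Kh: "0 \<le> 1 - K * h m" using small_K[OF m] by simp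
  \<comment> \<open>Replacing \<open>a m\<close> by its upper bound c in the recursion for a gives
    the condition that keeps the implicit equation within [-c, c].\<close>
  have "a (Suc m) + K * h m \<le> c * (1 - K * h m)"
    using a_step[OF m] mult_right_mono[OF a_le[of m] Kh] m by linarith
  then have "a (Suc m) + K * h m * (1 + c) \<le> c" by (simp add: algebra_simps)
  then obtain v where v: "v \<in> borel_measurable (F m)"
    "AE \<omega> in M. v \<omega> = Ec m (y (Suc m)) \<omega> + f (\<tau> (Suc m)) \<omega> (v \<omega>) (pr m (y (Suc m)) \<omega>) * h m"
    using S.implicit_solution_exists[OF g yM yb ac] by blast
  have vb: "AE \<omega> in M. \<bar>v \<omega>\<bar> \<le> a m"
    using S.a_priori_bound[OF g yM yb ac v(2)] by eventually_elim (use a_bound m in blast)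
  show ?case
  proof (intro exI[of _ "y(m := v)"] conjI ballI)
    show "(y(m := v)) n = \<xi>" using y(1) m by simp
    fix i assume "i \<in> {m..n}"
    then show "(y(m := v)) i \<in> borel_measurable (F i)" "AE \<omega> in M. \<bar>(y(m := v)) i \<omega>\<bar> \<le> a i"
      using y(2) v(1) vb by (cases "i = m"; simp)+
  next
    fix i assume i: "i \<in> {m..<n}"
    show "AE \<omega> in M. (y(m := v)) i \<omega> = Ec i ((y(m := v)) (Suc i)) \<omega>
        + f (\<tau> (Suc i)) \<omega> ((y(m := v)) i \<omega>) (pr i ((y(m := v)) (Suc i)) \<omega>) * h i"
    proof (cases "i = m")
      case True
      then show ?thesis using v(2) by simp
    next
      case False
      then show ?thesis using y(3) i by simp
    qed
  qed
qed

lemma X_grid_bounded: "i \<le> n \<Longrightarrow> AE_bounded M (\<lambda>\<omega>. X (\<tau> i) \<omega> $ k)"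
proof (induction i)
  case 0
  have "AE \<omega> in M. X 0 \<omega> = 0" using approx by (simp add: approximating_process_def)
  then have "AE \<omega> in M. \<bar>X (\<tau> 0) \<omega> $ k\<bar> \<le> 0" unfolding \<tau>_0 by eventually_elim simp
  then show ?case by (rule AE_boundedI)
next
  case (Suc i)
  have "AE \<omega> in M. \<bar>D i \<omega> $ k\<bar> \<le> \<beta> i" using D_bounded[of i] Suc.prems by auto
  then have "AE_bounded M (\<lambda>\<omega>. X (\<tau> i) \<omega> $ k + D i \<omega> $ k)"
    using Suc by (intro AE_bounded_add AE_boundedI[where f = "\<lambda>\<omega>. D i \<omega> $ k"]) auto
  then show ?case by (simp add: D_def)
qed

text \<open>The orthogonal martingale is the running sum of the one-step remainders of
  \<open>residual\<close>. On the grid all its values, and those of the driving process, are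
  bounded, which supplies every integrability that is needed.\<close>

lemma solution_exists:
  assumes f: "good_driver f" and \<xi>M: "\<xi> \<in> borel_measurable (\<F> T)"
    and \<xi>: "AE \<omega> in M. \<bar>\<xi> \<omega>\<bar> \<le> a n"
  shows "\<exists>Y Z U. is_solution M T n \<tau> X f \<xi> Y Z U"
proof -
  obtain y where y: "y n = \<xi>"
    "\<And>i. i \<le> n \<Longrightarrow> y i \<in> borel_measurable (F i)"
    "\<And>i. i \<le> n \<Longrightarrow> AE \<omega> in M. \<bar>y i \<omega>\<bar> \<le> a i"
    "\<And>i. i < n \<Longrightarrow> AE \<omega> in M.
       y i \<omega> = Ec i (y (Suc i)) \<omega> + f (\<tau> (Suc i)) \<omega> (y i \<omega>) (pr i (y (Suc i)) \<omega>) * h i"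
    using discrete_solution_exists[OF f \<xi>M \<xi>, of 0] by auto
  define z where "z i = pr i (y (Suc i))" for i
  define V where "V i \<omega> = y (Suc i) \<omega> - Ec i (y (Suc i)) \<omega> - z i \<omega> \<bullet> D i \<omega>" for i \<omega>
  define u where "u i \<omega> = (\<Sum>j<i. V j \<omega>)" for i \<omega>
  define Y where "Y t = y (idx t)" for t
  \<comment> \<open>No left-open cell contains time 0, so \<open>lidx\<close> gives nothing there;
    the constant 0 keeps Z adapted.\<close>
  define Z where "Z t = (if t \<le> 0 then (\<lambda>_. 0) else z (lidx t))" for t :: real
  define U where "U t = u (idx t)" for t

  have yM: "y i \<in> borel_measurable M" if "i \<le> n" for i using measurable_F_M[OF that y(2)[OF that]] .
  have yb: "AE_bounded M (y i)" if "i \<le> n" for i using y(3)[OF that] by (rule AE_boundedI)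
  have zF: "z i \<in> borel_measurable (F i)" if "i < n" for i
  proof -
    interpret S: small_step M "F i" "D i" "h i" "\<beta> i" K L q c "\<rho> i" using that by (rule small_step)
    show ?thesis unfolding z_def by (rule S.proj_measurable)
  qed
  have V: "AE_bounded M (V i)" "AE \<omega> in M. Ec i (V i) \<omega> = 0"
    "AE \<omega> in M. Ec i (\<lambda>\<omega>. V i \<omega> * D i \<omega> $ k) \<omega> = 0" if i: "i < n" for i k
  proof -
    interpret S: small_step M "F i" "D i" "h i" "\<beta> i" K L q c "\<rho> i" using i by (rule small_step)
    have V_eq: "V i = (\<lambda>\<omega>. y (Suc i) \<omega> - Ec i (y (Suc i)) \<omega> - pr i (y (Suc i)) \<omega> \<bullet> D i \<omega>)"
      by (auto simp: V_def z_def)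
    have Suc: "Suc i \<le> n" using i by simp
    note r = S.residual[OF yM[OF Suc] yb[OF Suc]]
    show "AE_bounded M (V i)" "AE \<omega> in M. Ec i (V i) \<omega> = 0"
      "AE \<omega> in M. Ec i (\<lambda>\<omega>. V i \<omega> * D i \<omega> $ k) \<omega> = 0"
      unfolding V_eq using r by blast+
  qed
  have VF: "V i \<in> borel_measurable (F (Suc i))" if i: "i < n" for i
  proof -
    have "Ec i (y (Suc i)) \<in> borel_measurable (F (Suc i))"
      using i by (intro measurable_F_mono[of i "Suc i"]) auto
    moreover have "z i \<in> borel_measurable (F (Suc i))"
      using i by (intro measurable_F_mono[of i "Suc i"] zF) auto
    ultimately show ?thesis
      unfolding V_def using i by (intro borel_measurable_diff borel_measurable_inner y(2) D_measurable_F) auto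
  qed
  have uF: "u i \<in> borel_measurable (F i)" if "i \<le> n" for i
    unfolding u_def using that by (intro borel_measurable_sum measurable_F_mono[OF _ _ VF]) auto
  have ub: "AE_bounded M (u i)" if "i \<le> n" for i
    unfolding u_def using that by (intro AE_bounded_sum V(1)) auto
  have u_Suc: "u (Suc i) = (\<lambda>\<omega>. u i \<omega> + V i \<omega>)" for i by (auto simp: u_def)
  have uM: "u i \<in> borel_measurable M" if "i \<le> n" for i using measurable_F_M[OF that uF[OF that]] .
  have VM: "V i \<in> borel_measurable M" if "i < n" for i
    using that by (intro measurable_F_M[OF _ VF]) auto
  have XF: "(\<lambda>\<omega>. X (\<tau> i) \<omega> $ k) \<in> borel_measurable (F i)" if "i \<le> n" for i k
    using that by (intro X_component_measurable_F) auto
  have XM: "(\<lambda>\<omega>. X (\<tau> i) \<omega> $ k) \<in> borel_measurable M" if "i \<le> n" for i k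
    using measurable_F_M[OF that XF[OF that]] .
  have DM: "(\<lambda>\<omega>. D i \<omega> $ k) \<in> borel_measurable M" if "i < n" for i k
    using D_integrable[OF that] by auto
  have Db: "AE_bounded M (\<lambda>\<omega>. D i \<omega> $ k)" if "i < n" for i k
    using D_bounded[OF that] by (intro AE_boundedI[where b = "\<beta> i"]) auto
  have idx_const: "idx t = idx (\<tau> i)" if "i < n" "t \<in> {\<tau> i..<\<tau> (Suc i)}" for t i
    using that idx_eq[of i t] idx_\<tau>[of i] by auto
  have U_const: "constant_right_open M n \<tau> U"
    unfolding constant_right_open_def U_def using idx_const by metis
  have U_grid: "U (\<tau> i) = u i" if "i \<le> n" for i unfolding U_def using idx_\<tau>[OF that] by simp
  have U_mart: "martingale M T \<F> U"
  proof (rule martingale_from_grid[OF U_const])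
    fix i assume i: "i \<le> n"
    show "U (\<tau> i) \<in> borel_measurable (F i)" unfolding U_grid[OF i] using i by (rule uF)
    show "integrable M (U (\<tau> i))" unfolding U_grid[OF i] using i by (intro AE_bounded_integrable ub uM)
  next
    fix i assume i: "i < n"
    then have i': "i \<le> n" "Suc i \<le> n" by auto
    interpret sigma_finite_subalgebra M "F i" using i' by (intro sigma_finite_F)
    have int: "integrable M (u i)" "integrable M (V i)"
      using i by (auto intro!: AE_bounded_integrable ub uM V(1) VM)
    have "AE \<omega> in M. Ec i (\<lambda>\<omega>. u i \<omega> + V i \<omega>) \<omega> = Ec i (u i) \<omega> + Ec i (V i) \<omega>"
      by (intro real_cond_exp_add int)
    moreover have "AE \<omega> in M. Ec i (u i) \<omega> = u i \<omega>"
      by (intro real_cond_exp_F_meas int uF i')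
    moreover note V(2)[OF i]
    ultimately show "AE \<omega> in M. Ec i (U (\<tau> (Suc i))) \<omega> = U (\<tau> i) \<omega>"
      unfolding U_grid[OF i'(1)] U_grid[OF i'(2)] u_Suc by eventually_elim simp
  qed
  have UX_mart: "martingale M T \<F> (\<lambda>t \<omega>. U t \<omega> * X t \<omega> $ k)" for k
  proof (rule martingale_from_grid)
    show "constant_right_open M n \<tau> (\<lambda>t \<omega>. U t \<omega> * X t \<omega> $ k)"
      using U_const X_const unfolding constant_right_open_def by metis
    fix i assume i: "i \<le> n"
    show "(\<lambda>\<omega>. U (\<tau> i) \<omega> * X (\<tau> i) \<omega> $ k) \<in> borel_measurable (F i)"
      unfolding U_grid[OF i] using i by (intro borel_measurable_times uF XF)
    show "integrable M (\<lambda>\<omega>. U (\<tau> i) \<omega> * X (\<tau> i) \<omega> $ k)"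
      unfolding U_grid[OF i] using i
      by (intro AE_bounded_integrable AE_bounded_mult ub X_grid_bounded borel_measurable_times uM XM)
  next
    fix i assume i: "i < n"
    then have i': "i \<le> n" "Suc i \<le> n" by auto
    interpret sigma_finite_subalgebra M "F i" using i' by (intro sigma_finite_F)
    \<comment> \<open>The four terms of the product rule: given the past, the first is known, and
      the others have mean 0 because D has mean 0, V has mean 0, and V is orthogonal to D.\<close>
    let ?A = "\<lambda>\<omega>. u i \<omega> * X (\<tau> i) \<omega> $ k" and ?B = "\<lambda>\<omega>. u i \<omega> * D i \<omega> $ k"
      and ?C = "\<lambda>\<omega>. X (\<tau> i) \<omega> $ k * V i \<omega>" and ?D = "\<lambda>\<omega>. V i \<omega> * D i \<omega> $ k"
    have int: "integrable M ?A" "integrable M ?B" "integrable M ?C" "integrable M ?D"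
      by (intro AE_bounded_integrable AE_bounded_mult borel_measurable_times
          ub[OF i'(1)] uM[OF i'(1)] V(1)[OF i] VM[OF i] X_grid_bounded[OF i'(1)] XM[OF i'(1)] Db[OF i] DM[OF i])+
    have eq: "(\<lambda>\<omega>. u (Suc i) \<omega> * X (\<tau> (Suc i)) \<omega> $ k) = (\<lambda>\<omega>. ?A \<omega> + ?B \<omega> + ?C \<omega> + ?D \<omega>)"
      by (auto simp: u_Suc D_def algebra_simps)
    have "AE \<omega> in M. Ec i (\<lambda>\<omega>. ?A \<omega> + ?B \<omega> + ?C \<omega> + ?D \<omega>) \<omega> = Ec i (\<lambda>\<omega>. ?A \<omega> + ?B \<omega> + ?C \<omega>) \<omega> + Ec i ?D \<omega>"
      by (intro real_cond_exp_add Bochner_Integration.integrable_add int)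
    moreover have "AE \<omega> in M. Ec i (\<lambda>\<omega>. ?A \<omega> + ?B \<omega> + ?C \<omega>) \<omega> = Ec i (\<lambda>\<omega>. ?A \<omega> + ?B \<omega>) \<omega> + Ec i ?C \<omega>"
      by (intro real_cond_exp_add Bochner_Integration.integrable_add int)
    moreover have "AE \<omega> in M. Ec i (\<lambda>\<omega>. ?A \<omega> + ?B \<omega>) \<omega> = Ec i ?A \<omega> + Ec i ?B \<omega>"
      by (intro real_cond_exp_add int)
    moreover have "AE \<omega> in M. Ec i ?A \<omega> = ?A \<omega>"
      by (intro real_cond_exp_F_meas int borel_measurable_times uF XF i')
    moreover have "AE \<omega> in M. Ec i ?B \<omega> = u i \<omega> * Ec i (\<lambda>\<omega>. D i \<omega> $ k) \<omega>"
      by (intro real_cond_exp_mult int uF i' DM[OF i])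
    moreover have "AE \<omega> in M. Ec i ?C \<omega> = X (\<tau> i) \<omega> $ k * Ec i (V i) \<omega>"
      by (intro real_cond_exp_mult int XF i' VM[OF i])
    moreover note V(2)[OF i] V(3)[OF i, of k] D_mean[OF i, of k]
    ultimately show "AE \<omega> in M. Ec i (\<lambda>\<omega>. U (\<tau> (Suc i)) \<omega> * X (\<tau> (Suc i)) \<omega> $ k) \<omega> = U (\<tau> i) \<omega> * X (\<tau> i) \<omega> $ k"
      unfolding U_grid[OF i'(1)] U_grid[OF i'(2)] eq by eventually_elim simp
  qed
  have "is_solution M T n \<tau> X f \<xi> Y Z U"
    unfolding is_solution_def Let_def square_integrable_martingale_def
  proof (intro conjI allI impI ballI U_mart UX_mart U_const)
    show "adapted T \<F> Y"
      unfolding adapted_def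
    proof
      fix t assume t: "t \<in> {0..T}"
      show "Y t \<in> borel_measurable (\<F> t)" unfolding Y_def \<F>_idx[OF t] by (rule y(2)[OF idx_le[OF t]])
    qed
    show "constant_right_open M n \<tau> Y"
      unfolding constant_right_open_def Y_def using idx_const by metis
    show "adapted T \<F> Z"
      unfolding adapted_def
    proof
      fix t assume t: "t \<in> {0..T}"
      show "Z t \<in> borel_measurable (\<F> t)"
      proof (cases "t \<le> 0")
        case True
        then show ?thesis by (simp add: Z_def)
      next
        case False
        then have t': "t \<in> {0<..T}" using t by simp
        have "z (lidx t) \<in> borel_measurable (\<F> t)"
          using \<tau>_lidx_less[OF t']
          by (intro measurable_from_subalg[OF subalgebra_natural_filtration_mono zF[OF lidx_less[OF t']]]) simp
        then show ?thesis using False by (simp add: Z_def)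
      qed
    qed
    show "constant_left_open M n \<tau> Z"
      unfolding constant_left_open_def
    proof (intro allI impI ballI)
      fix i t \<omega> assume i: "i < n" and t: "t \<in> {\<tau> i<..\<tau> (Suc i)}"
      have "0 < t" "0 < \<tau> (Suc i)" using t i \<tau>_in[of i] by auto
      moreover have "lidx t = i" "lidx (\<tau> (Suc i)) = i" using t i \<tau>_Suc[OF i] by (auto intro: lidx_eq)
      ultimately show "Z t \<omega> = Z (\<tau> (Suc i)) \<omega>" by (simp add: Z_def)
    qed
    show "integrable M (\<lambda>\<omega>. (U t \<omega>)\<^sup>2)" if "t \<in> {0..T}" for t
      unfolding U_def power2_eq_square using idx_le[OF that]
      by (intro AE_bounded_integrable AE_bounded_mult ub borel_measurable_times uM)
    show "AE \<omega> in M. U 0 \<omega> = 0"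
      using U_grid[of 0] by (simp add: \<tau>_0 u_def)
    show "AE \<omega> in M. Y T \<omega> = \<xi> \<omega>"
      using idx_\<tau>[of n] y(1) by (simp add: Y_def \<tau>_n)
    fix i assume i: "i < n"
    have idx: "idx (\<tau> i) = i" "idx (\<tau> (Suc i)) = Suc i" using i by (auto intro: idx_\<tau>)
    have "0 < \<tau> (Suc i)" "lidx (\<tau> (Suc i)) = i" using i \<tau>_Suc[OF i] \<tau>_in[of i] by (auto intro: lidx_eq)
    then have Zi: "Z (\<tau> (Suc i)) = z i" by (simp add: Z_def)
    show "AE \<omega> in M. Y (\<tau> i) \<omega> = Y (\<tau> (Suc i)) \<omega>
        + f (\<tau> (Suc i)) \<omega> (Y (\<tau> i) \<omega>) (Z (\<tau> (Suc i)) \<omega>) * increment \<tau> (bracket M X) (Suc i)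
        - Z (\<tau> (Suc i)) \<omega> \<bullet> increment \<tau> (\<lambda>t. X t \<omega>) (Suc i) - increment \<tau> (\<lambda>t. U t \<omega>) (Suc i)"
      using y(4)[OF i]
    proof eventually_elim
      case (elim \<omega>)
      have 1: "increment \<tau> (\<lambda>t. X t \<omega>) (Suc i) = D i \<omega>" "increment \<tau> (bracket M X) (Suc i) = h i"
        by (simp_all add: increment_def D_def h_def)
      have 2: "increment \<tau> (\<lambda>t. U t \<omega>) (Suc i) = V i \<omega>"
        by (simp add: increment_def U_def idx u_Suc)
      show ?case
        unfolding 1 2 Zi Y_def idx V_def using elim unfolding z_def by linarith
    qed
  qed
  then show ?thesis by blast
qed

end

section \<open>Convergence of the brackets and choice of constants\<close>

lemma brownian_second_moment:
  assumes prob: "prob_space M" and BM: "brownian_motion M T W" and t: "t \<in> {0..T}"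
  shows "integrable M (\<lambda>\<omega>. (W t \<omega> $ k)\<^sup>2)" "(\<integral>\<omega>. (W t \<omega> $ k)\<^sup>2 \<partial>M) = t"
proof -
  interpret prob_space M by fact
  have W0: "AE \<omega> in M. W 0 \<omega> = 0" using BM by (simp add: brownian_motion_def)
  have meas: "(\<lambda>\<omega>. W s \<omega> $ k) \<in> borel_measurable M" if "s \<in> {0..T}" for s
  proof (rule measurable_compose[of "W s" M borel])
    show "W s \<in> borel_measurable M" using BM that by (simp add: brownian_motion_def)
    show "(\<lambda>v. v $ k) \<in> borel_measurable borel" by (intro borel_measurable_continuous_onI continuous_intros)
  qed
  have "integrable M (\<lambda>\<omega>. (W t \<omega> $ k)\<^sup>2) \<and> (\<integral>\<omega>. (W t \<omega> $ k)\<^sup>2 \<partial>M) = t"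
  \<comment> \<open>The Gaussian law is given for increments of positive length only; at time 0 the
    value vanishes almost surely.\<close>
  proof (cases "t = 0")
    case True
    have "AE \<omega> in M. (W t \<omega> $ k)\<^sup>2 = 0" unfolding True using W0 by eventually_elim simp
    then have "integrable M (\<lambda>\<omega>. (W t \<omega> $ k)\<^sup>2) = integrable M (\<lambda>\<omega>. 0 :: real)"
      "(\<integral>\<omega>. (W t \<omega> $ k)\<^sup>2 \<partial>M) = (\<integral>\<omega>. 0 \<partial>M)"
      using meas[OF t] by (intro integrable_cong_AE integral_cong_AE; simp)+
    then show ?thesis using True by simp
  next
    case False
    let ?X = "\<lambda>\<omega>. (W t \<omega> - W 0 \<omega>) $ k" and ?s = "sqrt (t - 0)"
    have tT: "0 \<in> {0..T}" "t \<in> {0<..T}" using t False by auto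
    have D: "distributed M lborel ?X (normal_density 0 ?s)"
      using BM tT unfolding brownian_motion_def by blast
    have s: "0 < ?s" using tT by simp
    have "integrable lborel (\<lambda>x. normal_density 0 ?s x * x\<^sup>2)"
      using integrable_normal_moment[of ?s 0 2] s by simp
    then have int: "integrable M (\<lambda>\<omega>. (?X \<omega>)\<^sup>2)"
      using distributed_integrable[OF D, of "\<lambda>x. x\<^sup>2"] by simp
    have val: "(\<integral>\<omega>. (?X \<omega>)\<^sup>2 \<partial>M) = t"
      using normal_distributed_variance[OF s D] normal_distributed_expectation[OF s D] tT by simp
    have eq: "AE \<omega> in M. (W t \<omega> $ k)\<^sup>2 = (?X \<omega>)\<^sup>2" using W0 by eventually_elim simp
    have "integrable M (\<lambda>\<omega>. (W t \<omega> $ k)\<^sup>2) = integrable M (\<lambda>\<omega>. (?X \<omega>)\<^sup>2)"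
      "(\<integral>\<omega>. (W t \<omega> $ k)\<^sup>2 \<partial>M) = (\<integral>\<omega>. (?X \<omega>)\<^sup>2 \<partial>M)"
      using meas[OF t] int eq by (intro integrable_cong_AE integral_cong_AE; simp)+
    then show ?thesis using int val by simp
  qed
  then show "integrable M (\<lambda>\<omega>. (W t \<omega> $ k)\<^sup>2)" "(\<integral>\<omega>. (W t \<omega> $ k)\<^sup>2 \<partial>M) = t" by auto
qed

text \<open>Young's inequality with weight \<eta> for the cross term 2 b (a - b). After integration,
  closeness in mean square yields closeness of second moments.\<close>

lemma diff_squares_abs_le:
  fixes a b \<eta> :: real
  assumes "\<eta> > 0"
  shows "\<bar>a\<^sup>2 - b\<^sup>2\<bar> \<le> (1 + 1 / \<eta>) * (a - b)\<^sup>2 + \<eta> * b\<^sup>2"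
proof -
  have s: "sqrt \<eta> * sqrt \<eta> = \<eta>" "sqrt \<eta> > 0" using assms by auto
  have "2 * (\<bar>b\<bar> * \<bar>a - b\<bar>) = 2 * (sqrt \<eta> * \<bar>b\<bar>) * (\<bar>a - b\<bar> / sqrt \<eta>)" using s by (simp add: field_simps)
  also have "\<dots> \<le> (sqrt \<eta> * \<bar>b\<bar>)\<^sup>2 + (\<bar>a - b\<bar> / sqrt \<eta>)\<^sup>2" by (rule sum_squares_bound)
  also have "\<dots> = \<eta> * b\<^sup>2 + (a - b)\<^sup>2 / \<eta>" using assms by (simp add: power_mult_distrib power_divide)
  finally have 1: "2 * \<bar>b * (a - b)\<bar> \<le> \<eta> * b\<^sup>2 + (a - b)\<^sup>2 / \<eta>" by (simp add: abs_mult)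
  have "\<bar>a\<^sup>2 - b\<^sup>2\<bar> = \<bar>(a - b)\<^sup>2 + 2 * (b * (a - b))\<bar>" by (simp add: power2_eq_square algebra_simps)
  also have "\<dots> \<le> \<bar>(a - b)\<^sup>2\<bar> + \<bar>2 * (b * (a - b))\<bar>" by (rule abs_triangle_ineq)
  also have "\<dots> = (a - b)\<^sup>2 + 2 * \<bar>b * (a - b)\<bar>" by (simp add: abs_mult)
  also have "\<dots> \<le> (a - b)\<^sup>2 + (\<eta> * b\<^sup>2 + (a - b)\<^sup>2 / \<eta>)" using 1 by simp
  also have "\<dots> = (1 + 1 / \<eta>) * (a - b)\<^sup>2 + \<eta> * b\<^sup>2" by (simp add: algebra_simps)
  finally show ?thesis .
qed

text \<open>The second moment of Brownian motion at t is t, so it is enough to compare second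
  moments. Uniformity in t comes from the supremum inside the expectation in (C3), which dominates
  the squared distance at every single time.\<close>

lemma bracket_convergence:
  fixes W :: "real \<Rightarrow> 'a \<Rightarrow> real^'d::finite"
  assumes T: "T > 0" and prob: "prob_space M" and BM: "brownian_motion M T W"
    and WN: "\<And>N. approximating_process M T (WN N)"
    and C3: "(\<lambda>N. \<integral>\<^sup>+\<omega>. (SUP t\<in>{0..T}. ennreal ((norm (WN N t \<omega> - W t \<omega>))\<^sup>2)) \<partial>M) \<longlonglongrightarrow> 0"
    and \<delta>: "\<delta> > 0"
  shows "eventually (\<lambda>N. \<forall>t\<in>{0..T}. \<forall>k. \<bar>component_bracket M (WN N) k t - t\<bar> \<le> \<delta>) sequentially"
proof -
  interpret prob_space M by fact
  \<comment> \<open>The tolerance \<delta> is split in halves: \<eta> T is one of them, as the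
    second moment of W at t is at most T, and (1 + 1 / \<eta>) e is the other.\<close>
  define \<eta> where "\<eta> = \<delta> / (2 * T)"
  have \<eta>: "\<eta> > 0" using T \<delta> by (simp add: \<eta>_def)
  define e where "e = \<delta> / (2 * (1 + 1 / \<eta>))"
  have pos: "1 + 1 / \<eta> > 0" using \<eta> by (simp add: add_pos_pos)
  then have e: "e > 0" unfolding e_def using \<delta> by (intro divide_pos_pos mult_pos_pos) simp_all
  have "x * (\<delta> / (2 * x)) = \<delta> / 2" if "x > 0" for x using that by simp
  then have e': "(1 + 1 / \<eta>) * e = \<delta> / 2" unfolding e_def using pos by blast
  have "eventually (\<lambda>N. (\<integral>\<^sup>+\<omega>. (SUP t\<in>{0..T}. ennreal ((norm (WN N t \<omega> - W t \<omega>))\<^sup>2)) \<partial>M) < ennreal e) sequentially"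
    using e by (intro order_tendstoD(2)[OF C3]) simp
  then show ?thesis
  proof eventually_elim
    case (elim N)
    show ?case
    proof (intro ballI allI)
      fix t k assume t: "t \<in> {0..T}"
      let ?a = "\<lambda>\<omega>. WN N t \<omega> $ k" and ?b = "\<lambda>\<omega>. W t \<omega> $ k"
      have a2: "integrable M (\<lambda>\<omega>. (?a \<omega>)\<^sup>2)" and ai: "integrable M ?a"
        using WN[of N] t by (auto simp: approximating_process_def square_integrable_martingale_def martingale_def)
      note b2 = brownian_second_moment[OF prob BM t, of k]
      have aM [measurable]: "?a \<in> borel_measurable M" using ai by simp
      have bM [measurable]: "?b \<in> borel_measurable M"
      proof (rule measurable_compose[of "W t" M borel])
        show "W t \<in> borel_measurable M" using BM t by (simp add: brownian_motion_def)
        show "(\<lambda>v. v $ k) \<in> borel_measurable borel" by (intro borel_measurable_continuous_onI continuous_intros)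
      qed
      have d2: "integrable M (\<lambda>\<omega>. (?a \<omega> - ?b \<omega>)\<^sup>2)"
      proof (rule Bochner_Integration.integrable_bound)
        show "integrable M (\<lambda>\<omega>. 2 * ((?a \<omega>)\<^sup>2 + (?b \<omega>)\<^sup>2))" using a2 b2 by simp
        have "(x - y)\<^sup>2 \<le> 2 * (x\<^sup>2 + y\<^sup>2)" for x y :: real
          using zero_le_power2[of "x + y"] by (simp add: power2_eq_square algebra_simps)
        then show "AE \<omega> in M. norm ((?a \<omega> - ?b \<omega>)\<^sup>2) \<le> norm (2 * ((?a \<omega>)\<^sup>2 + (?b \<omega>)\<^sup>2))" by simp
      qed measurable
      have "ennreal (\<integral>\<omega>. (?a \<omega> - ?b \<omega>)\<^sup>2 \<partial>M) = (\<integral>\<^sup>+\<omega>. ennreal ((?a \<omega> - ?b \<omega>)\<^sup>2) \<partial>M)"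
        using d2 by (intro nn_integral_eq_integral[symmetric]) auto
      also have "\<dots> \<le> (\<integral>\<^sup>+\<omega>. (SUP t\<in>{0..T}. ennreal ((norm (WN N t \<omega> - W t \<omega>))\<^sup>2)) \<partial>M)"
      proof (rule nn_integral_mono)
        fix \<omega>
        have "\<bar>?a \<omega> - ?b \<omega>\<bar> \<le> norm (WN N t \<omega> - W t \<omega>)"
          using component_le_norm_cart[of "WN N t \<omega> - W t \<omega>" k] by simp
        then have "(?a \<omega> - ?b \<omega>)\<^sup>2 \<le> (norm (WN N t \<omega> - W t \<omega>))\<^sup>2"
          by (metis abs_ge_zero power2_abs power_mono)
        then have "ennreal ((?a \<omega> - ?b \<omega>)\<^sup>2) \<le> ennreal ((norm (WN N t \<omega> - W t \<omega>))\<^sup>2)"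
          by (rule ennreal_leI)
        also have "\<dots> \<le> (SUP t\<in>{0..T}. ennreal ((norm (WN N t \<omega> - W t \<omega>))\<^sup>2))"
          using t by (rule SUP_upper)
        finally show "ennreal ((?a \<omega> - ?b \<omega>)\<^sup>2) \<le> (SUP t\<in>{0..T}. ennreal ((norm (WN N t \<omega> - W t \<omega>))\<^sup>2))" .
      qed
      also note elim
      finally have d_e: "(\<integral>\<omega>. (?a \<omega> - ?b \<omega>)\<^sup>2 \<partial>M) \<le> e"
        using e by (simp add: ennreal_less_iff)
      have "\<bar>component_bracket M (WN N) k t - t\<bar> = \<bar>\<integral>\<omega>. (?a \<omega>)\<^sup>2 - (?b \<omega>)\<^sup>2 \<partial>M\<bar>"
        unfolding component_bracket_def using a2 b2 by simp
      also have "\<dots> \<le> (\<integral>\<omega>. \<bar>(?a \<omega>)\<^sup>2 - (?b \<omega>)\<^sup>2\<bar> \<partial>M)" by (rule integral_abs_bound)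
      also have "\<dots> \<le> (\<integral>\<omega>. (1 + 1 / \<eta>) * (?a \<omega> - ?b \<omega>)\<^sup>2 + \<eta> * (?b \<omega>)\<^sup>2 \<partial>M)"
        using a2 b2 d2 \<eta> by (intro integral_mono diff_squares_abs_le) auto
      also have "\<dots> = (1 + 1 / \<eta>) * (\<integral>\<omega>. (?a \<omega> - ?b \<omega>)\<^sup>2 \<partial>M) + \<eta> * t"
        using b2 d2 by simp
      also have "\<dots> \<le> (1 + 1 / \<eta>) * e + \<eta> * T"
        using d_e t \<eta> by (intro add_mono mult_left_mono) auto
      also have "\<dots> = \<delta>" using e' T by (simp add: \<eta>_def)
      finally show "\<bar>component_bracket M (WN N) k t - t\<bar> \<le> \<delta>" .
    qed
  qed
qed

text \<open>Count powers of h, with \<open>d * c / sqrt h\<close> of order h^(-1/2). The premise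
  means h^(1 - q/2) <= \<epsilon>^2, which controls h and the condition in y. The growth condition
  is left with \<epsilon> h^((2 - q)/4), harmless because q < 2. In the condition in z the powers
  cancel in the leading term, leaving \<epsilon>.\<close>

lemma small_constants:
  fixes K L q c d :: real
  assumes K: "0 \<le> K" and L: "0 \<le> L" and q: "1 \<le> q" "q < 2" and c: "0 < c" and d: "0 < d"
  shows "\<exists>\<epsilon>0>0. \<forall>\<epsilon> h. 0 < \<epsilon> \<longrightarrow> \<epsilon> \<le> \<epsilon>0 \<longrightarrow> 0 < h \<longrightarrow> h \<le> (\<epsilon> * h powr (q / 4))\<^sup>2 \<longrightarrow>
    h \<le> \<epsilon> \<and> K * h \<le> 1 / 2 \<and>
    K * (d * c / sqrt h) powr (q - 1) * (d * (\<epsilon> * h powr (q / 4))) \<le> 1 \<and>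
    L * (1 + (d * c / sqrt h) powr q) * h \<le> 1 / 2 \<and>
    L * (1 + (d * c / sqrt h) powr (q / 2)) * (d * (\<epsilon> * h powr (q / 4))) \<le> 1"
proof -
  \<comment> \<open>Q dominates every coefficient of \<epsilon> that occurs, so \<epsilon> <= 1 / (2
    Q) brings each product below 1/2.\<close>
  define Q where "Q = 1 + K + K * (d * c) powr (q - 1) * d + L * (1 + (d * c) powr q) + L * d * (1 + (d * c) powr (q / 2))"
  have terms: "0 \<le> K * (d * c) powr (q - 1) * d" "0 \<le> L * (1 + (d * c) powr q)" "0 \<le> L * d * (1 + (d * c) powr (q / 2))"
    using K L d by auto
  have Q: "1 \<le> Q" "K \<le> Q" "K * (d * c) powr (q - 1) * d \<le> Q" "L * (1 + (d * c) powr q) \<le> Q"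
    "L * d * (1 + (d * c) powr (q / 2)) \<le> Q"
    using terms K unfolding Q_def by linarith+
  show ?thesis
  proof (intro exI[of _ "1 / (2 * Q)"] conjI allI impI)
    show "0 < 1 / (2 * Q)" using Q by simp
    fix \<epsilon> h :: real assume \<epsilon>: "0 < \<epsilon>" "\<epsilon> \<le> 1 / (2 * Q)" and h: "0 < h" "h \<le> (\<epsilon> * h powr (q / 4))\<^sup>2"
    have Qe: "Q * \<epsilon> \<le> 1 / 2"
      using \<epsilon>(2) Q(1) by (simp add: field_simps)
    have le: "x * \<epsilon> \<le> 1 / 2" if "x \<le> Q" for x
      using mult_right_mono[OF that, of \<epsilon>] \<epsilon>(1) Qe by linarith
    have e1: "\<epsilon> \<le> 1" using le[OF Q(1)] by simp
    have "(\<epsilon> * h powr (q / 4))\<^sup>2 = \<epsilon>\<^sup>2 * h powr (q / 2)"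
      using h(1) by (simp add: power_mult_distrib power2_eq_square flip: powr_add)
    then have "h * h powr (- (q / 2)) \<le> \<epsilon>\<^sup>2 * h powr (q / 2) * h powr (- (q / 2))"
      using h by (intro mult_right_mono) auto
    then have hr: "h powr (1 - q / 2) \<le> \<epsilon>\<^sup>2"
      using h(1) powr_mult_base[of h "- (q / 2)"] by (simp add: mult.assoc flip: powr_add)
    have ee: "\<epsilon>\<^sup>2 \<le> \<epsilon>" using \<epsilon>(1) e1 by (simp add: power2_eq_square mult_left_le)
    \<comment> \<open>As 1 - q/2 is positive, h > 1 would contradict h^(1 - q/2) <= \<epsilon>^2 <=
      1. From here on, larger exponents mean smaller powers.\<close>
    have h1: "h \<le> 1"
    proof (rule ccontr)
      assume "\<not> h \<le> 1"
      then have "1 < h powr (1 - q / 2)" using q by (intro gr_one_powr) auto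
      then show False using hr ee e1 by linarith
    qed
    have pow1: "h powr s \<le> 1" if "0 \<le> s" for s using h h1 that by (simp add: powr_le1)
    have "h = h powr 1" using h by simp
    also have "\<dots> \<le> h powr (1 - q / 2)" using h h1 q by (intro powr_mono') auto
    finally have hh: "h \<le> h powr (1 - q / 2)" .
    then show he: "h \<le> \<epsilon>" using hr ee by linarith
    show "K * h \<le> 1 / 2" using mult_left_mono[OF he K] le[OF Q(2)] by linarith
    have \<rho>: "(d * c / sqrt h) powr s = (d * c) powr s * h powr (- s / 2)" for s
    proof -
      have "(d * c / sqrt h) powr s = (d * c) powr s / (h powr (1 / 2)) powr s"
        using h d c by (simp add: powr_divide powr_half_sqrt)
      also have "\<dots> = (d * c) powr s * h powr (- s / 2)"
        by (simp add: powr_powr powr_minus_divide)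
      finally show ?thesis .
    qed
    have "K * (d * c / sqrt h) powr (q - 1) * (d * (\<epsilon> * h powr (q / 4)))
        = (K * (d * c) powr (q - 1) * d * \<epsilon>) * (h powr (- (q - 1) / 2) * h powr (q / 4))"
      by (simp add: \<rho>)
    also have "h powr (- (q - 1) / 2) * h powr (q / 4) = h powr ((2 - q) / 4)"
      by (simp add: field_simps flip: powr_add)
    also have "(K * (d * c) powr (q - 1) * d * \<epsilon>) * h powr ((2 - q) / 4) \<le> (K * (d * c) powr (q - 1) * d * \<epsilon>) * 1"
      using pow1[of "(2 - q) / 4"] q terms(1) \<epsilon>(1) by (intro mult_left_mono) auto
    also have "\<dots> \<le> 1" using le[OF Q(3)] by simp
    finally show "K * (d * c / sqrt h) powr (q - 1) * (d * (\<epsilon> * h powr (q / 4))) \<le> 1" .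
    have "L * (1 + (d * c / sqrt h) powr q) * h = L * (h + (d * c) powr q * (h * h powr (- q / 2)))"
      unfolding \<rho> by (simp add: algebra_simps)
    also have "h * h powr (- q / 2) = h powr (1 - q / 2)"
      using h(1) powr_mult_base[of h "- q / 2"] by simp
    also have "L * (h + (d * c) powr q * h powr (1 - q / 2)) \<le> L * (h powr (1 - q / 2) + (d * c) powr q * h powr (1 - q / 2))"
      using hh L by (intro mult_left_mono) auto
    also have "\<dots> = L * (1 + (d * c) powr q) * h powr (1 - q / 2)" by (simp add: algebra_simps)
    also have "\<dots> \<le> L * (1 + (d * c) powr q) * \<epsilon>"
      using hr ee terms(2) by (intro mult_left_mono) auto
    also have "\<dots> \<le> 1 / 2" by (rule le[OF Q(4)])
    finally show "L * (1 + (d * c / sqrt h) powr q) * h \<le> 1 / 2" .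
    have "L * (1 + (d * c / sqrt h) powr (q / 2)) * (d * (\<epsilon> * h powr (q / 4)))
        = L * d * \<epsilon> * (h powr (q / 4) + (d * c) powr (q / 2) * (h powr (- q / 4) * h powr (q / 4)))"
      unfolding \<rho> by (simp add: algebra_simps)
    also have "h powr (- q / 4) * h powr (q / 4) = 1" using h(1) by (simp flip: powr_add)
    also have "L * d * \<epsilon> * (h powr (q / 4) + (d * c) powr (q / 2) * 1) \<le> L * d * \<epsilon> * (1 + (d * c) powr (q / 2) * 1)"
      using pow1[of "q / 4"] q L d \<epsilon>(1) by (intro mult_left_mono) auto
    also have "\<dots> = L * d * (1 + (d * c) powr (q / 2)) * \<epsilon>" by simp
    also have "\<dots> \<le> 1" using le[OF Q(5)] by simp
    finally show "L * (1 + (d * c / sqrt h) powr (q / 2)) * (d * (\<epsilon> * h powr (q / 4))) \<le> 1" .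
  qed
qed

text \<open>Measures the room left by the summand 1. With A = (C + 1) exp(K T), an error x in the
  exponent of the bound raises it by at most A (exp x - 1), and \<open>ln (1 + 1 / A)\<close> is the
  value at which this reaches 1.\<close>

lemma exp_slack:
  fixes A :: real
  assumes "A > 0"
  shows "\<exists>\<gamma>>0. \<forall>x. x \<le> \<gamma> \<longrightarrow> A * (exp x - 1) \<le> 1"
proof (intro exI[of _ "ln (1 + 1 / A)"] conjI allI impI)
  show "0 < ln (1 + 1 / A)" using assms by (intro ln_gt_zero) simp
  fix x assume "x \<le> ln (1 + 1 / A)"
  then have "exp x \<le> exp (ln (1 + 1 / A))" by simp
  then have "exp x - 1 \<le> 1 / A" using assms by (simp add: add_pos_pos)
  then show "A * (exp x - 1) \<le> 1" using assms by (simp add: field_simps)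
qed

text \<open>Comes from ln (1 - x) >= - x - 2 x^2. Applied to x = K h, the quadratic term is the
  origin of the factor 1 + 2 K \<epsilon> in the exponent of a.\<close>

lemma exp_neg_le_one_minus:
  fixes x y :: real
  assumes "0 \<le> x" "x \<le> 1 / 2" "x + 2 * x\<^sup>2 \<le> y"
  shows "exp (- y) \<le> 1 - x"
proof -
  have "- y \<le> ln (1 - x)" using ln_one_minus_pos_lower_bound[OF assms(1,2)] assms(3) by linarith
  then have "exp (- y) \<le> exp (ln (1 - x))" by simp
  then show ?thesis using assms by simp
qed

section \<open>Driver conditions with a common null set, and bounds at all times\<close>

context small_grid
begin

text \<open>All arguments of each inequality are collected in one point of a product space,
  restricted to bounded y for the Lipschitz conditions, and \<open>AE_forall_le_continuous\<close>
  is applied there.\<close>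

lemma good_driverI:
  assumes driver: "is_driver M T n \<tau> \<F> f"
    and growth: "\<And>t y z. t \<in> {0..T} \<Longrightarrow> AE \<omega> in M. \<bar>f t \<omega> y z\<bar> \<le> K * (1 + \<bar>y\<bar> + norm z powr q)"
    and Lip_y: "\<And>t y1 y2 z. t \<in> {0..T} \<Longrightarrow> \<bar>y1\<bar> \<le> c \<Longrightarrow> \<bar>y2\<bar> \<le> c \<Longrightarrow>
      AE \<omega> in M. \<bar>f t \<omega> y1 z - f t \<omega> y2 z\<bar> \<le> L * (1 + norm z powr q) * \<bar>y1 - y2\<bar>"
    and Lip_z: "\<And>t y z1 z2. t \<in> {0..T} \<Longrightarrow> \<bar>y\<bar> \<le> c \<Longrightarrow>
      AE \<omega> in M. \<bar>f t \<omega> y z1 - f t \<omega> y z2\<bar> \<le> L * (1 + max (norm z1) (norm z2) powr (q / 2)) * norm (z1 - z2)"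
  shows "good_driver f"
  unfolding good_driver_def
proof (intro allI impI)
  fix i assume i: "i < n"
  interpret S: small_step M "F i" "D i" "h i" "\<beta> i" K L q c "\<rho> i" using i by (rule small_step)
  let ?t = "\<tau> (Suc i)"
  have t: "?t \<in> {0..T}" using i by (intro \<tau>_in) simp
  have cont: "continuous_on UNIV (\<lambda>(y, z). f ?t \<omega> y z)" if "\<omega> \<in> space M" for \<omega>
    using driver t that unfolding is_driver_def by blast
  have cont': "continuous_on A (\<lambda>p. f ?t \<omega> (u p) (v p))"
    if "\<omega> \<in> space M" "continuous_on A u" "continuous_on A v" for \<omega> u v and A :: "'x::topological_space set"
    using continuous_on_compose2[OF cont[OF that(1)] continuous_on_Pair[OF that(2,3)]] by simp
  \<comment> \<open>The base is a norm and may vanish, so continuity of the power depends on the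
    exponent being positive.\<close>
  note powr_cont = continuous_on_powr'[OF _ continuous_on_const]
  have "AE \<omega> in M. \<forall>p\<in>UNIV. \<bar>f ?t \<omega> (fst p) (snd p)\<bar> \<le> K * (1 + \<bar>fst p\<bar> + norm (snd p) powr q)"
    by (rule AE_forall_le_continuous)
      (use growth[OF t] q in \<open>auto intro!: continuous_intros cont' powr_cont\<close>)
  then have 1: "AE \<omega> in M. \<forall>y z. \<bar>f ?t \<omega> y z\<bar> \<le> K * (1 + \<bar>y\<bar> + norm z powr q)"
    by eventually_elim auto
  have "AE \<omega> in M. \<forall>p\<in>{p. \<bar>fst p\<bar> \<le> c \<and> \<bar>fst (snd p)\<bar> \<le> c}.
      \<bar>f ?t \<omega> (fst p) (snd (snd p)) - f ?t \<omega> (fst (snd p)) (snd (snd p))\<bar>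
        \<le> L * (1 + norm (snd (snd p)) powr q) * \<bar>fst p - fst (snd p)\<bar>"
    by (rule AE_forall_le_continuous)
      (use Lip_y[OF t] q in \<open>auto intro!: continuous_intros cont' powr_cont\<close>)
  then have 2: "AE \<omega> in M. \<forall>y1 y2 z. \<bar>y1\<bar> \<le> c \<longrightarrow> \<bar>y2\<bar> \<le> c \<longrightarrow>
      \<bar>f ?t \<omega> y1 z - f ?t \<omega> y2 z\<bar> \<le> L * (1 + norm z powr q) * \<bar>y1 - y2\<bar>"
    by eventually_elim auto
  have "AE \<omega> in M. \<forall>p\<in>{p. \<bar>fst p\<bar> \<le> c}.
      \<bar>f ?t \<omega> (fst p) (fst (snd p)) - f ?t \<omega> (fst p) (snd (snd p))\<bar>
        \<le> L * (1 + max (norm (fst (snd p))) (norm (snd (snd p))) powr (q / 2)) * norm (fst (snd p) - snd (snd p))"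
    by (rule AE_forall_le_continuous)
      (use Lip_z[OF t] q in \<open>auto intro!: continuous_intros cont' powr_cont simp: le_max_iff_disj\<close>)
  then have 3: "AE \<omega> in M. \<forall>y z1 z2. \<bar>y\<bar> \<le> c \<longrightarrow>
      \<bar>f ?t \<omega> y z1 - f ?t \<omega> y z2\<bar> \<le> L * (1 + max (norm z1) (norm z2) powr (q / 2)) * norm (z1 - z2)"
    by eventually_elim auto
  show "S.slice (f ?t)"
    unfolding S.slice_def
  proof (intro conjI ballI allI 1 2 3)
    show "continuous_on UNIV (\<lambda>(y, z). f ?t \<omega> y z)" if "\<omega> \<in> space M" for \<omega> using cont[OF that] .
    show "(\<lambda>\<omega>. f ?t \<omega> y z) \<in> borel_measurable (F i)" for y z
      using driver i unfolding is_driver_def by blast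
  qed
qed

lemma driver_order_uniform:
  assumes driver: "is_driver M T n \<tau> \<F> f1" "is_driver M T n \<tau> \<F> f2"
    and le: "\<And>t y z. t \<in> {0..T} \<Longrightarrow> AE \<omega> in M. f2 t \<omega> y z \<le> f1 t \<omega> y z"
    and t: "t \<in> {0..T}"
  shows "AE \<omega> in M. \<forall>y z. f2 t \<omega> y z \<le> f1 t \<omega> y z"
proof -
  have "AE \<omega> in M. \<forall>p\<in>UNIV. (\<lambda>(y, z). f2 t \<omega> y z) p \<le> (\<lambda>(y, z). f1 t \<omega> y z) p"
  proof (rule AE_forall_le_continuous)
    show "continuous_on UNIV (\<lambda>(y, z). f2 t \<omega> y z)" "continuous_on UNIV (\<lambda>(y, z). f1 t \<omega> y z)"
      if "\<omega> \<in> space M" for \<omega>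
      using driver t that unfolding is_driver_def by blast+
    show "AE \<omega> in M. (\<lambda>(y, z). f2 t \<omega> y z) p \<le> (\<lambda>(y, z). f1 t \<omega> y z) p" for p
      using le[OF t] by (cases p) simp
  qed
  then show ?thesis by eventually_elim auto
qed

lemma solution_bounds_all_times:
  assumes sol1: "is_solution M T n \<tau> X f1 \<xi>1 Y1 Z1 U1" and sol2: "is_solution M T n \<tau> X f2 \<xi>2 Y2 Z2 U2"
    and f1: "good_driver f1" and f2: "good_driver f2"
    and \<xi>1: "AE \<omega> in M. \<bar>\<xi>1 \<omega>\<bar> \<le> a n" and \<xi>2: "AE \<omega> in M. \<bar>\<xi>2 \<omega>\<bar> \<le> a n"
    and f12: "\<And>i. i < n \<Longrightarrow> AE \<omega> in M. \<forall>y z. f2 (\<tau> (Suc i)) \<omega> y z \<le> f1 (\<tau> (Suc i)) \<omega> y z"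
    and \<xi>12: "AE \<omega> in M. \<xi>2 \<omega> \<le> \<xi>1 \<omega>"
    and B: "\<And>t. t \<in> {0..T} \<Longrightarrow> a (idx t) \<le> B t"
  shows "AE \<omega> in M. \<forall>t\<in>{0..T}. B t \<ge> Y1 t \<omega> \<and> Y1 t \<omega> \<ge> Y2 t \<omega> \<and> Y2 t \<omega> \<ge> - B t"
proof -
  have "AE \<omega> in M. \<forall>i\<in>{..n}. \<bar>Y1 (\<tau> i) \<omega>\<bar> \<le> a i" "AE \<omega> in M. \<forall>i\<in>{..n}. \<bar>Y2 (\<tau> i) \<omega>\<bar> \<le> a i"
    "AE \<omega> in M. \<forall>i\<in>{..n}. Y2 (\<tau> i) \<omega> \<le> Y1 (\<tau> i) \<omega>"
    using solution_bound[OF sol1 f1 \<xi>1] solution_bound[OF sol2 f2 \<xi>2]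
      solution_comparison[OF sol1 sol2 f1 f2 \<xi>1 \<xi>2 f12 \<xi>12] by (simp_all add: AE_ball_countable)
  then show ?thesis
    using AE_space
  proof eventually_elim
    case (elim \<omega>)
    show ?case
    proof
      fix t assume t: "t \<in> {0..T}"
      have i: "idx t \<in> {..n}" using idx_le[OF t] by simp
      have "\<bar>Y1 t \<omega>\<bar> \<le> a (idx t)" "\<bar>Y2 t \<omega>\<bar> \<le> a (idx t)" "Y2 t \<omega> \<le> Y1 t \<omega>"
        using elim(1-3) i constant_right_openD[OF sol_Y_const[OF sol1] t elim(4)]
          constant_right_openD[OF sol_Y_const[OF sol2] t elim(4)] by auto
      then show "B t \<ge> Y1 t \<omega> \<and> Y1 t \<omega> \<ge> Y2 t \<omega> \<and> Y2 t \<omega> \<ge> - B t" using B[OF t] by linarith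
    qed
  qed
qed

end

section \<open>The deterministic sequence bounding all solutions\<close>

context grid_martingale
begin

text \<open>From one index to the next a + 1 is multiplied by exp(- K (1 + 2 K \<epsilon>) h), which
  is at most 1 - K h because h <= \<epsilon>; this is the recursion for a. Subtracting 1 makes the
  final value C and leaves room 1 below the claimed bound at every time, to be used up by the errors
  of mesh and bracket.\<close>

lemma small_gridI:
  fixes C K L q \<epsilon> c :: real and \<beta> \<rho> a :: "nat \<Rightarrow> real"
  defines "c \<equiv> (C + 1) * exp (K * T)"
    and "\<beta> \<equiv> \<lambda>i. \<epsilon> * h i powr (q / 4)"
    and "\<rho> \<equiv> \<lambda>i. CARD('d) * c / sqrt (h i)"
    and "a \<equiv> \<lambda>i. (1 + C) * exp (K * (1 + 2 * K * \<epsilon>) * (bracket M X T - bracket M X (\<tau> i))) - 1"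
  assumes CKL: "0 \<le> C" "0 \<le> K" "0 \<le> L" and q: "1 \<le> q" and \<epsilon>: "0 < \<epsilon>"
    and const: "\<forall>x>0. x \<le> (\<epsilon> * x powr (q / 4))\<^sup>2 \<longrightarrow>
      x \<le> \<epsilon> \<and> K * x \<le> 1 / 2 \<and>
      K * (CARD('d) * c / sqrt x) powr (q - 1) * (CARD('d) * (\<epsilon> * x powr (q / 4))) \<le> 1 \<and>
      L * (1 + (CARD('d) * c / sqrt x) powr q) * x \<le> 1 / 2 \<and>
      L * (1 + (CARD('d) * c / sqrt x) powr (q / 2)) * (CARD('d) * (\<epsilon> * x powr (q / 4))) \<le> 1"
    and D: "\<forall>i<n. AE \<omega> in M. \<forall>k. \<bar>D i \<omega> $ k\<bar> \<le> \<beta> i"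
    and mesh: "\<forall>i<n. \<tau> (Suc i) - \<tau> i \<le> \<epsilon>"
    and br: "\<forall>i\<le>n. \<bar>bracket M X (\<tau> i) - \<tau> i\<bar> \<le> \<epsilon>"
    and slack: "(C + 1) * exp (K * T) * (exp (3 * K * \<epsilon> + 2 * K\<^sup>2 * \<epsilon> * (T + 2 * \<epsilon>)) - 1) \<le> 1"
  shows "small_grid M T n \<tau> X K L q c \<beta> \<rho> a"
    and "a n = C"
    and "\<And>t. t \<in> {0..T} \<Longrightarrow> a (idx t) \<le> (C + 1) * exp (K * (T - t))"
proof -
  have h_small: "h i \<le> (\<epsilon> * h i powr (q / 4))\<^sup>2" if i: "i < n" for i
  proof -
    interpret S: one_step M "F i" "D i" "h i" "\<beta> i" using i D[rule_format, OF i] by (rule one_step)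
    show ?thesis using S.h_le unfolding \<beta>_def .
  qed
  note const' = const[rule_format, OF h_pos h_small]
  have bound: "a i \<le> (C + 1) * exp (K * (T - t))"
    if i: "i \<le> n" and t: "t \<in> {0..T}" "T - \<tau> i \<le> T - t + \<epsilon>" for i t
  proof -
    \<comment> \<open>In ?\<gamma> the term 3 K \<epsilon> pays once for the mesh and twice for the
      bracket error, at T and at \<open>\<tau> i\<close>; the other term is the correction 2 K
      \<epsilon> over a bracket of length at most T + 2 \<epsilon>.\<close>
    let ?d = "bracket M X T - bracket M X (\<tau> i)" and ?\<gamma> = "3 * K * \<epsilon> + 2 * K\<^sup>2 * \<epsilon> * (T + 2 * \<epsilon>)"
    have d: "?d \<le> T - \<tau> i + 2 * \<epsilon>"
      using br[rule_format, OF i] br[rule_format, of n] unfolding \<tau>_n by (simp add: abs_le_iff)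
    have 1: "K * ?d \<le> K * (T - t + 3 * \<epsilon>)"
      using d t CKL(2) by (intro mult_left_mono) auto
    have 2: "2 * K\<^sup>2 * \<epsilon> * ?d \<le> 2 * K\<^sup>2 * \<epsilon> * (T + 2 * \<epsilon>)"
      using d \<tau>_in[OF i] \<epsilon> by (intro mult_left_mono) auto
    have "K * (1 + 2 * K * \<epsilon>) * ?d = K * ?d + 2 * K\<^sup>2 * \<epsilon> * ?d"
      by (simp add: power2_eq_square algebra_simps)
    also have "\<dots> \<le> K * (T - t + 3 * \<epsilon>) + 2 * K\<^sup>2 * \<epsilon> * (T + 2 * \<epsilon>)"
      using 1 2 by (rule add_mono)
    also have "\<dots> = K * (T - t) + ?\<gamma>" by (simp add: algebra_simps)
    finally have "exp (K * (1 + 2 * K * \<epsilon>) * ?d) \<le> exp (K * (T - t)) * exp ?\<gamma>"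
      unfolding exp_add[symmetric] by simp
    then have "a i + 1 \<le> (C + 1) * (exp (K * (T - t)) * exp ?\<gamma>)"
      unfolding a_def using CKL(1) by (simp add: add.commute mult_left_mono)
    also have "\<dots> = (C + 1) * exp (K * (T - t)) + (C + 1) * exp (K * (T - t)) * (exp ?\<gamma> - 1)"
      by (simp add: algebra_simps)
    also have "(C + 1) * exp (K * (T - t)) * (exp ?\<gamma> - 1) \<le> (C + 1) * exp (K * T) * (exp ?\<gamma> - 1)"
    proof (intro mult_right_mono mult_left_mono)
      show "exp (K * (T - t)) \<le> exp (K * T)" using t CKL(2) by (simp add: mult_left_mono)
      have "0 \<le> ?\<gamma>" using CKL \<epsilon> T_pos by simp
      then show "0 \<le> exp ?\<gamma> - 1" by simp
    qed (use CKL in simp)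
    also note slack
    finally show ?thesis by simp
  qed
  show "a (idx t) \<le> (C + 1) * exp (K * (T - t))" if t: "t \<in> {0..T}" for t
  proof (rule bound[OF idx_le[OF t] t])
    show "T - \<tau> (idx t) \<le> T - t + \<epsilon>"
    proof (cases "idx t = n")
      case True
      then show ?thesis using idx_eq_n[OF t] \<tau>_n \<epsilon> by simp
    next
      case False
      then have "idx t < n" using idx_le[OF t] by simp
      then show ?thesis using mesh[rule_format, of "idx t"] less_\<tau>_idx[OF t] by simp
    qed
  qed
  show "a n = C" unfolding a_def \<tau>_n by simp
  show "small_grid M T n \<tau> X K L q c \<beta> \<rho> a"
  proof unfold_locales
    show "0 < c" unfolding c_def using CKL by simp
    fix i assume i: "i < n"
    show "real CARD('d) * c / sqrt (h i) \<le> \<rho> i" unfolding \<rho>_def by simp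
    show "K * h i \<le> 1 / 2" "K * \<rho> i powr (q - 1) * (CARD('d) * \<beta> i) \<le> 1"
      "L * (1 + \<rho> i powr q) * h i \<le> 1 / 2" "L * (1 + \<rho> i powr (q / 2)) * (CARD('d) * \<beta> i) \<le> 1"
      using const'[OF i i] unfolding \<rho>_def \<beta>_def by blast+
    have "exp (- (K * (1 + 2 * K * \<epsilon>) * h i)) \<le> 1 - K * h i"
    proof (rule exp_neg_le_one_minus)
      show "0 \<le> K * h i" using CKL h_pos[OF i] by simp
      have "2 * K\<^sup>2 * h i * h i \<le> 2 * K\<^sup>2 * h i * \<epsilon>"
        using const'[OF i i] h_pos[OF i] by (intro mult_left_mono) auto
      then show "K * h i + 2 * (K * h i)\<^sup>2 \<le> K * (1 + 2 * K * \<epsilon>) * h i"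
        by (simp add: power2_eq_square algebra_simps)
    qed (use const'[OF i i] in simp)
    then have "(a i + 1) * exp (- (K * (1 + 2 * K * \<epsilon>) * h i)) \<le> (a i + 1) * (1 - K * h i)"
      unfolding a_def using CKL by (intro mult_left_mono) auto
    moreover have "(a i + 1) * exp (- (K * (1 + 2 * K * \<epsilon>) * h i)) = a (Suc i) + 1"
      unfolding a_def h_def increment_def by (simp add: mult.assoc algebra_simps flip: exp_add)
    ultimately show "a (Suc i) + K * h i \<le> a i * (1 - K * h i)" by (simp add: algebra_simps)
  next
    fix i assume i: "i \<le> n"
    have "a i \<le> (C + 1) * exp (K * (T - \<tau> i))" using i \<tau>_in[OF i] \<epsilon> by (intro bound) auto
    also have "\<dots> \<le> c"
      unfolding c_def using CKL \<tau>_in[OF i] by (simp add: mult_left_mono)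
    finally show "a i \<le> c" .
  qed (use D CKL q in auto)
qed

end

lemma Linf_norm_quotient_less:
  assumes "Linf_norm M Y / ereal p < ereal \<epsilon>" and p: "0 < p"
  shows "AE \<omega> in M. \<bar>Y \<omega>\<bar> \<le> \<epsilon> * p"
proof -
  have le: "Linf_norm M Y \<le> ereal (\<epsilon> * p)"
    using assms by (cases "Linf_norm M Y") (auto simp: divide_less_eq)
  have "AE \<omega> in M. ereal \<bar>Y \<omega>\<bar> \<le> Linf_norm M Y"
    unfolding Linf_norm_def by (rule esssup_AE)
  then show ?thesis
  proof eventually_elim
    case (elim \<omega>)
    then have "ereal \<bar>Y \<omega>\<bar> \<le> ereal (\<epsilon> * p)" using le by (rule order_trans)
    then show ?case by simp
  qed
qed

section \<open>Comparison and existence for fine grids\<close>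

theorem theorem4p2:
  fixes M :: "'a measure" and T :: real
    and W :: "real \<Rightarrow> 'a \<Rightarrow> real^'d::finite"
    and WN :: "nat \<Rightarrow> real \<Rightarrow> 'a \<Rightarrow> real^'d"
    and n :: "nat \<Rightarrow> nat" and \<tau> :: "nat \<Rightarrow> nat \<Rightarrow> real"
    and C K L q :: real
  assumes T: "T > 0"
    and prob: "prob_space M"
    and BM: "brownian_motion M T W"
    and WN: "\<And>N. approximating_process M T (WN N)"
    and orth: "\<And>N. orthogonal_components M T (WN N)"
    and C1_grid: "\<And>N. is_grid T (n N) (\<tau> N)"
    and C1_mesh: "(\<lambda>N. mesh (n N) (\<tau> N)) \<longlonglongrightarrow> 0"
    and C1_const: "\<And>N. constant_right_open M (n N) (\<tau> N) (WN N)"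
    and C2: "\<And>N. equal_positive_brackets M (n N) (\<tau> N) (WN N)"
    and C3: "(\<lambda>N. \<integral>\<^sup>+\<omega>. (SUP t\<in>{0..T}. ennreal ((norm (WN N t \<omega> - W t \<omega>))\<^sup>2)) \<partial>M) \<longlonglongrightarrow> 0"
    and CKL: "C \<ge> 0" "K \<ge> 0" "L \<ge> 0"
    and q: "1 \<le> q" "q < 2"
    and W1: "(\<lambda>N. Max ((\<lambda>(i, k).
                Linf_norm M (\<lambda>\<omega>. increment (\<tau> N) (\<lambda>t. WN N t \<omega> $ k) i)
                  / ereal (increment (\<tau> N) (bracket M (WN N)) i powr (q / 4)))
                ` ({1..n N} \<times> UNIV))) \<longlonglongrightarrow> 0"
  shows "\<exists>N0. \<forall>N\<ge>N0.
    \<forall>(f :: nat \<Rightarrow> real \<Rightarrow> 'a \<Rightarrow> real \<Rightarrow> real^'d \<Rightarrow> real) (\<xi> :: nat \<Rightarrow> 'a \<Rightarrow> real).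
      (\<forall>m\<in>{1, 2}.
         is_driver M T (n N) (\<tau> N) (natural_filtration M (WN N)) (f m) \<and>
         \<xi> m \<in> borel_measurable (natural_filtration M (WN N) T) \<and>
         Linf_norm M (\<xi> m) \<le> ereal C \<and>
         (\<forall>t\<in>{0..T}. \<forall>y z. AE \<omega> in M.
            \<bar>f m t \<omega> y z\<bar> \<le> K * (1 + \<bar>y\<bar> + norm z powr q)) \<and>
         (\<forall>t\<in>{0..T}. \<forall>y1 y2 z.
            \<bar>y1\<bar> \<le> (C + 1) * exp (K * T) \<longrightarrow> \<bar>y2\<bar> \<le> (C + 1) * exp (K * T) \<longrightarrow>
            (AE \<omega> in M. \<bar>f m t \<omega> y1 z - f m t \<omega> y2 z\<bar> \<le> L * (1 + norm z powr q) * \<bar>y1 - y2\<bar>)) \<and>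
         (\<forall>t\<in>{0..T}. \<forall>y z1 z2.
            \<bar>y\<bar> \<le> (C + 1) * exp (K * T) \<longrightarrow>
            (AE \<omega> in M. \<bar>f m t \<omega> y z1 - f m t \<omega> y z2\<bar>
               \<le> L * (1 + max (norm z1) (norm z2) powr (q / 2)) * norm (z1 - z2)))) \<longrightarrow>
      (\<forall>t\<in>{0..T}. \<forall>y z. AE \<omega> in M. f 1 t \<omega> y z \<ge> f 2 t \<omega> y z) \<longrightarrow>
      (AE \<omega> in M. \<xi> 1 \<omega> \<ge> \<xi> 2 \<omega>) \<longrightarrow>
      (\<forall>m\<in>{1, 2}. has_unique_solution M T (n N) (\<tau> N) (WN N) (f m) (\<xi> m)) \<and>
      (\<forall>Y1 Z1 U1 Y2 Z2 U2.
         is_solution M T (n N) (\<tau> N) (WN N) (f 1) (\<xi> 1) Y1 Z1 U1 \<longrightarrow>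
         is_solution M T (n N) (\<tau> N) (WN N) (f 2) (\<xi> 2) Y2 Z2 U2 \<longrightarrow>
         (AE \<omega> in M. \<forall>t\<in>{0..T}.
            (C + 1) * exp (K * (T - t)) \<ge> Y1 t \<omega> \<and> Y1 t \<omega> \<ge> Y2 t \<omega> \<and>
            Y2 t \<omega> \<ge> - ((C + 1) * exp (K * (T - t)))))"
proof -
  define c where "c = (C + 1) * exp (K * T)"
  have c: "0 < c" using CKL by (simp add: c_def)
  obtain \<epsilon>0 where \<epsilon>0: "0 < \<epsilon>0" and const: "\<And>\<epsilon>. 0 < \<epsilon> \<Longrightarrow> \<epsilon> \<le> \<epsilon>0 \<Longrightarrow> \<forall>x>0. x \<le> (\<epsilon> * x powr (q / 4))\<^sup>2 \<longrightarrow>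
      x \<le> \<epsilon> \<and> K * x \<le> 1 / 2 \<and>
      K * (CARD('d) * c / sqrt x) powr (q - 1) * (CARD('d) * (\<epsilon> * x powr (q / 4))) \<le> 1 \<and>
      L * (1 + (CARD('d) * c / sqrt x) powr q) * x \<le> 1 / 2 \<and>
      L * (1 + (CARD('d) * c / sqrt x) powr (q / 2)) * (CARD('d) * (\<epsilon> * x powr (q / 4))) \<le> 1"
    using small_constants[OF CKL(2,3) q c, of "real CARD('d)"] by auto
  obtain \<gamma> where \<gamma>: "0 < \<gamma>" "\<And>x. x \<le> \<gamma> \<Longrightarrow> c * (exp x - 1) \<le> 1"
    using exp_slack[OF c] by blast
  \<comment> \<open>For \<epsilon> <= 1 the total error in the exponent is at most Q \<epsilon>, so
    \<epsilon> <= \<gamma> / Q fits it into the slack. The summand 1 keeps Q positive when K =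
    0.\<close>
  define Q where "Q = 1 + 3 * K + 2 * K\<^sup>2 * (T + 2)"
  have Q: "0 < Q" "3 * K + 2 * K\<^sup>2 * (T + 2) \<le> Q" using CKL T by (simp_all add: Q_def add_pos_nonneg)
  define \<epsilon> where "\<epsilon> = min (min \<epsilon>0 1) (\<gamma> / Q)"
  have \<epsilon>: "0 < \<epsilon>" "\<epsilon> \<le> \<epsilon>0" "\<epsilon> \<le> 1" "\<epsilon> \<le> \<gamma> / Q" using \<epsilon>0 \<gamma> Q by (auto simp: \<epsilon>_def)
  have slack: "(C + 1) * exp (K * T) * (exp (3 * K * \<epsilon> + 2 * K\<^sup>2 * \<epsilon> * (T + 2 * \<epsilon>)) - 1) \<le> 1"
  proof -
    have "3 * K * \<epsilon> + 2 * K\<^sup>2 * \<epsilon> * (T + 2 * \<epsilon>) \<le> 3 * K * \<epsilon> + 2 * K\<^sup>2 * \<epsilon> * (T + 2)"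
      using \<epsilon> by (intro add_left_mono mult_left_mono) auto
    also have "\<dots> = (3 * K + 2 * K\<^sup>2 * (T + 2)) * \<epsilon>" by (simp add: algebra_simps)
    also have "\<dots> \<le> Q * \<epsilon>" using Q(2) \<epsilon>(1) by (intro mult_right_mono) auto
    also have "\<dots> \<le> \<gamma>" using \<epsilon>(4) Q(1) by (simp add: pos_le_divide_eq mult.commute)
    finally show ?thesis using \<gamma>(2) unfolding c_def by blast
  qed
  \<comment> \<open>By now \<epsilon> is fixed by T, C, K, L, q and the dimension alone, so the
    index from which the three quantities are small does not depend on drivers and terminal
    conditions.\<close>
  have "eventually (\<lambda>N. Max ((\<lambda>(i, k).
                Linf_norm M (\<lambda>\<omega>. increment (\<tau> N) (\<lambda>t. WN N t \<omega> $ k) i)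
                  / ereal (increment (\<tau> N) (bracket M (WN N)) i powr (q / 4)))
                ` ({1..n N} \<times> UNIV)) < ereal \<epsilon>) sequentially"
    using \<epsilon> by (intro order_tendstoD(2)[OF W1]) simp
  moreover have "eventually (\<lambda>N. mesh (n N) (\<tau> N) < \<epsilon>) sequentially"
    using \<epsilon> by (intro order_tendstoD(2)[OF C1_mesh])
  moreover have "eventually (\<lambda>N. \<forall>t\<in>{0..T}. \<forall>k. \<bar>component_bracket M (WN N) k t - t\<bar> \<le> \<epsilon>) sequentially"
    by (rule bracket_convergence[OF T prob BM WN C3 \<epsilon>(1)])
  ultimately have "eventually (\<lambda>N. Max ((\<lambda>(i, k).
                Linf_norm M (\<lambda>\<omega>. increment (\<tau> N) (\<lambda>t. WN N t \<omega> $ k) i)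
                  / ereal (increment (\<tau> N) (bracket M (WN N)) i powr (q / 4)))
                ` ({1..n N} \<times> UNIV)) < ereal \<epsilon> \<and> mesh (n N) (\<tau> N) < \<epsilon> \<and>
        (\<forall>t\<in>{0..T}. \<forall>k. \<bar>component_bracket M (WN N) k t - t\<bar> \<le> \<epsilon>)) sequentially"
    by eventually_elim blast
  then obtain N0 where N0: "\<And>N. N0 \<le> N \<Longrightarrow> Max ((\<lambda>(i, k).
                Linf_norm M (\<lambda>\<omega>. increment (\<tau> N) (\<lambda>t. WN N t \<omega> $ k) i)
                  / ereal (increment (\<tau> N) (bracket M (WN N)) i powr (q / 4)))
                ` ({1..n N} \<times> UNIV)) < ereal \<epsilon> \<and> mesh (n N) (\<tau> N) < \<epsilon> \<and>
        (\<forall>t\<in>{0..T}. \<forall>k. \<bar>component_bracket M (WN N) k t - t\<bar> \<le> \<epsilon>)"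
    unfolding eventually_sequentially by blast
  show ?thesis
  proof (intro exI[of _ N0] allI impI)
    fix N and f :: "nat \<Rightarrow> real \<Rightarrow> 'a \<Rightarrow> real \<Rightarrow> real^'d \<Rightarrow> real" and \<xi> :: "nat \<Rightarrow> 'a \<Rightarrow> real"
    assume N: "N0 \<le> N"
    assume hyp: "\<forall>m\<in>{1, 2}.
         is_driver M T (n N) (\<tau> N) (natural_filtration M (WN N)) (f m) \<and>
         \<xi> m \<in> borel_measurable (natural_filtration M (WN N) T) \<and>
         Linf_norm M (\<xi> m) \<le> ereal C \<and>
         (\<forall>t\<in>{0..T}. \<forall>y z. AE \<omega> in M.
            \<bar>f m t \<omega> y z\<bar> \<le> K * (1 + \<bar>y\<bar> + norm z powr q)) \<and>
         (\<forall>t\<in>{0..T}. \<forall>y1 y2 z.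
            \<bar>y1\<bar> \<le> (C + 1) * exp (K * T) \<longrightarrow> \<bar>y2\<bar> \<le> (C + 1) * exp (K * T) \<longrightarrow>
            (AE \<omega> in M. \<bar>f m t \<omega> y1 z - f m t \<omega> y2 z\<bar> \<le> L * (1 + norm z powr q) * \<bar>y1 - y2\<bar>)) \<and>
         (\<forall>t\<in>{0..T}. \<forall>y z1 z2.
            \<bar>y\<bar> \<le> (C + 1) * exp (K * T) \<longrightarrow>
            (AE \<omega> in M. \<bar>f m t \<omega> y z1 - f m t \<omega> y z2\<bar>
               \<le> L * (1 + max (norm z1) (norm z2) powr (q / 2)) * norm (z1 - z2)))"
    assume f12: "\<forall>t\<in>{0..T}. \<forall>y z. AE \<omega> in M. f 1 t \<omega> y z \<ge> f 2 t \<omega> y z"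
    assume \<xi>12: "AE \<omega> in M. \<xi> 1 \<omega> \<ge> \<xi> 2 \<omega>"
    interpret G: grid_martingale M T "n N" "\<tau> N" "WN N"
      by (intro grid_martingale.intro time_grid.intro grid_martingale_axioms.intro prob T
          C1_grid WN orth C1_const C2)
    define \<beta> where "\<beta> = (\<lambda>i. \<epsilon> * G.h i powr (q / 4))"
    define \<rho> where "\<rho> = (\<lambda>i. CARD('d) * c / sqrt (G.h i))"
    define a where "a = (\<lambda>i. (1 + C) * exp (K * (1 + 2 * K * \<epsilon>) *
      (bracket M (WN N) T - bracket M (WN N) (\<tau> N i))) - 1)"
    have D: "\<forall>i<n N. AE \<omega> in M. \<forall>k. \<bar>G.D i \<omega> $ k\<bar> \<le> \<epsilon> * G.h i powr (q / 4)"
    proof (intro allI impI)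
      fix i assume i: "i < n N"
      have "AE \<omega> in M. \<bar>G.D i \<omega> $ k\<bar> \<le> \<epsilon> * G.h i powr (q / 4)" for k
      proof -
        let ?g = "\<lambda>(i, k). Linf_norm M (\<lambda>\<omega>. increment (\<tau> N) (\<lambda>t. WN N t \<omega> $ k) i)
            / ereal (increment (\<tau> N) (bracket M (WN N)) i powr (q / 4))"
        have "?g (Suc i, k) \<le> Max (?g ` ({1..n N} \<times> UNIV))"
          using i by (intro Max_ge imageI finite_imageI) auto
        then have less: "?g (Suc i, k) < ereal \<epsilon>" using N0[OF N] by (meson le_less_trans)
        have eq: "(\<lambda>\<omega>. increment (\<tau> N) (\<lambda>t. WN N t \<omega> $ k) (Suc i)) = (\<lambda>\<omega>. G.D i \<omega> $ k)"
          by (auto simp: increment_def G.D_def)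
        from less have "Linf_norm M (\<lambda>\<omega>. G.D i \<omega> $ k) / ereal (G.h i powr (q / 4)) < ereal \<epsilon>"
          unfolding prod.case eq G.h_def .
        then show ?thesis by (rule Linf_norm_quotient_less) (use G.h_pos[OF i] in simp)
      qed
      then have "AE \<omega> in M. \<forall>k\<in>UNIV. \<bar>G.D i \<omega> $ k\<bar> \<le> \<epsilon> * G.h i powr (q / 4)"
        by (subst AE_ball_countable) auto
      then show "AE \<omega> in M. \<forall>k. \<bar>G.D i \<omega> $ k\<bar> \<le> \<epsilon> * G.h i powr (q / 4)" by simp
    qed
    have mesh: "\<forall>i<n N. \<tau> N (Suc i) - \<tau> N i \<le> \<epsilon>"
    proof (intro allI impI)
      fix i assume i: "i < n N"
      have "\<bar>\<tau> N (Suc i) - \<tau> N i\<bar> \<le> mesh (n N) (\<tau> N)"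
        unfolding mesh_def using i by (intro Max_ge) auto
      then show "\<tau> N (Suc i) - \<tau> N i \<le> \<epsilon>" using N0[OF N] by linarith
    qed
    have br: "\<forall>i\<le>n N. \<bar>bracket M (WN N) (\<tau> N i) - \<tau> N i\<bar> \<le> \<epsilon>"
    proof (intro allI impI)
      fix i assume i: "i \<le> n N"
      show "\<bar>bracket M (WN N) (\<tau> N i) - \<tau> N i\<bar> \<le> \<epsilon>"
        unfolding G.bracket_grid[OF i, of undefined] using N0[OF N] G.\<tau>_in[OF i] by blast
    qed
    note small = G.small_gridI[OF CKL q(1) \<epsilon>(1) const[OF \<epsilon>(1,2), unfolded c_def] D mesh br slack]
    interpret S: small_grid M T "n N" "\<tau> N" "WN N" K L q c \<beta> \<rho> a
      using small(1) unfolding c_def \<beta>_def \<rho>_def a_def .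
    have a_n: "a (n N) = C" using small(2) unfolding a_def .
    have a_idx: "a (G.idx t) \<le> (C + 1) * exp (K * (T - t))" if "t \<in> {0..T}" for t
      using small(3)[OF that] unfolding a_def .
    have good: "S.good_driver (f m)" if "m \<in> {1, 2}" for m
      using hyp that by (intro S.good_driverI) (auto simp: c_def)
    have \<xi>: "AE \<omega> in M. \<bar>\<xi> m \<omega>\<bar> \<le> a (n N)" if "m \<in> {1, 2}" for m
    proof -
      have le: "Linf_norm M (\<xi> m) \<le> ereal C" using hyp that by blast
      have "AE \<omega> in M. ereal \<bar>\<xi> m \<omega>\<bar> \<le> Linf_norm M (\<xi> m)"
        unfolding Linf_norm_def by (rule esssup_AE)
      then show ?thesis
        unfolding a_n
      proof eventually_elim
        case (elim \<omega>)
        then have "ereal \<bar>\<xi> m \<omega>\<bar> \<le> ereal C" using le by (rule order_trans)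
        then show ?case by simp
      qed
    qed
    have order: "AE \<omega> in M. \<forall>y z. f 2 (\<tau> N (Suc i)) \<omega> y z \<le> f 1 (\<tau> N (Suc i)) \<omega> y z" if i: "i < n N" for i
    proof (rule S.driver_order_uniform)
      show "is_driver M T (n N) (\<tau> N) (natural_filtration M (WN N)) (f 1)"
        "is_driver M T (n N) (\<tau> N) (natural_filtration M (WN N)) (f 2)"
        using hyp by blast+
      show "\<tau> N (Suc i) \<in> {0..T}" using i by (intro G.\<tau>_in) simp
    qed (use f12 in blast)
    have "has_unique_solution M T (n N) (\<tau> N) (WN N) (f m) (\<xi> m)" if m: "m \<in> {1, 2}" for m
      unfolding has_unique_solution_def
    proof (intro conjI allI impI)
      have "\<xi> m \<in> borel_measurable (natural_filtration M (WN N) T)" using hyp m by blast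
      then show "\<exists>Y Z U. is_solution M T (n N) (\<tau> N) (WN N) (f m) (\<xi> m) Y Z U"
        by (rule S.solution_exists[OF good[OF m] _ \<xi>[OF m]])
    qed (rule S.solution_unique[OF _ _ good[OF m] \<xi>[OF m]])
    moreover have "AE \<omega> in M. \<forall>t\<in>{0..T}.
            (C + 1) * exp (K * (T - t)) \<ge> Y1 t \<omega> \<and> Y1 t \<omega> \<ge> Y2 t \<omega> \<and>
            Y2 t \<omega> \<ge> - ((C + 1) * exp (K * (T - t)))"
      if "is_solution M T (n N) (\<tau> N) (WN N) (f 1) (\<xi> 1) Y1 Z1 U1"
        "is_solution M T (n N) (\<tau> N) (WN N) (f 2) (\<xi> 2) Y2 Z2 U2" for Y1 Z1 U1 Y2 Z2 U2
      by (rule S.solution_bounds_all_times[OF that good good \<xi> \<xi> order \<xi>12 a_idx]) auto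
    ultimately show "(\<forall>m\<in>{1, 2}. has_unique_solution M T (n N) (\<tau> N) (WN N) (f m) (\<xi> m)) \<and>
      (\<forall>Y1 Z1 U1 Y2 Z2 U2.
         is_solution M T (n N) (\<tau> N) (WN N) (f 1) (\<xi> 1) Y1 Z1 U1 \<longrightarrow>
         is_solution M T (n N) (\<tau> N) (WN N) (f 2) (\<xi> 2) Y2 Z2 U2 \<longrightarrow>
         (AE \<omega> in M. \<forall>t\<in>{0..T}.
            (C + 1) * exp (K * (T - t)) \<ge> Y1 t \<omega> \<and> Y1 t \<omega> \<ge> Y2 t \<omega> \<and>
            Y2 t \<omega> \<ge> - ((C + 1) * exp (K * (T - t)))))"
      by blast
  qed
qed

end
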